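(* Let $n\ge1$, $0<s<1$, $r>0$, let $m$ be an integer with $m>n/2\ge m-1$, and let $g\in H^m(\mathbb R^n\setminus B_r)$. Let $\mathcal K_r:H^m(\mathbb R^n\setminus B_r)\to L^2(B_r)$ be the integral operator $(\mathcal K_rh)(x)=\int_{\mathbb R^n\setminus B_r}P_r(y,x)h(y)\,dy$, $x\in B_r$. Then $g$ can be reconstructed from the knowledge of $u_g:=\mathcal K_rg$ in $B_r$ as the limit $g=\lim_{\alpha\to0^+}g_\alpha$ in $H^m(\mathbb R^n\setminus B_r)$, where for $\alpha>0$ $$g_\alpha:=\arg\min_{h\in H^m(\mathbb R^n\setminus B_r)}\left[\|\mathcal K_rh-u_g\|_{L^2(B_r)}^2+\alpha\|h\|_{H^m(\mathbb R^n\setminus B_r)}^2\right].$$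
   Context: $B_r$ is the open ball of radius $r$ centered at $0$ in $\mathbb R^n$. $P_r$ is the fractional Poisson kernel of the ball, $$P_r(y,x):=c_{n,s}\left(\frac{r^2-|x|^2}{|y|^2-r^2}\right)^s\frac1{|x-y|^n},\qquad x\in B_r,\ y\in\mathbb R^n\setminus B_r,$$ with $c_{n,s}=\Gamma(n/2)\sin(\pi s)/\pi^{n/2+1}$. $H^m$ is the usual $L^2$-based Sobolev space of order $m$. *)

theory Defs
  imports "HOL-Analysis.Analysis"
begin

text \<open>Functions on a set \<open>S\<close> are represented by total functions of which only the values on \<open>S\<close>
  matter; elements of \<open>L\<^sup>2(S)\<close> and \<open>H\<^sup>m(S)\<close> are represented by functions, to be read up to
  equality almost everywhere on \<open>S\<close>. All functions are real-valued.\<close>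

definition L2_space :: "'a::euclidean_space set \<Rightarrow> ('a \<Rightarrow> real) set" where
  "L2_space S = {f. f \<in> borel_measurable (lebesgue_on S) \<and>
                    integrable (lebesgue_on S) (\<lambda>x. (f x)\<^sup>2)}"

definition L2_norm :: "'a::euclidean_space set \<Rightarrow> ('a \<Rightarrow> real) \<Rightarrow> real" where
  "L2_norm S f = sqrt (LINT x|lebesgue_on S. (f x)\<^sup>2)"

definition partial_deriv :: "'n::finite \<Rightarrow> (real^'n \<Rightarrow> real) \<Rightarrow> real^'n \<Rightarrow> real" where
  "partial_deriv i f x = frechet_derivative f (at x) (axis i 1)"

definition iter_partial_deriv :: "'n::finite list \<Rightarrow> (real^'n \<Rightarrow> real) \<Rightarrow> real^'n \<Rightarrow> real" where
  "iter_partial_deriv is f = foldr partial_deriv is f"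

text \<open>Differentiability of all iterated partial derivatives makes all of them continuous, so this
  is \<open>C\<^sup>\<infinity>(\<real>\<^sup>n)\<close>.\<close>

definition smooth :: "(real^'n::finite \<Rightarrow> real) \<Rightarrow> bool" where
  "smooth f \<longleftrightarrow> (\<forall>is x. iter_partial_deriv is f differentiable (at x))"

text \<open>A multi-index is a function \<open>\<beta> :: 'n \<Rightarrow> nat\<close>. The list below lists the coordinates with
  multiplicities \<open>\<beta>\<close> in an arbitrary order; for smooth functions the order is irrelevant.\<close>

definition multi_deriv :: "('n::finite \<Rightarrow> nat) \<Rightarrow> (real^'n \<Rightarrow> real) \<Rightarrow> real^'n \<Rightarrow> real" where
  "multi_deriv \<beta> f = iter_partial_deriv (SOME is. count_list is = \<beta>) f"

text \<open>For open \<open>S\<close> these are the functions in \<open>C\<^sub>c\<^sup>\<infinity>(S)\<close>. The interior is taken in order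
  to admit sets such as \<open>\<real>\<^sup>n - B\<^sub>r\<close>, whose boundary is a null set: the space \<open>H\<^sup>m(S)\<close> below is then
  that of the interior of \<open>S\<close>.\<close>

definition test_function :: "(real^'n::finite) set \<Rightarrow> (real^'n \<Rightarrow> real) \<Rightarrow> bool" where
  "test_function S \<phi> \<longleftrightarrow>
     smooth \<phi> \<and> compact (closure {x. \<phi> x \<noteq> 0}) \<and> closure {x. \<phi> x \<noteq> 0} \<subseteq> interior S"

definition L2_weak_deriv ::
    "(real^'n::finite) set \<Rightarrow> ('n \<Rightarrow> nat) \<Rightarrow> (real^'n \<Rightarrow> real) \<Rightarrow> (real^'n \<Rightarrow> real) \<Rightarrow> bool" where
  "L2_weak_deriv S \<beta> h v \<longleftrightarrow> h \<in> L2_space S \<and> v \<in> L2_space S \<and>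
     (\<forall>\<phi>. test_function S \<phi> \<longrightarrow>
        (LINT x|lebesgue_on S. h x * multi_deriv \<beta> \<phi> x) =
        (-1) ^ (\<Sum>i\<in>UNIV. \<beta> i) * (LINT x|lebesgue_on S. v x * \<phi> x))"

definition sobolev_space :: "(real^'n::finite) set \<Rightarrow> nat \<Rightarrow> (real^'n \<Rightarrow> real) set" where
  "sobolev_space S m = {h. \<forall>\<beta>. (\<Sum>i\<in>UNIV. \<beta> i) \<le> m \<longrightarrow> (\<exists>v. L2_weak_deriv S \<beta> h v)}"

text \<open>Weak derivatives are unique up to null sets (if the boundary of \<open>S\<close> is a null set), so the
  choice made here does not affect the norm.\<close>

definition sobolev_norm :: "(real^'n::finite) set \<Rightarrow> nat \<Rightarrow> (real^'n \<Rightarrow> real) \<Rightarrow> real" where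
  "sobolev_norm S m h =
     sqrt (\<Sum>\<beta> | (\<Sum>i\<in>UNIV. \<beta> i) \<le> m. (L2_norm S (SOME v. L2_weak_deriv S \<beta> h v))\<^sup>2)"

text \<open>The dimension \<open>n\<close> is \<open>CARD('n)\<close>.\<close>

definition poisson_kernel :: "real \<Rightarrow> real \<Rightarrow> real^'n::finite \<Rightarrow> real^'n \<Rightarrow> real" where
  "poisson_kernel s r y x =
     Gamma (real CARD('n) / 2) * sin (pi * s) / pi powr (real CARD('n) / 2 + 1)
       * ((r\<^sup>2 - (norm x)\<^sup>2) / ((norm y)\<^sup>2 - r\<^sup>2)) powr s
       * (1 / norm (x - y) ^ CARD('n))"

definition poisson_op :: "real \<Rightarrow> real \<Rightarrow> (real^'n::finite \<Rightarrow> real) \<Rightarrow> real^'n \<Rightarrow> real" where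
  "poisson_op s r h x = (LINT y|lebesgue_on (- ball 0 r). poisson_kernel s r y x * h y)"

definition tikhonov ::
    "real \<Rightarrow> real \<Rightarrow> nat \<Rightarrow> (real^'n::finite \<Rightarrow> real) \<Rightarrow> real \<Rightarrow> (real^'n \<Rightarrow> real) \<Rightarrow> real" where
  "tikhonov s r m u \<alpha> h =
     (L2_norm (ball 0 r) (\<lambda>x. poisson_op s r h x - u x))\<^sup>2
       + \<alpha> * (sobolev_norm (- ball 0 r) m h)\<^sup>2"

end

theory Submission
  imports Defs
begin

text \<open>The minimisers of the Tikhonov functional exist, are unique and converge to \<open>g\<close> as soon as the
  operator is bounded and injective on the Hilbert space \<open>H\<^sup>m\<close>; this is an exercise with the
  parallelogram law.

  Boundedness: along rays the elements of \<open>H\<^sup>1\<close> are absolutely continuous, which yields the Hardy-type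
  inequality \<open>\<integral> \<bar>h(y)\<bar>\<^sup>2 (\<bar>y\<bar> - r)\<^sup>-\<^sup>s dy \<le> C \<parallel>h\<parallel>\<^sup>2\<close>. Since \<open>\<integral> P(y,x) dy\<close> is bounded in \<open>x\<close> and
  \<open>\<integral> P(y,x) dx\<close> by a multiple of \<open>(\<bar>y\<bar> - r)\<^sup>-\<^sup>s\<close>, the Cauchy-Schwarz inequality bounds the \<open>L\<^sup>2\<close> norm of
  the image of \<open>h\<close>. Integrals are never transformed to polar coordinates: averaging over dilations and
  Fubini's theorem take their place.

  Injectivity: if the image of \<open>h\<close> vanishes then so does \<open>\<integral> f(y) \<bar>x - y\<bar>\<^sup>-\<^sup>n dy\<close> for all \<open>x\<close> in the ball, where
  \<open>f(y) = (\<bar>y\<bar>\<^sup>2 - r\<^sup>2)\<^sup>-\<^sup>s h(y)\<close>. Differentiating in \<open>x\<close> gives \<open>\<integral> f(y) \<bar>y\<bar>\<^sup>-\<^sup>n (e \<bullet> z)\<^sup>k dy = 0\<close> with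
  \<open>z = y / \<bar>y\<bar>\<^sup>2\<close> for all \<open>e\<close> and \<open>k\<close>, so \<open>f = 0\<close> by the Stone-Weierstrass theorem.\<close>

section \<open>Tikhonov regularisation\<close>

text \<open>Two obstacles shape the proof. The weight \<open>(norm y - r) powr (- s)\<close> fails
  to be square integrable at the sphere once s \<ge> 1/2, so that the Poisson integral of a mere L2
  function may diverge; one weak derivative has to absorb the weight.

  The second is hidden in the moment identities. A k-fold derivative along e of the n-th inverse
  power of the distance contains, besides the leading power of e \<bullet> (y - x), terms of lower
  degree with factors e \<bullet> e. These vanish as well, because the Laplacian sends the power -2b
  of the distance to a nonzero multiple of the power -2b - 2 whenever 2b \<ge> n; hence the
  vanishing of a potential passes on to all larger exponents.

  Spaces consist of functions rather than of classes, so norms are seminorms throughout. Weak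
  derivatives are chosen, and therefore linear only almost everywhere. Fubini is applied to Borel
  representatives extended by zero.\<close>

locale semi_inner_space =
  fixes V :: "('a \<Rightarrow> real) set" and B :: "('a \<Rightarrow> real) \<Rightarrow> ('a \<Rightarrow> real) \<Rightarrow> real"
  assumes lin: "h \<in> V \<Longrightarrow> k \<in> V \<Longrightarrow> (\<lambda>x. a * h x + b * k x) \<in> V"
    and comm: "h \<in> V \<Longrightarrow> k \<in> V \<Longrightarrow> B h k = B k h"
    and lin_left: "h \<in> V \<Longrightarrow> k \<in> V \<Longrightarrow> l \<in> V \<Longrightarrow>
        B (\<lambda>x. a * h x + b * k x) l = a * B h l + b * B k l"
    and pos: "h \<in> V \<Longrightarrow> 0 \<le> B h h"
begin

definition nrm :: "('a \<Rightarrow> real) \<Rightarrow> real" where "nrm h = sqrt (B h h)"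

lemma nrm_nonneg: "h \<in> V \<Longrightarrow> 0 \<le> nrm h"
  by (simp add: nrm_def pos)

lemma nrm_sq: "h \<in> V \<Longrightarrow> (nrm h)\<^sup>2 = B h h"
  by (simp add: nrm_def pos)

lemma quad:
  assumes "h \<in> V" "k \<in> V"
  shows "B (\<lambda>x. a * h x + b * k x) (\<lambda>x. a * h x + b * k x)
     = a\<^sup>2 * B h h + 2 * a * b * B h k + b\<^sup>2 * B k k"
proof -
  have l: "(\<lambda>x. a * h x + b * k x) \<in> V" by (rule lin[OF assms])
  have 1: "B h (\<lambda>x. a * h x + b * k x) = a * B h h + b * B h k"
    using comm[OF assms(1) l] lin_left[OF assms assms(1), of a b] comm[OF assms(2,1)] by simp
  have 2: "B k (\<lambda>x. a * h x + b * k x) = a * B h k + b * B k k"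
    using comm[OF assms(2) l] lin_left[OF assms assms(2), of a b] by simp
  show ?thesis
    unfolding lin_left[OF assms l] 1 2 by (simp add: algebra_simps power2_eq_square)
qed

lemma add_mem: "h \<in> V \<Longrightarrow> k \<in> V \<Longrightarrow> (\<lambda>x. h x + k x) \<in> V"
  using lin[of h k 1 1] by simp

lemma diff_mem: "h \<in> V \<Longrightarrow> k \<in> V \<Longrightarrow> (\<lambda>x. h x - k x) \<in> V"
  using lin[of h k 1 "-1"] by simp

lemma Cauchy_Schwarz:
  assumes "h \<in> V" "k \<in> V"
  shows "\<bar>B h k\<bar> \<le> nrm h * nrm k"
proof -
  have q: "0 \<le> a\<^sup>2 * B h h + 2 * a * b * B h k + b\<^sup>2 * B k k" for a b
    using pos[OF lin[OF assms, of a b]] quad[OF assms, of a b] by simp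
  have "(B h k)\<^sup>2 \<le> B h h * B k k"
  proof (cases "B k k = 0")
    case True
    have "B h k = 0"
    proof (rule ccontr)
      assume nz: "B h k \<noteq> 0"
      have "0 \<le> B h h + 2 * b * B h k" for b using q[of 1 b] True by simp
      \<comment> \<open>An affine function of \<open>b\<close> that is bounded below has slope 0; at
        this \<open>b\<close> it would take the value -1.\<close>
      from this[of "- (B h h + 1) / (2 * B h k)"] nz show False by (simp add: field_simps)
    qed
    then show ?thesis using True by simp
  next
    case False
    then have "B k k > 0" using pos[OF assms(2)] by simp
    \<comment> \<open>The minimiser of the quadratic form, taken without a division, so that the
      discriminant appears with the factor \<open>B k k\<close>.\<close>
    moreover have "0 \<le> B k k * (B h h * B k k - (B h k)\<^sup>2)"
      using q[of "B k k" "- B h k"] by (simp add: algebra_simps power2_eq_square)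
    ultimately show ?thesis by (simp add: zero_le_mult_iff)
  qed
  then have "sqrt ((B h k)\<^sup>2) \<le> sqrt (B h h * B k k)" by (rule real_sqrt_le_mono)
  then show ?thesis by (simp add: nrm_def real_sqrt_mult)
qed

lemma nrm_add_sq:
  assumes "h \<in> V" "k \<in> V"
  shows "(nrm (\<lambda>x. h x + k x))\<^sup>2 = (nrm h)\<^sup>2 + 2 * B h k + (nrm k)\<^sup>2"
  using quad[OF assms, of 1 1] nrm_sq assms add_mem[OF assms] by simp

lemma nrm_diff_sq:
  assumes "h \<in> V" "k \<in> V"
  shows "(nrm (\<lambda>x. h x - k x))\<^sup>2 = (nrm h)\<^sup>2 - 2 * B h k + (nrm k)\<^sup>2"
  using quad[OF assms, of 1 "-1"] nrm_sq assms diff_mem[OF assms] by simp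

lemma nrm_triangle:
  assumes "h \<in> V" "k \<in> V"
  shows "nrm (\<lambda>x. h x + k x) \<le> nrm h + nrm k"
proof (rule power2_le_imp_le)
  show "(nrm (\<lambda>x. h x + k x))\<^sup>2 \<le> (nrm h + nrm k)\<^sup>2"
    using nrm_add_sq[OF assms] Cauchy_Schwarz[OF assms] by (simp add: power2_sum)
  show "0 \<le> nrm h + nrm k" using assms nrm_nonneg by simp
qed

text \<open>\<open>V\<close> might be empty, so the zero function is produced as a combination of a
  given member.\<close>

lemma nrm_zero: "h \<in> V \<Longrightarrow> nrm (\<lambda>x. 0) = 0"
  using quad[of h h 0 0] by (simp add: nrm_def)

lemma nrm_diff_commute:
  assumes "h \<in> V" "k \<in> V"
  shows "nrm (\<lambda>x. h x - k x) = nrm (\<lambda>x. k x - h x)"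
proof (rule power2_eq_imp_eq)
  show "(nrm (\<lambda>x. h x - k x))\<^sup>2 = (nrm (\<lambda>x. k x - h x))\<^sup>2"
    using nrm_diff_sq[OF assms] nrm_diff_sq[OF assms(2,1)] comm[OF assms] by simp
qed (use nrm_nonneg diff_mem assms in auto)

lemma nrm_triangle_diff:
  assumes "h \<in> V" "k \<in> V" "l \<in> V"
  shows "nrm (\<lambda>x. h x - l x) \<le> nrm (\<lambda>x. h x - k x) + nrm (\<lambda>x. k x - l x)"
  using nrm_triangle[OF diff_mem[OF assms(1,2)] diff_mem[OF assms(2,3)]] by simp

text \<open>The parallelogram law for the halves of \<open>h\<close> and \<open>k\<close>. The exact
  defect term is what later turns nearly minimal values into small distances.\<close>

lemma midpoint:
  assumes "h \<in> V" "k \<in> V"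
  shows "(nrm (\<lambda>x. (h x + k x) / 2))\<^sup>2
    = ((nrm h)\<^sup>2 + (nrm k)\<^sup>2) / 2 - (nrm (\<lambda>x. h x - k x))\<^sup>2 / 4"
proof -
  have "(\<lambda>x. (h x + k x) / 2) = (\<lambda>x. (1/2) * h x + (1/2) * k x)" by (auto simp: field_simps)
  moreover have "(\<lambda>x. (1/2) * h x + (1/2) * k x) \<in> V" by (rule lin[OF assms])
  ultimately have "(nrm (\<lambda>x. (h x + k x) / 2))\<^sup>2 = B h h / 4 + B h k / 2 + B k k / 4"
    using quad[OF assms, of "1/2" "1/2"] nrm_sq[of "\<lambda>x. (1/2) * h x + (1/2) * k x"]
    by (simp add: power2_eq_square[of "1/2"])
  then show ?thesis
    using nrm_diff_sq[OF assms] by (simp add: nrm_sq assms field_simps)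
qed

end

section \<open>Minimisers of a quadratic functional built from two seminorms\<close>

locale tikhonov_setting =
  N: semi_inner_space V BN + M: semi_inner_space V BM
  for V :: "('a \<Rightarrow> real) set" and BN BM +
  fixes C :: real
  assumes bound: "h \<in> V \<Longrightarrow> M.nrm h \<le> C * N.nrm h"
    and complete: "(\<And>k. f k \<in> V) \<Longrightarrow>
       (\<And>e. e > 0 \<Longrightarrow> \<exists>K. \<forall>j\<ge>K. \<forall>k\<ge>K. N.nrm (\<lambda>x. f j x - f k x) < e) \<Longrightarrow>
       \<exists>h\<in>V. (\<lambda>k. N.nrm (\<lambda>x. f k x - h x)) \<longlonglongrightarrow> 0"
    and inj: "h \<in> V \<Longrightarrow> M.nrm h = 0 \<Longrightarrow> N.nrm h = 0"
begin

text \<open>The operator enters only through \<open>M.nrm\<close>, the L2 norm of the image. By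
  linearity the misfit between the images of \<open>h\<close> and \<open>g\<close> is the image of
  \<open>h - g\<close>, so the functional can be written without a target space.\<close>

definition J :: "('a \<Rightarrow> real) \<Rightarrow> real \<Rightarrow> ('a \<Rightarrow> real) \<Rightarrow> real" where
  "J g \<alpha> h = (M.nrm (\<lambda>x. h x - g x))\<^sup>2 + \<alpha> * (N.nrm h)\<^sup>2"

text \<open>Uniform convexity: the misfit is merely convex and its defect is dropped, while the
  penalty contributes its full defect with factor \<alpha>.\<close>

lemma J_midpoint:
  assumes "g \<in> V" "h \<in> V" "k \<in> V" "\<alpha> > 0"
  shows "J g \<alpha> (\<lambda>x. (h x + k x) / 2) \<le> (J g \<alpha> h + J g \<alpha> k) / 2
    - \<alpha> * (N.nrm (\<lambda>x. h x - k x))\<^sup>2 / 4"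
proof -
  have "(\<lambda>x. (h x + k x) / 2 - g x) = (\<lambda>x. ((h x - g x) + (k x - g x)) / 2)"
    by (auto simp: field_simps)
  then have "(M.nrm (\<lambda>x. (h x + k x) / 2 - g x))\<^sup>2
     \<le> ((M.nrm (\<lambda>x. h x - g x))\<^sup>2 + (M.nrm (\<lambda>x. k x - g x))\<^sup>2) / 2"
    by (simp only: M.midpoint[OF N.diff_mem[OF assms(2,1)] N.diff_mem[OF assms(3,1)]]) (simp add: field_simps)
  then show ?thesis
    unfolding J_def N.midpoint[OF assms(2,3)] using assms(4) by (simp add: field_simps)
qed

lemma mid_mem: "h \<in> V \<Longrightarrow> k \<in> V \<Longrightarrow> (\<lambda>x. (h x + k x) / 2) \<in> V"
  using N.lin[of h k "1/2" "1/2"] by (simp add: field_simps)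

lemma J_nonneg: "g \<in> V \<Longrightarrow> h \<in> V \<Longrightarrow> \<alpha> > 0 \<Longrightarrow> 0 \<le> J g \<alpha> h"
  by (simp add: J_def)

text \<open>Both seminorms are continuous along the sequence, the misfit by \<open>bound\<close>; so
  the limit of a minimising sequence is a minimiser.\<close>

lemma J_lsc:
  assumes V: "g \<in> V" "h \<in> V" "\<And>k. f k \<in> V"
    and lim: "(\<lambda>k. N.nrm (\<lambda>x. f k x - h x)) \<longlonglongrightarrow> 0"
    and Jl: "(\<lambda>k. J g \<alpha> (f k)) \<longlonglongrightarrow> c" and "\<alpha> > 0"
  shows "J g \<alpha> h \<le> c"
proof -
  have tr: "\<bar>N.nrm (f k) - N.nrm h\<bar> \<le> N.nrm (\<lambda>x. f k x - h x)" for k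
    using N.nrm_triangle[OF V(2) N.diff_mem[OF V(3) V(2)], of k]
      N.nrm_triangle[OF V(3) N.diff_mem[OF V(2) V(3)], of k k] N.nrm_diff_commute[OF V(2) V(3), of k]
    by simp
  have "(\<lambda>k. N.nrm (f k) - N.nrm h) \<longlonglongrightarrow> 0"
    by (rule Lim_null_comparison[OF _ lim]) (simp add: tr)
  then have lN: "(\<lambda>k. N.nrm (f k)) \<longlonglongrightarrow> N.nrm h" by (simp add: LIM_zero_iff)
  have limM: "(\<lambda>k. C * N.nrm (\<lambda>x. f k x - h x)) \<longlonglongrightarrow> 0" by (rule tendsto_mult_right_zero[OF lim])
  have tr: "\<bar>M.nrm (\<lambda>x. f k x - g x) - M.nrm (\<lambda>x. h x - g x)\<bar> \<le> C * N.nrm (\<lambda>x. f k x - h x)" for k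
    using M.nrm_triangle_diff[OF V(3) V(2) V(1), of k] M.nrm_triangle_diff[OF V(2) V(3) V(1), of k]
      M.nrm_diff_commute[OF V(2) V(3), of k] bound[OF N.diff_mem[OF V(3) V(2)], of k] by simp
  have "(\<lambda>k. M.nrm (\<lambda>x. f k x - g x) - M.nrm (\<lambda>x. h x - g x)) \<longlonglongrightarrow> 0"
    by (rule Lim_null_comparison[OF _ limM]) (simp add: tr)
  then have lM: "(\<lambda>k. M.nrm (\<lambda>x. f k x - g x)) \<longlonglongrightarrow> M.nrm (\<lambda>x. h x - g x)" by (simp add: LIM_zero_iff)
  have "(\<lambda>k. J g \<alpha> (f k)) \<longlonglongrightarrow> J g \<alpha> h"
    unfolding J_def by (intro tendsto_intros lN lM)
  then show ?thesis using LIMSEQ_unique Jl by blast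
qed

lemma minimiser_exists:
  assumes g: "g \<in> V" and \<alpha>: "\<alpha> > 0"
  shows "\<exists>h. is_arg_min (J g \<alpha>) (\<lambda>h. h \<in> V) h"
proof -
  define c where "c = (INF h\<in>V. J g \<alpha> h)"
  have bdd: "bdd_below (J g \<alpha> ` V)" using J_nonneg[OF g _ \<alpha>] by (auto intro!: bdd_belowI)
  have lo: "c \<le> J g \<alpha> h" if "h \<in> V" for h
    unfolding c_def by (rule cINF_lower[OF bdd that])
  have "\<exists>h\<in>V. J g \<alpha> h < c + 1 / real (Suc k)" for k
    using cINF_less_iff[OF _ bdd, of "c + 1 / real (Suc k)"] g unfolding c_def[symmetric] by auto
  then obtain f where f: "\<And>k. f k \<in> V" "\<And>k. J g \<alpha> (f k) < c + 1 / real (Suc k)" by metis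
  \<comment> \<open>A minimising sequence is Cauchy of its own accord: the value at a midpoint is at
    least \<open>c\<close>, so the convexity defect is at most the mean excess of the two values
    over \<open>c\<close>.\<close>
  have d: "\<alpha> * (N.nrm (\<lambda>x. f j x - f k x))\<^sup>2 \<le> 4 * (1 / real (Suc K))" if "j \<ge> K" "k \<ge> K" for j k K
  proof -
    have "1 / real (Suc j) \<le> 1 / real (Suc K)" "1 / real (Suc k) \<le> 1 / real (Suc K)"
      using that by (auto simp: field_simps)
    then show ?thesis
      using J_midpoint[OF g f(1) f(1) \<alpha>, of j k] lo[OF mid_mem[OF f(1) f(1)], of j k] f(2)[of j] f(2)[of k]
      by argo
  qed
  have "\<exists>K. \<forall>j\<ge>K. \<forall>k\<ge>K. N.nrm (\<lambda>x. f j x - f k x) < e" if "e > 0" for e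
  proof -
    have "0 < \<alpha> * e\<^sup>2 / 4" using that \<alpha> by simp
    then obtain K where "inverse (real (Suc K)) < \<alpha> * e\<^sup>2 / 4" using reals_Archimedean by blast
    then have "4 * (1 / real (Suc K)) < \<alpha> * e\<^sup>2" by (simp add: field_simps)
    then have "\<alpha> * (N.nrm (\<lambda>x. f j x - f k x))\<^sup>2 < \<alpha> * e\<^sup>2" if "j \<ge> K" "k \<ge> K" for j k
      using d[OF that] by linarith
    then have "N.nrm (\<lambda>x. f j x - f k x) < e" if "j \<ge> K" "k \<ge> K" for j k
      using \<alpha> \<open>e > 0\<close> that by (meson less_imp_le mult_less_cancel_left_pos power2_less_imp_less)
    then show ?thesis by blast
  qed
  then obtain h where h: "h \<in> V" "(\<lambda>k. N.nrm (\<lambda>x. f k x - h x)) \<longlonglongrightarrow> 0"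
    using complete[of f, OF f(1)] by blast
  have "(\<lambda>k. c + 1 / real (Suc k)) \<longlonglongrightarrow> c + 0"
    by (intro tendsto_intros) (use LIMSEQ_inverse_real_of_nat in \<open>simp add: inverse_eq_divide\<close>)
  then have "(\<lambda>k. J g \<alpha> (f k)) \<longlonglongrightarrow> c"
    using tendsto_sandwich[of "\<lambda>_. c" "\<lambda>k. J g \<alpha> (f k)" sequentially "\<lambda>k. c + 1 / real (Suc k)" c]
      lo f less_imp_le by (simp add: always_eventually) (smt (verit, best) always_eventually)
  then have "J g \<alpha> h \<le> c" using J_lsc[OF g h(1) f(1) h(2) _ \<alpha>] by blast
  then show ?thesis using h(1) lo unfolding is_arg_min_linorder by fastforce
qed

lemma minimiser_unique:
  assumes g: "g \<in> V" and \<alpha>: "\<alpha> > 0"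
    and h: "is_arg_min (J g \<alpha>) (\<lambda>h. h \<in> V) h" and k: "is_arg_min (J g \<alpha>) (\<lambda>h. h \<in> V) k"
  shows "N.nrm (\<lambda>x. h x - k x) = 0"
proof -
  have V: "h \<in> V" "k \<in> V" using h k by (auto simp: is_arg_min_def)
  have "J g \<alpha> h \<le> J g \<alpha> (\<lambda>x. (h x + k x) / 2)" "J g \<alpha> k \<le> J g \<alpha> (\<lambda>x. (h x + k x) / 2)"
    using h k mid_mem[OF V] by (auto simp: is_arg_min_linorder)
  then have "\<alpha> * (N.nrm (\<lambda>x. h x - k x))\<^sup>2 \<le> 0"
    using J_midpoint[OF g V \<alpha>] by argo
  then show ?thesis using \<alpha> by (simp add: mult_le_0_iff)
qed

text \<open>Convergence of the regularised solutions needs neither weak compactness nor adjoints: if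
  \<open>\<beta> < \<alpha>\<close> then the midpoint of the two minimisers competes with the minimiser for \<open>\<alpha>\<close>, and the
  parallelogram law gives \<open>\<parallel>h\<^sub>\<beta> - h\<^sub>\<alpha>\<parallel>\<^sup>2 \<le> 2 (\<parallel>h\<^sub>\<beta>\<parallel>\<^sup>2 - \<parallel>h\<^sub>\<alpha>\<parallel>\<^sup>2)\<close>.\<close>

lemma minimisers_converge:
  assumes g: "g \<in> V"
    and G: "\<And>\<alpha>. \<alpha> > 0 \<Longrightarrow> is_arg_min (J g \<alpha>) (\<lambda>h. h \<in> V) (G \<alpha>)"
  shows "((\<lambda>\<alpha>. N.nrm (\<lambda>x. G \<alpha> x - g x)) \<longlongrightarrow> 0) (at_right 0)"
proof -
  have V: "G \<alpha> \<in> V" if "\<alpha> > 0" for \<alpha> using G[OF that] by (auto simp: is_arg_min_def)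
  have min: "J g \<alpha> (G \<alpha>) \<le> J g \<alpha> h" if "\<alpha> > 0" "h \<in> V" for \<alpha> h
    using G[OF that(1)] that(2) by (auto simp: is_arg_min_linorder)
  define m where "m \<alpha> = (M.nrm (\<lambda>x. G \<alpha> x - g x))\<^sup>2" for \<alpha>
  define n where "n \<alpha> = (N.nrm (G \<alpha>))\<^sup>2" for \<alpha>
  \<comment> \<open>\<open>g\<close> itself competes with misfit 0, which bounds both the misfit and
    the norm of \<open>G \<alpha>\<close>.\<close>
  have "J g \<alpha> g = \<alpha> * (N.nrm g)\<^sup>2" if "\<alpha> > 0" for \<alpha>
    unfolding J_def using M.nrm_diff_sq[OF g g] M.nrm_sq[OF g] by simp
  then have mn: "m \<alpha> + \<alpha> * n \<alpha> \<le> \<alpha> * (N.nrm g)\<^sup>2" if "\<alpha> > 0" for \<alpha>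
    using min[OF that g] that unfolding J_def m_def n_def by simp
  have mle: "m \<alpha> \<le> \<alpha> * (N.nrm g)\<^sup>2" if "\<alpha> > 0" for \<alpha>
    using mn[OF that] that by (smt (verit) n_def mult_nonneg_nonneg zero_le_power2)
  have nle: "n \<alpha> \<le> (N.nrm g)\<^sup>2" if "\<alpha> > 0" for \<alpha>
    using mn[OF that] that by (smt (verit) m_def mult_le_cancel_left_pos zero_le_power2)
  have key: "n \<alpha> \<le> n \<beta> \<and> (N.nrm (\<lambda>x. G \<beta> x - G \<alpha> x))\<^sup>2 \<le> 2 * (n \<beta> - n \<alpha>)"
    if "0 < \<beta>" "\<beta> < \<alpha>" for \<alpha> \<beta>
  proof -
    have p: "\<alpha> > 0" using that by simp
    have 1: "m \<alpha> + \<alpha> * n \<alpha> \<le> m \<beta> + \<alpha> * n \<beta>" using min[OF p V[OF that(1)]] unfolding J_def m_def n_def .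
    have 2: "m \<beta> + \<beta> * n \<beta> \<le> m \<alpha> + \<beta> * n \<alpha>" using min[OF that(1) V[OF p]] unfolding J_def m_def n_def .
    \<comment> \<open>Adding the two minimality inequalities cancels the misfits: norms grow as the
      parameter decreases, and by the second inequality misfits shrink.\<close>
    from 1 2 have "(\<alpha> - \<beta>) * (n \<alpha> - n \<beta>) \<le> 0" by (simp add: algebra_simps)
    then have n: "n \<alpha> \<le> n \<beta>" using that by (simp add: mult_le_0_iff)
    then have "\<beta> * n \<alpha> \<le> \<beta> * n \<beta>" using that by simp
    then have mm: "m \<beta> \<le> m \<alpha>" using 2 by linarith
    have "(\<lambda>x. (G \<beta> x + G \<alpha> x) / 2 - g x) = (\<lambda>x. ((G \<beta> x - g x) + (G \<alpha> x - g x)) / 2)"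
      by (auto simp: field_simps)
    then have "(M.nrm (\<lambda>x. (G \<beta> x + G \<alpha> x) / 2 - g x))\<^sup>2 \<le> (m \<beta> + m \<alpha>) / 2"
      unfolding m_def
      by (simp only: M.midpoint[OF N.diff_mem[OF V[OF that(1)] g] N.diff_mem[OF V[OF p] g]]) (simp add: field_simps)
    then have "(M.nrm (\<lambda>x. (G \<beta> x + G \<alpha> x) / 2 - g x))\<^sup>2 \<le> m \<alpha>" using mm by simp
    with min[OF p mid_mem[OF V[OF that(1)] V[OF p]]]
    have "\<alpha> * n \<alpha> \<le> \<alpha> * (N.nrm (\<lambda>x. (G \<beta> x + G \<alpha> x) / 2))\<^sup>2"
      unfolding J_def m_def n_def by linarith
    then have "n \<alpha> \<le> (N.nrm (\<lambda>x. (G \<beta> x + G \<alpha> x) / 2))\<^sup>2" using p by simp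
    then show ?thesis
      unfolding N.midpoint[OF V[OF that(1)] V[OF p]] n_def[symmetric] using n by argo
  qed
  \<comment> \<open>Completeness speaks of sequences, so the limit is first found along parameters
    tending to 0. Their norms increase and are bounded by that of \<open>g\<close>, whence the gaps
    in \<open>key\<close> become small.\<close>
  define a where "a k = inverse (real (Suc k))" for k
  have a0: "a k > 0" for k by (simp add: a_def)
  have mono: "n (a j) \<le> n (a k)" if "j \<le> k" for j k
  proof (cases "j = k")
    case False
    then have "a k < a j" using that by (simp add: a_def)
    then show ?thesis using key[OF a0] by blast
  qed simp
  have "incseq (\<lambda>k. n (a k))" using mono by (simp add: incseq_def)
  then obtain L where L: "(\<lambda>k. n (a k)) \<longlonglongrightarrow> L" "\<And>k. n (a k) \<le> L"
    using incseq_convergent[of "\<lambda>k. n (a k)" "(N.nrm g)\<^sup>2"] nle[OF a0] by blast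
  have nL: "n \<beta> \<le> L" if "\<beta> > 0" for \<beta>
  proof -
    obtain k where "a k < \<beta>" using reals_Archimedean[OF \<open>\<beta> > 0\<close>] by (auto simp: a_def)
    then show ?thesis using key[OF a0] L(2)[of k] by fastforce
  qed
  \<comment> \<open>The estimate is uniform over all \<open>\<beta>\<close> up to
    \<open>a k\<close>, not only over the sequence; this carries the limit over to the filter
    \<open>at_right 0\<close>.\<close>
  have near: "\<exists>K. \<forall>k\<ge>K. \<forall>\<beta>>0. \<beta> \<le> a k \<longrightarrow> N.nrm (\<lambda>x. G \<beta> x - G (a k) x) < e" if "e > 0" for e
  proof -
    have "0 < e\<^sup>2 / 2" using that by simp
    then obtain K where K: "\<And>k. k \<ge> K \<Longrightarrow> \<bar>n (a k) - L\<bar> < e\<^sup>2 / 2"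
      using L(1) by (metis LIMSEQ_iff real_norm_def)
    have "N.nrm (\<lambda>x. G \<beta> x - G (a k) x) < e" if k: "k \<ge> K" and b: "\<beta> > 0" "\<beta> \<le> a k" for k \<beta>
    proof (cases "\<beta> = a k")
      case True
      show ?thesis unfolding True using N.nrm_zero[OF V[OF a0]] \<open>e > 0\<close> by simp
    next
      case False
      then have "(N.nrm (\<lambda>x. G \<beta> x - G (a k) x))\<^sup>2 < e\<^sup>2"
        using key[of \<beta> "a k"] b K[OF k] nL[OF b(1)] by argo
      then show ?thesis using \<open>e > 0\<close> by (meson less_imp_le power2_less_imp_less)
    qed
    then show ?thesis by blast
  qed
  have "\<exists>h\<in>V. (\<lambda>k. N.nrm (\<lambda>x. G (a k) x - h x)) \<longlonglongrightarrow> 0"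
  proof (rule complete)
    show "G (a k) \<in> V" for k by (rule V[OF a0])
    fix e :: real assume "e > 0"
    then obtain K where K: "\<forall>k\<ge>K. \<forall>\<beta>>0. \<beta> \<le> a k \<longrightarrow> N.nrm (\<lambda>x. G \<beta> x - G (a k) x) < e / 2"
      using near[of "e/2"] by auto
    have aK: "a j \<le> a K" if "j \<ge> K" for j using that by (simp add: a_def)
    have nK: "N.nrm (\<lambda>x. G (a j) x - G (a K) x) < e / 2" if "j \<ge> K" for j
      using K aK[OF that] a0 by blast
    have "N.nrm (\<lambda>x. G (a j) x - G (a k) x) < e" if "j \<ge> K" "k \<ge> K" for j k
      using N.nrm_triangle_diff[OF V[OF a0] V[OF a0] V[OF a0], of j k K]
        N.nrm_diff_commute[OF V[OF a0] V[OF a0], of K k] nK[OF that(1)] nK[OF that(2)]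
      by argo
    then show "\<exists>K. \<forall>j\<ge>K. \<forall>k\<ge>K. N.nrm (\<lambda>x. G (a j) x - G (a k) x) < e" by blast
  qed
  then obtain h where h: "h \<in> V" "(\<lambda>k. N.nrm (\<lambda>x. G (a k) x - h x)) \<longlonglongrightarrow> 0" by blast
  have "(\<lambda>k. m (a k)) \<longlonglongrightarrow> 0"
  proof (rule Lim_null_comparison)
    show "\<forall>\<^sub>F k in sequentially. norm (m (a k)) \<le> a k * (N.nrm g)\<^sup>2"
      using mle[OF a0] by (auto simp: m_def)
    have "a \<longlonglongrightarrow> 0" unfolding a_def by (rule LIMSEQ_inverse_real_of_nat)
    then show "(\<lambda>k. a k * (N.nrm g)\<^sup>2) \<longlonglongrightarrow> 0" by (rule tendsto_mult_left_zero)
  qed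
  then have "(\<lambda>k. sqrt (m (a k))) \<longlonglongrightarrow> sqrt 0" by (rule tendsto_real_sqrt)
  then have mlim: "(\<lambda>k. M.nrm (\<lambda>x. G (a k) x - g x)) \<longlonglongrightarrow> 0"
    using M.nrm_nonneg[OF N.diff_mem[OF V[OF a0] g]] by (simp add: m_def)
  \<comment> \<open>The limit \<open>h\<close> has the same image as \<open>g\<close>, because the
    misfits tend to 0; \<open>inj\<close> then puts \<open>h\<close> at distance 0 from
    \<open>g\<close>.\<close>
  have "M.nrm (\<lambda>x. h x - g x) \<le> C * N.nrm (\<lambda>x. G (a k) x - h x) + M.nrm (\<lambda>x. G (a k) x - g x)" for k
    using M.nrm_triangle_diff[OF h(1) V[OF a0] g, of k] M.nrm_diff_commute[OF h(1) V[OF a0], of k]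
      bound[OF N.diff_mem[OF V[OF a0] h(1)], of k] by linarith
  moreover have "(\<lambda>k. C * N.nrm (\<lambda>x. G (a k) x - h x) + M.nrm (\<lambda>x. G (a k) x - g x)) \<longlonglongrightarrow> C * 0 + 0"
    by (intro tendsto_intros h(2) mlim)
  ultimately have "M.nrm (\<lambda>x. h x - g x) \<le> 0"
    using LIMSEQ_le_const by (metis (no_types, lifting) add.right_neutral mult_zero_right)
  then have "N.nrm (\<lambda>x. h x - g x) = 0"
    using inj[OF N.diff_mem[OF h(1) g]] M.nrm_nonneg[OF N.diff_mem[OF h(1) g]] by simp
  then have le: "N.nrm (\<lambda>x. G (a k) x - g x) \<le> N.nrm (\<lambda>x. G (a k) x - h x)" for k
    using N.nrm_triangle_diff[OF V[OF a0] h(1) g, of k] by simp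
  show ?thesis
  proof (rule tendstoI)
    fix e :: real assume "e > 0"
    then obtain K where K: "\<forall>k\<ge>K. \<forall>\<beta>>0. \<beta> \<le> a k \<longrightarrow> N.nrm (\<lambda>x. G \<beta> x - G (a k) x) < e / 2"
      using near[of "e/2"] by auto
    have "e / 2 > 0" using \<open>e > 0\<close> by simp
    then obtain K' where K': "\<And>k. k \<ge> K' \<Longrightarrow> \<bar>N.nrm (\<lambda>x. G (a k) x - h x)\<bar> < e / 2"
      using LIMSEQ_D[OF h(2) \<open>e / 2 > 0\<close>] by auto
    define k where "k = max K K'"
    have "dist (N.nrm (\<lambda>x. G \<beta> x - g x)) 0 < e" if b: "\<beta> > 0" "\<beta> < a k" for \<beta>
    proof -
      have "N.nrm (\<lambda>x. G \<beta> x - G (a k) x) < e / 2" using K b by (simp add: k_def)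
      moreover have "N.nrm (\<lambda>x. G (a k) x - g x) < e / 2"
        using le[of k] K'[of k] by (simp add: k_def)
      moreover have "0 \<le> N.nrm (\<lambda>x. G \<beta> x - g x)" using N.nrm_nonneg[OF N.diff_mem[OF V[OF b(1)] g]] .
      ultimately show ?thesis
        using N.nrm_triangle_diff[OF V[OF b(1)] V[OF a0] g, of k] by simp
    qed
    then show "\<forall>\<^sub>F \<alpha> in at_right 0. dist (N.nrm (\<lambda>x. G \<alpha> x - g x)) 0 < e"
      unfolding eventually_at_right_field using a0 by blast
  qed
qed

end

section \<open>Square-integrable functions\<close>

definition square_integrable :: "'a measure \<Rightarrow> ('a \<Rightarrow> real) set" where
  "square_integrable M = {f \<in> borel_measurable M. integrable M (\<lambda>x. (f x)\<^sup>2)}"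

lemma square_integrableI_nn:
  assumes "f \<in> borel_measurable M" "(\<integral>\<^sup>+x. ennreal ((f x)\<^sup>2) \<partial>M) < \<infinity>"
  shows "f \<in> square_integrable M"
  using assms by (auto simp: square_integrable_def integrable_iff_bounded)

lemma square_integrable_nn:
  assumes "f \<in> square_integrable M"
  shows "(\<integral>\<^sup>+x. ennreal ((f x)\<^sup>2) \<partial>M) = ennreal (\<integral>x. (f x)\<^sup>2 \<partial>M)"
  using assms by (intro nn_integral_eq_integral) (auto simp: square_integrable_def)

lemma abs_mult_le_sum_squares: "\<bar>a * b\<bar> \<le> a\<^sup>2 + b\<^sup>2" for a b :: real
  using sum_squares_bound[of "\<bar>a\<bar>" "\<bar>b\<bar>"] zero_le_power2[of a] zero_le_power2[of b]
    abs_ge_zero[of "a * b"] unfolding power2_abs abs_mult by linarith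

lemma square_integrable_mult:
  assumes "f \<in> square_integrable M" "g \<in> square_integrable M"
  shows "integrable M (\<lambda>x. f x * g x)"
proof (rule Bochner_Integration.integrable_bound)
  show "integrable M (\<lambda>x. (f x)\<^sup>2 + (g x)\<^sup>2)" using assms by (auto simp: square_integrable_def)
  show "(\<lambda>x. f x * g x) \<in> borel_measurable M" using assms by (auto simp: square_integrable_def)
  show "AE x in M. norm (f x * g x) \<le> norm ((f x)\<^sup>2 + (g x)\<^sup>2)"
    using abs_mult_le_sum_squares[of "f _" "g _"] by simp
qed

lemma square_integrable_lin:
  assumes "f \<in> square_integrable M" "g \<in> square_integrable M"
  shows "(\<lambda>x. a * f x + b * g x) \<in> square_integrable M"
proof -
  have "integrable M (\<lambda>x. a\<^sup>2 * (f x)\<^sup>2 + 2 * a * b * (f x * g x) + b\<^sup>2 * (g x)\<^sup>2)"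
    using assms square_integrable_mult[OF assms] by (auto simp: square_integrable_def)
  moreover have "(\<lambda>x. a\<^sup>2 * (f x)\<^sup>2 + 2 * a * b * (f x * g x) + b\<^sup>2 * (g x)\<^sup>2) = (\<lambda>x. (a * f x + b * g x)\<^sup>2)"
    by (auto simp: algebra_simps power2_eq_square)
  ultimately show ?thesis using assms by (auto simp: square_integrable_def)
qed

interpretation L2: semi_inner_space "square_integrable M" "\<lambda>f g. \<integral>x. f x * g x \<partial>M" for M
proof
  fix h k l :: "'a \<Rightarrow> real" and a b :: real
  assume h: "h \<in> square_integrable M" and k: "k \<in> square_integrable M"
  show "(\<lambda>x. a * h x + b * k x) \<in> square_integrable M" by (rule square_integrable_lin[OF h k])
  show "(\<integral>x. h x * k x \<partial>M) = (\<integral>x. k x * h x \<partial>M)" by (simp add: mult.commute)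
  assume l: "l \<in> square_integrable M"
  have "(\<integral>x. (a * h x + b * k x) * l x \<partial>M) = (\<integral>x. a * (h x * l x) + b * (k x * l x) \<partial>M)"
    by (simp add: algebra_simps)
  also have "\<dots> = a * (\<integral>x. h x * l x \<partial>M) + b * (\<integral>x. k x * l x \<partial>M)"
    using square_integrable_mult[OF h l] square_integrable_mult[OF k l] by simp
  finally show "(\<integral>x. (a * h x + b * k x) * l x \<partial>M) = a * (\<integral>x. h x * l x \<partial>M) + b * (\<integral>x. k x * l x \<partial>M)" .
qed simp

lemma L2_nrm_eq: "L2.nrm M f = sqrt (\<integral>x. (f x)\<^sup>2 \<partial>M)"
  by (simp add: L2.nrm_def power2_eq_square)

lemma nn_L2_nrm:
  assumes "f \<in> square_integrable M"
  shows "(\<integral>\<^sup>+x. ennreal ((f x)\<^sup>2) \<partial>M) = ennreal ((L2.nrm M f)\<^sup>2)"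
  using square_integrable_nn[OF assms] L2.nrm_sq[OF assms] by (simp add: power2_eq_square)

lemma L2_nrm_eq_0:
  assumes "f \<in> square_integrable M" "L2.nrm M f = 0"
  shows "AE x in M. f x = 0"
proof -
  have "(\<integral>x. (f x)\<^sup>2 \<partial>M) = 0" using assms(2) by (simp add: L2_nrm_eq)
  then have "AE x in M. (f x)\<^sup>2 = 0"
    using assms(1) by (subst (asm) integral_nonneg_eq_0_iff_AE) (auto simp: square_integrable_def)
  then show ?thesis by simp
qed

text \<open>The Riesz-Fischer theorem: a rapidly converging subsequence converges almost everywhere,
  and Fatou's lemma shows that its pointwise limit is also the limit in norm.\<close>

lemma L2_complete:
  fixes f :: "nat \<Rightarrow> 'a \<Rightarrow> real"
  assumes f: "\<And>k. f k \<in> square_integrable M"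
    and cauchy: "\<And>e. e > 0 \<Longrightarrow> \<exists>K. \<forall>j\<ge>K. \<forall>k\<ge>K. L2.nrm M (\<lambda>x. f j x - f k x) < e"
  shows "\<exists>h\<in>square_integrable M. (\<lambda>k. L2.nrm M (\<lambda>x. f k x - h x)) \<longlonglongrightarrow> 0"
proof -
  have [measurable]: "f k \<in> borel_measurable M" for k using f by (auto simp: square_integrable_def)
  have "\<exists>K. \<forall>j\<ge>K. \<forall>k\<ge>K. L2.nrm M (\<lambda>x. f j x - f k x) < (1/2)^i" for i :: nat
    by (rule cauchy) simp
  then obtain K where K: "\<And>i j k. j \<ge> K i \<Longrightarrow> k \<ge> K i \<Longrightarrow> L2.nrm M (\<lambda>x. f j x - f k x) < (1/2)^i"
    by metis
  \<comment> \<open>The partial sums make \<open>s\<close> monotone and at least \<open>K i\<close>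
    although \<open>K\<close> need not be monotone; the summand \<open>i\<close> makes it
    unbounded.\<close>
  define s where "s i = (\<Sum>j\<le>i. K j) + i" for i
  have sK: "s i \<ge> K i" for i unfolding s_def by (simp add: member_le_sum trans_le_add1)
  have s_mono: "s i \<le> s (Suc i)" for i by (simp add: s_def)
  have si: "s i \<ge> i" for i by (simp add: s_def)
  define a where "a i x = f (s (Suc i)) x - f (s i) x" for i x
  have [measurable]: "a i \<in> borel_measurable M" for i unfolding a_def by measurable
  have aL: "a i \<in> square_integrable M" for i unfolding a_def by (rule L2.diff_mem[OF f f])
  have a_nrm: "(L2.nrm M (a i))\<^sup>2 \<le> (1/4)^i" for i
  proof -
    have "L2.nrm M (a i) \<le> (1/2)^i"
      unfolding a_def using K[of i "s (Suc i)" "s i"] sK[of i] s_mono[of i] by simp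
    then have "(L2.nrm M (a i))\<^sup>2 \<le> ((1/2)^i)\<^sup>2"
      by (rule power_mono) (rule L2.nrm_nonneg[OF aL])
    then show ?thesis by (simp add: power2_eq_square power_mult_distrib[symmetric])
  qed
  \<comment> \<open>With the weights \<open>2^i\<close> the integrals still form a convergent
    geometric series, and the weighted squares control the terms themselves:
    \<open>\<bar>a i x\<bar> \<le> (1/2)^i + 2^i * (a i x)\<^sup>2\<close> by the inequality of
    means. This replaces the triangle inequality for infinite sums.\<close>
  have "(\<integral>\<^sup>+x. (\<Sum>i. ennreal (2^i * (a i x)\<^sup>2)) \<partial>M) = (\<Sum>i. \<integral>\<^sup>+x. ennreal (2^i * (a i x)\<^sup>2) \<partial>M)"
    by (rule nn_integral_suminf) measurable
  also have "\<dots> = (\<Sum>i. ennreal (2^i) * ennreal ((L2.nrm M (a i))\<^sup>2))"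
    by (simp add: ennreal_mult nn_integral_cmult nn_L2_nrm[OF aL])
  also have "\<dots> \<le> (\<Sum>i. ennreal ((1/2)^i))"
  proof (intro suminf_le summableI)
    fix i :: nat
    have "(2::real)^i * (L2.nrm M (a i))\<^sup>2 \<le> 2^i * (1/4)^i"
      by (rule mult_left_mono[OF a_nrm]) simp
    also have "\<dots> = (1/2)^i" by (simp add: power_mult_distrib[symmetric])
    finally show "ennreal (2^i) * ennreal ((L2.nrm M (a i))\<^sup>2) \<le> ennreal ((1/2)^i)"
      by (subst ennreal_mult[symmetric]) (auto intro: ennreal_leI)
  qed
  also have "\<dots> = ennreal (\<Sum>i. (1/2)^i)" by (rule suminf_ennreal2) (auto intro: summable_geometric)
  finally have "(\<integral>\<^sup>+x. (\<Sum>i. ennreal (2^i * (a i x)\<^sup>2)) \<partial>M) \<noteq> \<infinity>" by (auto simp: top_unique)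
  then have "AE x in M. (\<Sum>i. ennreal (2^i * (a i x)\<^sup>2)) \<noteq> \<infinity>"
    by (intro nn_integral_noteq_infinite) auto
  then have conv: "AE x in M. convergent (\<lambda>i. f (s i) x)"
  proof eventually_elim
    case (elim x)
    have 1: "summable (\<lambda>i. 2^i * (a i x)\<^sup>2)"
      by (rule summable_suminf_not_top) (use elim in auto)
    have "summable (\<lambda>i. (1/2)^i + 2^i * (a i x)\<^sup>2)"
      by (intro summable_add 1 summable_geometric) simp
    then have "summable (\<lambda>i. a i x)"
    proof (rule summable_comparison_test')
      fix i :: nat
      have "0 \<le> (1/2)^i * (1 - 2^i * \<bar>a i x\<bar>)\<^sup>2" by simp
      also have "\<dots> = (1/2)^i + 2^i * (a i x)\<^sup>2 - 2 * \<bar>a i x\<bar>"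
        by (simp add: power2_eq_square algebra_simps abs_mult_self_eq power_one_over)
      finally show "norm (a i x) \<le> (1/2)^i + 2^i * (a i x)\<^sup>2" by simp
    qed
    then have "(\<lambda>n. \<Sum>i<n. a i x) \<longlonglongrightarrow> (\<Sum>i. a i x)" by (rule summable_LIMSEQ)
    moreover have "(\<Sum>i<n. a i x) = f (s n) x - f (s 0) x" for n
      unfolding a_def by (rule sum_lessThan_telescope)
    ultimately have "(\<lambda>n. f (s n) x - f (s 0) x + f (s 0) x) \<longlonglongrightarrow> (\<Sum>i. a i x) + f (s 0) x"
      by (intro tendsto_add) auto
    then show ?case by (auto simp: convergent_def)
  qed
  define h where "h x = lim (\<lambda>i. f (s i) x)" for x
  have [measurable]: "h \<in> borel_measurable M" unfolding h_def by measurable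
  have lim: "AE x in M. (\<lambda>i. f (s i) x) \<longlonglongrightarrow> h x"
    using conv by eventually_elim (simp add: h_def convergent_LIMSEQ_iff)
  have fatou: "(\<integral>\<^sup>+x. ennreal ((f j x - h x)\<^sup>2) \<partial>M) \<le> ennreal (e\<^sup>2)"
    if "\<And>j k. j \<ge> K \<Longrightarrow> k \<ge> K \<Longrightarrow> L2.nrm M (\<lambda>x. f j x - f k x) < e" "j \<ge> K" for K e j
  proof -
    have "(\<integral>\<^sup>+x. ennreal ((f j x - h x)\<^sup>2) \<partial>M) = (\<integral>\<^sup>+x. liminf (\<lambda>i. ennreal ((f j x - f (s i) x)\<^sup>2)) \<partial>M)"
    proof (rule nn_integral_cong_AE)
      show "AE x in M. ennreal ((f j x - h x)\<^sup>2) = liminf (\<lambda>i. ennreal ((f j x - f (s i) x)\<^sup>2))"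
        using lim
      proof eventually_elim
        case (elim x)
        then have "(\<lambda>i. ennreal ((f j x - f (s i) x)\<^sup>2)) \<longlonglongrightarrow> ennreal ((f j x - h x)\<^sup>2)"
          by (intro tendsto_intros)
        then show ?case by (metis lim_imp_Liminf trivial_limit_sequentially)
      qed
    qed
    also have "\<dots> \<le> liminf (\<lambda>i. \<integral>\<^sup>+x. ennreal ((f j x - f (s i) x)\<^sup>2) \<partial>M)"
      by (rule nn_integral_liminf) measurable
    also have "\<dots> \<le> liminf (\<lambda>i. ennreal (e\<^sup>2))"
    proof (rule Liminf_mono)
      have "(\<integral>\<^sup>+x. ennreal ((f j x - f (s i) x)\<^sup>2) \<partial>M) \<le> ennreal (e\<^sup>2)" if "i \<ge> K" for i
      proof -
        have "s i \<ge> K" using si[of i] that by linarith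
        then have "L2.nrm M (\<lambda>x. f j x - f (s i) x) \<le> e" using \<open>j \<ge> K\<close> that(1)
          using less_imp_le \<open>\<And>j k. j \<ge> K \<Longrightarrow> k \<ge> K \<Longrightarrow> L2.nrm M (\<lambda>x. f j x - f k x) < e\<close> by blast
        then show ?thesis
          unfolding nn_L2_nrm[OF L2.diff_mem[OF f f]]
          by (intro ennreal_leI power_mono L2.nrm_nonneg[OF L2.diff_mem[OF f f]])
      qed
      then show "\<forall>\<^sub>F i in sequentially. (\<integral>\<^sup>+x. ennreal ((f j x - f (s i) x)\<^sup>2) \<partial>M) \<le> ennreal (e\<^sup>2)"
        using eventually_sequentially by blast
    qed
    also have "\<dots> = ennreal (e\<^sup>2)" by (simp add: Liminf_const)
    finally show ?thesis .
  qed
  obtain K1 where K1: "\<And>j k. j \<ge> K1 \<Longrightarrow> k \<ge> K1 \<Longrightarrow> L2.nrm M (\<lambda>x. f j x - f k x) < 1"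
    using cauchy[of 1] by auto
  have "(\<integral>\<^sup>+x. ennreal ((f K1 x - h x)\<^sup>2) \<partial>M) \<le> ennreal (1\<^sup>2)"
    by (rule fatou[OF K1]) auto
  then have "(\<lambda>x. f K1 x - h x) \<in> square_integrable M"
    by (intro square_integrableI_nn) (auto simp: less_top[symmetric] top_unique)
  from L2.diff_mem[OF f[of K1] this] have hL: "h \<in> square_integrable M" by simp
  have "(\<lambda>k. L2.nrm M (\<lambda>x. f k x - h x)) \<longlonglongrightarrow> 0"
  proof (rule LIMSEQ_I)
    fix e :: real assume "e > 0"
    then obtain K where K: "\<And>j k. j \<ge> K \<Longrightarrow> k \<ge> K \<Longrightarrow> L2.nrm M (\<lambda>x. f j x - f k x) < e/2"
      using cauchy[of "e/2"] by auto
    have "norm (L2.nrm M (\<lambda>x. f k x - h x) - 0) < e" if "k \<ge> K" for k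
    proof -
      have "ennreal ((L2.nrm M (\<lambda>x. f k x - h x))\<^sup>2) \<le> ennreal ((e/2)\<^sup>2)"
        using fatou[OF K that] unfolding nn_L2_nrm[OF L2.diff_mem[OF f hL]] .
      then have "(L2.nrm M (\<lambda>x. f k x - h x))\<^sup>2 \<le> (e/2)\<^sup>2" by simp
      then have "L2.nrm M (\<lambda>x. f k x - h x) \<le> e/2" by (rule power2_le_imp_le) (use \<open>e > 0\<close> in simp)
      then show ?thesis using L2.nrm_nonneg[OF L2.diff_mem[OF f hL], of k] \<open>e > 0\<close> by simp
    qed
    then show "\<exists>K. \<forall>k\<ge>K. norm (L2.nrm M (\<lambda>x. f k x - h x) - 0) < e" by blast
  qed
  with hL show ?thesis by blast
qed

section \<open>Borel representatives, and integrals over a Borel set\<close>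

lemma borel_representative:
  fixes v :: "'a::euclidean_space \<Rightarrow> real"
  assumes S: "S \<in> sets borel" and v: "v \<in> borel_measurable (lebesgue_on S)"
  obtains w where "w \<in> borel_measurable borel" "\<And>x. x \<notin> S \<Longrightarrow> w x = 0"
    "AE x in lebesgue_on S. v x = w x"
proof -
  have "(\<lambda>x. indicator S x *\<^sub>R v x) \<in> borel_measurable lebesgue"
    using borel_measurable_restrict_space_iff[of S lebesgue v] v S by simp
  then obtain w0 where w0: "w0 \<in> borel_measurable lborel" "AE x in lborel. indicator S x *\<^sub>R v x = w0 x"
    using completion_ex_borel_measurable_real[of _ lborel] by blast
  show thesis
  proof
    show "(\<lambda>x. indicator S x * w0 x) \<in> borel_measurable borel" using w0(1) S by measurable
    show "indicator S x * w0 x = 0" if "x \<notin> S" for x using that by simp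
    have "AE x in lebesgue. x \<in> S \<longrightarrow> v x = indicator S x * w0 x"
      using AE_completion[OF w0(2)] by eventually_elim (auto simp: indicator_def)
    then show "AE x in lebesgue_on S. v x = indicator S x * w0 x"
      using S AE_restrict_space_iff[of S lebesgue] by simp
  qed
qed

lemma borel_measurable_lebesgue_on:
  assumes "f \<in> borel_measurable borel"
  shows "f \<in> borel_measurable (lebesgue_on S)"
proof -
  have "f \<in> borel_measurable lborel" using assms by simp
  then have "f \<in> borel_measurable lebesgue" by (rule measurable_completion)
  then show ?thesis by (rule measurable_restrict_space1)
qed

lemma nn_integral_lebesgue_on:
  assumes S: "S \<in> sets borel"
  shows "(\<integral>\<^sup>+x. f x \<partial>lebesgue_on S) = (\<integral>\<^sup>+x. f x * indicator S x \<partial>lborel)"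
  using S nn_integral_restrict_space[of S lebesgue f] by (simp add: nn_integral_completion)

lemma AE_lebesgue_on_iff:
  assumes S: "S \<in> sets borel"
  shows "(AE x in lebesgue_on S. P x) \<longleftrightarrow> (AE x in lborel. x \<in> S \<longrightarrow> P x)"
  using S AE_restrict_space_iff[of S lebesgue P] by (simp add: AE_completion_iff)

lemma integrable_lebesgue_on_borel:
  fixes F :: "'a::euclidean_space \<Rightarrow> real"
  assumes S: "S \<in> sets borel" and F: "F \<in> borel_measurable borel" 
  shows "integrable (lebesgue_on S) F \<longleftrightarrow> integrable lborel (\<lambda>x. indicator S x * F x)"
proof -
  have "(\<lambda>x. indicator S x * F x) \<in> borel_measurable lborel" using F S by measurable
  then show ?thesis
    using S integrable_restrict_space[of S lebesgue F] integrable_completion[of "\<lambda>x. indicator S x * F x" lborel]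
    by simp
qed

lemma integral_lebesgue_on_borel:
  fixes F :: "'a::euclidean_space \<Rightarrow> real"
  assumes S: "S \<in> sets borel" and F: "F \<in> borel_measurable borel" 
  shows "(LINT x|lebesgue_on S. F x) = (LINT x|lborel. indicator S x * F x)"
proof -
  have "(\<lambda>x. indicator S x * F x) \<in> borel_measurable lborel" using F S by measurable
  then show ?thesis
    using S integral_restrict_space[of S lebesgue F] integral_completion[of "\<lambda>x. indicator S x * F x" lborel]
    by simp
qed

section \<open>Smooth functions of compact support\<close>

text \<open>The derivatives of \<open>exp (- (1 / t))\<close>, extended by 0, are combinations of
  these functions: carrying the power \<open>j\<close> along closes the family under
  differentiation.\<close>

definition flat :: "nat \<Rightarrow> real \<Rightarrow> real" where
  "flat j t = (if t > 0 then (1 / t) ^ j * exp (- (1 / t)) else 0)"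

lemma flat_at_zero: "(flat j \<longlongrightarrow> 0) (at_right 0)"
proof -
  have "((\<lambda>x::real. x ^ j / exp x) \<longlongrightarrow> 0) at_top" by (rule tendsto_power_div_exp_0)
  moreover have "filterlim (\<lambda>t::real. 1 / t) at_top (at_right 0)"
    using filterlim_inverse_at_top_right by (simp add: inverse_eq_divide)
  ultimately have "((\<lambda>t::real. (1/t) ^ j / exp (1/t)) \<longlongrightarrow> 0) (at_right 0)"
    by (rule filterlim_compose)
  then show ?thesis
  proof (rule Lim_transform_eventually)
    show "\<forall>\<^sub>F t in at_right 0. (1/t) ^ j / exp (1/t) = flat j t"
      unfolding eventually_at_right_field flat_def exp_minus divide_inverse[of _ "exp _"]
      by (intro exI[of _ 1]) simp
  qed
qed

lemma flat_deriv: "(flat j has_real_derivative (flat (j + 2) t - real j * flat (j + 1) t)) (at t)"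
proof -
  consider "t > 0" | "t < 0" | "t = 0" by linarith
  then show ?thesis
  proof cases
    case 1
    have "((\<lambda>t. (1 / t) ^ j * exp (- (1 / t))) has_real_derivative
        (real j * (1 / t) ^ (j - 1) * (- 1 / t\<^sup>2) * exp (- (1/t)) + (1 / t) ^ j * (exp (- (1/t)) * (1 / t\<^sup>2)))) (at t)"
      using 1 by (auto intro!: derivative_eq_intros) (simp add: power2_eq_square)
    also have "real j * (1 / t) ^ (j - 1) * (- 1 / t\<^sup>2) * exp (- (1/t)) + (1 / t) ^ j * (exp (- (1/t)) * (1 / t\<^sup>2))
       = flat (j + 2) t - real j * flat (j + 1) t"
    proof (cases j)
      case 0
      then show ?thesis using 1 by (simp add: flat_def power2_eq_square)
    next
      case (Suc k)
      have "(1 / t) ^ k * (- 1 / t\<^sup>2) = - ((1 / t) ^ (k + 2))" "1 / t\<^sup>2 = (1 / t) ^ 2"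
        by (simp_all add: power_add power_one_over power2_eq_square)
      then show ?thesis using 1 unfolding Suc
        by (simp add: flat_def algebra_simps power_add power2_eq_square add_divide_distrib)
    qed
    finally show ?thesis
      by (rule has_field_derivative_transform_within_open[of _ _ _ "{0<..}"]) (use 1 in \<open>auto simp: flat_def\<close>)
  next
    case 2
    have "((\<lambda>t. 0::real) has_real_derivative 0) (at t)" by simp
    then have "(flat j has_real_derivative 0) (at t)"
      by (rule has_field_derivative_transform_within_open[of _ _ _ "{..<0}"]) (use 2 in \<open>auto simp: flat_def\<close>)
    then show ?thesis using 2 by (simp add: flat_def)
  next
    case 3
    \<comment> \<open>At 0 the difference quotient from the right is the next member of the family,
      which tends to 0.\<close>
    have "((\<lambda>h. (flat j (0 + h) - flat j 0) / h) \<longlongrightarrow> 0) (at_right 0)"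
    proof (rule Lim_transform_eventually[OF flat_at_zero[of "j + 1"]])
      show "\<forall>\<^sub>F h in at_right 0. flat (j + 1) h = (flat j (0 + h) - flat j 0) / h"
        unfolding eventually_at_right_field flat_def by (intro exI[of _ 1]) simp
    qed
    moreover have "((\<lambda>h. (flat j (0 + h) - flat j 0) / h) \<longlongrightarrow> 0) (at_left 0)"
    proof (rule Lim_transform_eventually[OF tendsto_const[of 0]])
      show "\<forall>\<^sub>F h in at_left 0. 0 = (flat j (0 + h) - flat j 0) / h"
        unfolding eventually_at_left_field flat_def by (intro exI[of _ "-1"]) simp
    qed
    ultimately have "((\<lambda>h. (flat j (0 + h) - flat j 0) / h) \<longlongrightarrow> 0) (at 0)"
      by (simp add: filterlim_at_split)
    then show ?thesis using 3 by (simp add: DERIV_def flat_def)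
  qed
qed

lemma sum_vec_delta: "(\<Sum>k\<in>UNIV. (v :: real^'n::finite) $ k * (if k = i then c else 0)) = v $ i * c"
proof -
  have "(\<Sum>k\<in>UNIV. v $ k * (if k = i then c else 0)) = (\<Sum>k\<in>UNIV. if k = i then v $ k * c else 0)"
    by (intro sum.cong) auto
  then show ?thesis by simp
qed

text \<open>A concrete algebra of smooth functions that is closed under partial derivatives by
  construction and contains enough functions of compact support.\<close>

inductive flat_alg :: "(real^'n::finite \<Rightarrow> real) \<Rightarrow> bool" where
  const: "flat_alg (\<lambda>x. c)"
| coord: "flat_alg (\<lambda>x. x $ i)"
| flat: "flat_alg (\<lambda>x. flat j (c * x $ i + d))"
| add: "flat_alg f \<Longrightarrow> flat_alg g \<Longrightarrow> flat_alg (\<lambda>x. f x + g x)"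
| mult: "flat_alg f \<Longrightarrow> flat_alg g \<Longrightarrow> flat_alg (\<lambda>x. f x * g x)"

text \<open>That the partial derivatives lie in the same algebra is the point: iteration then yields
  derivatives of every order without formulas for them.\<close>

lemma flat_alg_has_derivative:
  fixes f :: "real^'n::finite \<Rightarrow> real"
  assumes "flat_alg f"
  shows "\<exists>D. (\<forall>x. (f has_derivative (\<lambda>v. \<Sum>i\<in>UNIV. v $ i * D i x)) (at x)) \<and> (\<forall>i. flat_alg (D i))"
  using assms
proof induction
  case (const c)
  show ?case by (rule exI[of _ "\<lambda>i x. 0"]) (auto intro: flat_alg.const)
next
  case (coord i)
  have *: "(\<lambda>v::real^'n. \<Sum>k\<in>UNIV. v $ k * (if k = i then 1 else 0)) = (\<lambda>v. v $ i)"
    by (simp add: sum_vec_delta)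
  show ?case
    by (rule exI[of _ "\<lambda>k x. if k = i then 1 else 0"])
      (auto simp: * intro!: flat_alg.const bounded_linear_imp_has_derivative bounded_linear_vec_nth)
next
  case (flat j c i d)
  define g where "g t = flat (j + 2) t - real j * flat (j + 1) t" for t
  define D where "D k x = (if k = i then c * g (c * x $ i + d) else 0)" for k :: 'n and x :: "real^'n"
  have "((\<lambda>x. flat j (c * x $ i + d)) has_derivative (\<lambda>v. \<Sum>k\<in>UNIV. v $ k * D k x)) (at x)" for x
  proof -
    have 1: "((\<lambda>x::real^'n. c * x $ i + d) has_derivative (\<lambda>v. c * v $ i)) (at x)"
      by (intro has_derivative_add_const has_derivative_mult_right bounded_linear_imp_has_derivative bounded_linear_vec_nth)
    have 2: "(flat j has_derivative (\<lambda>h. g (c * x $ i + d) * h)) (at (c * x $ i + d))"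
      using flat_deriv[of j "c * x $ i + d"] by (simp add: has_field_derivative_def g_def)
    have "((\<lambda>x. flat j (c * x $ i + d)) has_derivative (\<lambda>v. g (c * x $ i + d) * (c * v $ i))) (at x)"
      using has_derivative_compose[OF 1 2] .
    moreover have "(\<Sum>k\<in>UNIV. v $ k * D k x) = g (c * x $ i + d) * (c * v $ i)" for v
      by (simp add: D_def sum_vec_delta)
    ultimately show ?thesis by simp
  qed
  moreover have "flat_alg (D k)" for k
  proof -
    have "flat_alg (\<lambda>x. c * (flat (j + 2) (c * x $ i + d) + (- real j) * flat (j + 1) (c * x $ i + d)))"
      by (intro flat_alg.intros)
    moreover have "D i = (\<lambda>x. c * (flat (j + 2) (c * x $ i + d) + (- real j) * flat (j + 1) (c * x $ i + d)))"
      by (simp add: D_def g_def fun_eq_iff)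
    moreover have "k \<noteq> i \<Longrightarrow> D k = (\<lambda>x. 0)" by (simp add: D_def fun_eq_iff)
    ultimately show ?thesis by (cases "k = i") (auto intro: flat_alg.const)
  qed
  ultimately show ?case by blast
next
  case (add f g)
  then obtain D E where D: "\<And>x. (f has_derivative (\<lambda>v. \<Sum>i\<in>UNIV. v $ i * D i x)) (at x)" "\<And>i. flat_alg (D i)"
    and E: "\<And>x. (g has_derivative (\<lambda>v. \<Sum>i\<in>UNIV. v $ i * E i x)) (at x)" "\<And>i. flat_alg (E i)" by blast
  have "((\<lambda>x. f x + g x) has_derivative (\<lambda>v. \<Sum>i\<in>UNIV. v $ i * (D i x + E i x))) (at x)" for x
    using has_derivative_add[OF D(1) E(1), of x] by (simp add: sum.distrib distrib_left)
  then show ?case using D(2) E(2) by (intro exI[of _ "\<lambda>i x. D i x + E i x"]) (auto intro: flat_alg.add)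
next
  case (mult f g)
  then obtain D E where D: "\<And>x. (f has_derivative (\<lambda>v. \<Sum>i\<in>UNIV. v $ i * D i x)) (at x)" "\<And>i. flat_alg (D i)"
    and E: "\<And>x. (g has_derivative (\<lambda>v. \<Sum>i\<in>UNIV. v $ i * E i x)) (at x)" "\<And>i. flat_alg (E i)" by blast
  have "((\<lambda>x. f x * g x) has_derivative (\<lambda>v. \<Sum>i\<in>UNIV. v $ i * (f x * E i x + D i x * g x))) (at x)" for x
  proof -
    have "f x * (\<Sum>i\<in>UNIV. v $ i * E i x) + (\<Sum>i\<in>UNIV. v $ i * D i x) * g x
       = (\<Sum>i\<in>UNIV. v $ i * (f x * E i x + D i x * g x))" for v :: "real^'n"
      unfolding sum_distrib_left sum_distrib_right sum.distrib[symmetric]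
      by (intro sum.cong) (simp_all add: algebra_simps)
    then show ?thesis using has_derivative_mult[OF D(1) E(1), of x] by simp
  qed
  then show ?case using D(2) E(2) mult.hyps
    by (intro exI[of _ "\<lambda>i x. f x * E i x + D i x * g x"]) (auto intro!: flat_alg.add flat_alg.mult)
qed

lemma partial_deriv_eq:
  assumes "(f has_derivative (\<lambda>v. \<Sum>i\<in>UNIV. v $ i * D i)) (at x)"
  shows "partial_deriv i f x = D i"
proof -
  have "partial_deriv i f x = (\<Sum>k\<in>UNIV. axis i 1 $ k * D k)"
    unfolding partial_deriv_def frechet_derivative_at[OF assms, symmetric] ..
  also have "\<dots> = (\<Sum>k\<in>UNIV. if k = i then D k else 0)"
    by (intro sum.cong) (auto simp: axis_def)
  finally show ?thesis by simp
qed

lemma flat_alg_partial: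
  assumes "flat_alg f"
  shows "flat_alg (partial_deriv i f)"
    "(f has_derivative (\<lambda>v. \<Sum>i\<in>UNIV. v $ i * partial_deriv i f x)) (at x)"
proof -
  obtain D where D: "\<And>x. (f has_derivative (\<lambda>v. \<Sum>i\<in>UNIV. v $ i * D i x)) (at x)" "\<And>i. flat_alg (D i)"
    using flat_alg_has_derivative[OF assms] by blast
  have eq: "partial_deriv i f = D i" for i using partial_deriv_eq[OF D(1)] by blast
  show "flat_alg (partial_deriv i f)" unfolding eq by (rule D(2))
  show "(f has_derivative (\<lambda>v. \<Sum>i\<in>UNIV. v $ i * partial_deriv i f x)) (at x)" unfolding eq by (rule D(1))
qed

lemma flat_alg_smooth:
  assumes "flat_alg f"
  shows "smooth f"
proof -
  have "flat_alg (iter_partial_deriv is f)" for "is"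
    by (induction "is") (auto simp: iter_partial_deriv_def assms flat_alg_partial(1))
  then show ?thesis
    unfolding smooth_def using flat_alg_partial(2) differentiable_def by blast
qed

lemma flat_alg_continuous: "flat_alg f \<Longrightarrow> continuous_on UNIV f"
  using flat_alg_partial(2) by (blast intro: continuous_at_imp_continuous_on has_derivative_continuous)

lemma flat_alg_test_function:
  assumes "flat_alg f" "\<And>x. x \<notin> cbox a b \<Longrightarrow> f x = 0" "cbox a b \<subseteq> interior S"
  shows "test_function S f"
proof -
  have "closure {x. f x \<noteq> 0} \<subseteq> cbox a b"
    using assms(2) by (intro closure_minimal) auto
  moreover from this have "compact (closure {x. f x \<noteq> 0})"
    unfolding compact_eq_bounded_closed by (auto intro: bounded_subset[OF bounded_cbox])
  ultimately show ?thesis using flat_alg_smooth[OF assms(1)] assms(3) by (auto simp: test_function_def)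
qed

text \<open>Each factor is \<open>exp (- (1 / (k * t)))\<close> with \<open>t\<close> the distance
  of a coordinate to a face, and 0 beyond the face; inside the box it tends to 1 as \<open>k\<close>
  grows. The arguments are written in the affine shape that generates
  \<open>flat_alg\<close>.\<close>

definition box_bump :: "nat \<Rightarrow> real^'n::finite \<Rightarrow> real^'n \<Rightarrow> real^'n \<Rightarrow> real" where
  "box_bump k a b x =
     (\<Prod>i\<in>UNIV. flat 0 (real k * x $ i + (- real k * a $ i)) * flat 0 ((- real k) * x $ i + real k * b $ i))"

lemma flat_alg_prod: "finite I \<Longrightarrow> (\<And>i. i \<in> I \<Longrightarrow> flat_alg (f i)) \<Longrightarrow> flat_alg (\<lambda>x. \<Prod>i\<in>I. f i x)"
  by (induction rule: finite_induct) (auto intro: flat_alg.intros)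

lemma flat_alg_box_bump: "flat_alg (box_bump k a b)"
  unfolding box_bump_def[abs_def] by (intro flat_alg_prod flat_alg.mult flat_alg.flat) auto

lemma flat_0_bounds: "0 \<le> flat 0 t" "flat 0 t \<le> 1"
  by (auto simp: flat_def)

lemma box_bump_bounds: "0 \<le> box_bump k a b x" "box_bump k a b x \<le> 1"
  unfolding box_bump_def
  by (auto intro!: prod_nonneg prod_le_1 mult_nonneg_nonneg mult_le_one flat_0_bounds)

lemma box_bump_outside:
  assumes "x \<notin> box a b"
  shows "box_bump k a b x = 0"
proof -
  obtain i where i: "x $ i \<le> a $ i \<or> x $ i \<ge> b $ i" using assms by (auto simp: mem_box_cart not_less)
  then have "real k * x $ i + (- real k * a $ i) \<le> 0 \<or> (- real k) * x $ i + real k * b $ i \<le> 0"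
    by (auto simp: mult_left_mono)
  then have "flat 0 (real k * x $ i + (- real k * a $ i)) * flat 0 ((- real k) * x $ i + real k * b $ i) = 0"
    by (auto simp: flat_def)
  then show ?thesis unfolding box_bump_def by (subst prod_zero_iff) auto
qed

lemma box_bump_limit:
  fixes a b :: "real^'n::finite"
  shows "(\<lambda>k. box_bump k a b x) \<longlonglongrightarrow> indicator (box a b) x"
proof (cases "x \<in> box a b")
  case False
  then show ?thesis by (simp add: box_bump_outside)
next
  case True
  have fl: "(\<lambda>k. flat 0 (real k * t)) \<longlonglongrightarrow> 1" if "t > 0" for t
  proof -
    have "(\<lambda>k. - (inverse (real k) * (1 / t))) \<longlonglongrightarrow> - (0 * (1 / t))"
      by (intro tendsto_intros lim_inverse_n)
    then have "(\<lambda>k. exp (- (inverse (real k) * (1 / t)))) \<longlonglongrightarrow> exp (- (0 * (1 / t)))"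
      by (rule tendsto_exp)
    then have "(\<lambda>k. exp (- (inverse (real k) * (1 / t)))) \<longlonglongrightarrow> 1" by simp
    moreover have "\<forall>\<^sub>F k in sequentially. exp (- (inverse (real k) * (1 / t))) = flat 0 (real k * t)"
      using that by (intro eventually_sequentiallyI[of 1]) (auto simp: flat_def field_simps)
    ultimately show ?thesis by (rule Lim_transform_eventually)
  qed
  have "(\<lambda>k. \<Prod>i\<in>UNIV. flat 0 (real k * (x $ i - a $ i)) * flat 0 (real k * (b $ i - x $ i)))
     \<longlonglongrightarrow> (\<Prod>i\<in>(UNIV::'n set). 1 * 1)"
    by (intro tendsto_prod tendsto_mult fl) (use True in \<open>auto simp: mem_box_cart\<close>)
  then show ?thesis using True by (simp add: box_bump_def algebra_simps)
qed

section \<open>The fundamental lemma of the calculus of variations\<close>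

lemma AE_zero_if_box_integrals_zero:
  fixes f :: "'a::euclidean_space \<Rightarrow> real"
  assumes f: "integrable lborel f"
    and z: "\<And>a b. (LINT x|lborel. indicator (box a b) x * f x) = 0"
  shows "AE x in lborel. f x = 0"
proof -
  have [measurable]: "f \<in> borel_measurable borel" using f by auto
  \<comment> \<open>Since \<open>ennreal\<close> sends negative numbers to 0, \<open>P\<close> and
    \<open>Q\<close> have the positive and the negative part of \<open>f\<close> as densities. They
    agree on boxes, an intersection-stable generator of the Borel sets, hence everywhere; then so do
    the densities.\<close>
  define P where "P = density lborel (\<lambda>x. ennreal (f x))"
  define Q where "Q = density lborel (\<lambda>x. ennreal (- f x))"
  have fb: "integrable lborel (\<lambda>x. indicator (box a b) x * f x)" for a b
    using integrable_mult_indicator[OF _ f, of "box a b"] by simp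
  have eqP: "emeasure P (box a b) = (\<integral>\<^sup>+x. ennreal (indicator (box a b) x * f x) \<partial>lborel)"
    and eqQ: "emeasure Q (box a b) = (\<integral>\<^sup>+x. ennreal (- (indicator (box a b) x * f x)) \<partial>lborel)" for a b
    unfolding P_def Q_def
    by (auto simp: emeasure_density intro!: nn_integral_cong split: split_indicator)
  have fin: "emeasure P (box a b) \<noteq> \<infinity>" "emeasure Q (box a b) \<noteq> \<infinity>" for a b
    using fb unfolding eqP eqQ real_integrable_def by auto
  have eq: "emeasure P (box a b) = emeasure Q (box a b)" for a b
  proof -
    have "enn2real (emeasure P (box a b)) = enn2real (emeasure Q (box a b))"
      using z[of a b] unfolding real_lebesgue_integral_def[OF fb] eqP eqQ by simp
    then show ?thesis using fin by (metis ennreal_enn2real_if infinity_ennreal_def)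
  qed
  have "P = Q"
  proof (rule measure_eqI_generator_eq)
    let ?E = "range (\<lambda>(a, b). box a b::'a set)"
    show "Int_stable ?E" by (auto simp: Int_stable_def box_Int_box)
    show "?E \<subseteq> Pow UNIV" "sets P = sigma_sets UNIV ?E" "sets Q = sigma_sets UNIV ?E"
      by (simp_all add: borel_eq_box P_def Q_def)
    let ?A = "\<lambda>n::nat. box (- (real n *\<^sub>R One)) (real n *\<^sub>R One) :: 'a set"
    show "range ?A \<subseteq> ?E" "(\<Union>i. ?A i) = UNIV" unfolding UN_box_eq_UNIV by auto
    show "emeasure P (?A i) \<noteq> \<infinity>" for i by (rule fin)
    show "emeasure P X = emeasure Q X" if "X \<in> ?E" for X using that eq by auto
  qed
  then have "AE x in lborel. ennreal (f x) = ennreal (- f x)"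
    unfolding P_def Q_def by (intro sigma_finite_measure.density_unique sigma_finite_lborel) auto
  then show ?thesis
  proof eventually_elim
    case (elim x)
    then show ?case by (cases "f x" "0 :: real" rule: linorder_cases) (auto simp: ennreal_neg)
  qed
qed

text \<open>Test functions must be supported in \<open>U\<close>, so the claim is localised.
  Countably many closed boxes cover \<open>U\<close>, and inside each of them the bumps converge
  boundedly to the indicators of smaller boxes.\<close>

lemma fundamental_lemma_box_bump:
  fixes v :: "real^'n::finite \<Rightarrow> real"
  assumes U: "open U" and v: "v \<in> borel_measurable borel"
    and int: "\<And>a b. cbox a b \<subseteq> U \<Longrightarrow> integrable lborel (\<lambda>x. indicator (cbox a b) x * v x)"
    and z: "\<And>k a b. cbox a b \<subseteq> U \<Longrightarrow> (LINT x|lborel. v x * box_bump k a b x) = 0"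
  shows "AE x in lborel. x \<in> U \<longrightarrow> v x = 0"
proof -
  have [measurable]: "box_bump k a b \<in> borel_measurable borel" for k and a b :: "real^'n"
    by (intro borel_measurable_continuous_onI flat_alg_continuous flat_alg_box_bump)
  note v[measurable]
  have box0: "(LINT x|lborel. indicator (box a b) x * v x) = 0" if ab: "cbox a b \<subseteq> U" for a b
  proof -
    have "(\<lambda>k. LINT x|lborel. indicator (cbox a b) x * v x * box_bump k a b x)
        \<longlonglongrightarrow> (LINT x|lborel. indicator (cbox a b) x * v x * indicator (box a b) x)"
    proof (rule integral_dominated_convergence)
      show "integrable lborel (\<lambda>x. norm (indicator (cbox a b) x * v x))"
        using int[OF ab] by (rule integrable_norm)
      show "AE x in lborel. (\<lambda>k. indicator (cbox a b) x * v x * box_bump k a b x)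
          \<longlonglongrightarrow> indicator (cbox a b) x * v x * indicator (box a b) x"
        by (intro AE_I2 tendsto_mult tendsto_const box_bump_limit)
      show "AE x in lborel. norm (indicator (cbox a b) x * v x * box_bump k a b x)
          \<le> norm (indicator (cbox a b) x * v x)" for k
        using box_bump_bounds[of k a b] by (auto simp: abs_mult intro!: mult_left_le)
    qed measurable
    moreover have "indicator (cbox a b) x * v x * box_bump k a b x = v x * box_bump k a b x" for k x
      using box_bump_outside[of x a b k] box_subset_cbox[of a b] by (auto split: split_indicator)
    moreover have "indicator (cbox a b) x * v x * indicator (box a b) x = indicator (box a b) x * v x" for x
      using box_subset_cbox[of a b] by (auto split: split_indicator)
    ultimately have "(\<lambda>k. 0) \<longlonglongrightarrow> (LINT x|lborel. indicator (box a b) x * v x)"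
      using z[OF ab] by simp
    then show ?thesis by (simp add: LIMSEQ_const_iff)
  qed
  obtain \<D> where D: "countable \<D>" "\<And>X. X \<in> \<D> \<Longrightarrow> \<exists>a b. X = cbox a b" "\<D> \<subseteq> Pow U" "\<Union>\<D> = U"
    using open_countable_Union_open_cbox[OF U] by metis
  have "AE x in lborel. x \<in> X \<longrightarrow> v x = 0" if "X \<in> \<D>" for X
  proof -
    obtain c d where X: "X = cbox c d" using D(2) \<open>X \<in> \<D>\<close> by blast
    have cd: "cbox c d \<subseteq> U" using D(3) \<open>X \<in> \<D>\<close> X by blast
    have "AE x in lborel. indicator (box c d) x * v x = 0"
    proof (rule AE_zero_if_box_integrals_zero)
      have "integrable lborel (\<lambda>x. indicator (box c d) x *\<^sub>R (indicator (cbox c d) x * v x))"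
        by (rule integrable_mult_indicator[OF _ int[OF cd]]) simp
      moreover have "indicator (box c d) x *\<^sub>R (indicator (cbox c d) x * v x) = indicator (box c d) x * v x" for x
        using box_subset_cbox[of c d] by (auto split: split_indicator)
      ultimately show "integrable lborel (\<lambda>x. indicator (box c d) x * v x)" by (simp only:)
      fix a b
      \<comment> \<open>The corners of the intersection of \<open>box a b\<close> with
        \<open>box c d\<close>; its closed version lies in \<open>cbox c d\<close> and is therefore
        admissible for \<open>box0\<close>.\<close>
      define a' where "a' = (\<Sum>i\<in>Basis. max (a\<bullet>i) (c\<bullet>i) *\<^sub>R i)"
      define b' where "b' = (\<Sum>i\<in>Basis. min (b\<bullet>i) (d\<bullet>i) *\<^sub>R i)"
      have "cbox a' b' \<subseteq> cbox c d" by (auto simp: mem_box a'_def b'_def)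
      then have "(LINT x|lborel. indicator (box a' b') x * v x) = 0" using cd by (intro box0) auto
      moreover have "indicator (box a' b') x * v x = indicator (box a b) x * (indicator (box c d) x * v x)" for x
        unfolding a'_def b'_def box_Int_box[symmetric] indicator_inter_arith by simp
      ultimately show "(LINT x|lborel. indicator (box a b) x * (indicator (box c d) x * v x)) = 0" by simp
    qed
    moreover have "AE x in lborel. x \<notin> cbox c d - box c d"
    proof (rule AE_not_in)
      have "cbox c d - box c d \<in> null_sets lebesgue"
        using negligible_frontier_interval[of c d] by (simp add: negligible_iff_null_sets)
      then show "cbox c d - box c d \<in> null_sets lborel" by (simp add: null_sets_completion_iff)
    qed
    ultimately show ?thesis unfolding X by eventually_elim (auto simp: indicator_def)
  qed
  then have "AE x in lborel. \<forall>X\<in>\<D>. x \<in> X \<longrightarrow> v x = 0" using D(1) by (subst AE_ball_countable) auto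
  then show ?thesis by eventually_elim (use D(4) in blast)
qed

section \<open>Sobolev spaces\<close>

lemma L2_space_eq: "L2_space S = square_integrable (lebesgue_on S)"
  by (simp add: L2_space_def square_integrable_def)

lemma L2_norm_eq: "L2_norm S f = L2.nrm (lebesgue_on S) f"
  by (simp add: L2_norm_def L2_nrm_eq)

lemma square_integrable_cong_AE:
  assumes "f \<in> square_integrable M" "g \<in> borel_measurable M" "AE x in M. f x = g x"
  shows "g \<in> square_integrable M"
proof -
  have "integrable M (\<lambda>x. (g x)\<^sup>2)"
  proof (rule integrable_cong_AE_imp)
    show "integrable M (\<lambda>x. (f x)\<^sup>2)" using assms by (simp add: square_integrable_def)
    show "AE x in M. (f x)\<^sup>2 = (g x)\<^sup>2" using assms(3) by eventually_elim simp
  qed (use assms in measurable)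
  then show ?thesis using assms by (simp add: square_integrable_def)
qed

text \<open>Product measurability and Fubini are used on \<open>lborel\<close>, whereas functions on
  \<open>S\<close> are only Lebesgue measurable. Extension by zero moreover turns integrals over
  \<open>S\<close> into integrals over the whole space.\<close>

lemma borel_representative_L2:
  fixes v :: "'a::euclidean_space \<Rightarrow> real"
  assumes S: "S \<in> sets borel" and v: "v \<in> square_integrable (lebesgue_on S)"
  obtains w where "w \<in> borel_measurable borel" "\<And>x. x \<notin> S \<Longrightarrow> w x = 0"
    "AE x in lebesgue_on S. v x = w x" "w \<in> square_integrable lborel"
proof -
  have vm: "v \<in> borel_measurable (lebesgue_on S)" using v by (simp add: square_integrable_def)
  obtain w where w: "w \<in> borel_measurable borel" "\<And>x. x \<notin> S \<Longrightarrow> w x = 0"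
    "AE x in lebesgue_on S. v x = w x" using borel_representative[OF S vm] by blast
  have "w \<in> square_integrable (lebesgue_on S)"
    by (rule square_integrable_cong_AE[OF v borel_measurable_lebesgue_on[OF w(1)] w(3)])
  then have "integrable lborel (\<lambda>x. indicator S x * (w x)\<^sup>2)"
    using integrable_lebesgue_on_borel[OF S, of "\<lambda>x. (w x)\<^sup>2"] w(1) by (simp add: square_integrable_def)
  moreover have "indicator S x * (w x)\<^sup>2 = (w x)\<^sup>2" for x using w(2)[of x] by (cases "x \<in> S") auto
  ultimately have "w \<in> square_integrable lborel" using w(1) by (simp add: square_integrable_def)
  with w show thesis by (rule that)
qed

lemma integral_lebesgue_on_representative:
  fixes v w :: "'a::euclidean_space \<Rightarrow> real"
  assumes S: "S \<in> sets borel" and v: "v \<in> borel_measurable (lebesgue_on S)"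
    and w: "w \<in> borel_measurable borel" "\<And>x. x \<notin> S \<Longrightarrow> w x = 0" "AE x in lebesgue_on S. v x = w x"
    and p: "p \<in> borel_measurable borel"
  shows "(LINT x|lebesgue_on S. v x * p x) = (LINT x|lborel. w x * p x)"
proof -
  have "(LINT x|lebesgue_on S. v x * p x) = (LINT x|lebesgue_on S. w x * p x)"
    using v borel_measurable_lebesgue_on[OF w(1), of S] borel_measurable_lebesgue_on[OF p, of S] w(3)
    by (intro integral_cong_AE) auto
  also have "\<dots> = (LINT x|lborel. indicator S x * (w x * p x))"
    using w p by (intro integral_lebesgue_on_borel[OF S]) auto
  also have "\<dots> = (LINT x|lborel. w x * p x)"
    by (intro Bochner_Integration.integral_cong refl) (use w(2) in \<open>auto simp: indicator_def\<close>)
  finally show ?thesis .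
qed

lemma indicator_cbox_square_integrable:
  "(indicator (cbox a b) :: 'a::euclidean_space \<Rightarrow> real) \<in> square_integrable lborel"
proof -
  have "(\<lambda>x. (indicator (cbox a b) x :: real)\<^sup>2) = indicator (cbox a b)"
    by (auto simp: indicator_def)
  then show ?thesis
    using emeasure_lborel_cbox_finite[of a b] by (simp add: square_integrable_def integrable_indicator_iff)
qed

lemma bounded_support_square_integrable:
  fixes f :: "'a::euclidean_space \<Rightarrow> real"
  assumes "f \<in> borel_measurable borel" "\<And>x. \<bar>f x\<bar> \<le> B" "\<And>x. x \<notin> cbox a b \<Longrightarrow> f x = 0"
  shows "f \<in> square_integrable lborel"
proof -
  have "integrable lborel (\<lambda>x. (f x)\<^sup>2)"
  proof (rule Bochner_Integration.integrable_bound)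
    show "integrable lborel (\<lambda>x. B\<^sup>2 * (indicator (cbox a b) x :: real))"
      using emeasure_lborel_cbox_finite[of a b] by (simp add: integrable_indicator_iff)
    have "(f x)\<^sup>2 \<le> B\<^sup>2" for x using assms(2)[of x] by (rule abs_le_square_iff[THEN iffD1, OF order_trans]) simp
    then show "AE x in lborel. norm ((f x)\<^sup>2) \<le> norm (B\<^sup>2 * (indicator (cbox a b) x :: real))"
      using assms(3) by (intro AE_I2) (auto simp: indicator_def)
  qed (use assms in auto)
  then show ?thesis using assms by (simp add: square_integrable_def)
qed

lemma square_integrable_lebesgue_on:
  fixes f :: "'a::euclidean_space \<Rightarrow> real"
  assumes S: "S \<in> sets borel" and f: "f \<in> square_integrable lborel"
  shows "f \<in> square_integrable (lebesgue_on S)"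
proof -
  have fm: "f \<in> borel_measurable borel" using f by (simp add: square_integrable_def)
  have "integrable lborel (\<lambda>x. indicator S x *\<^sub>R (f x)\<^sup>2)"
    using f S by (intro integrable_mult_indicator) (auto simp: square_integrable_def)
  then show ?thesis
    using fm integrable_lebesgue_on_borel[OF S, of "\<lambda>x. (f x)\<^sup>2"] borel_measurable_lebesgue_on[OF fm]
    by (simp add: square_integrable_def)
qed

lemma du_Bois_Reymond:
  fixes v :: "real^'n::finite \<Rightarrow> real"
  assumes S: "S \<in> sets borel" and v: "v \<in> square_integrable (lebesgue_on S)"
    and z: "\<And>k a b. cbox a b \<subseteq> interior S \<Longrightarrow> (LINT x|lebesgue_on S. v x * box_bump k a b x) = 0"
  shows "AE x in lebesgue_on S. x \<in> interior S \<longrightarrow> v x = 0"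
proof -
  obtain w where w: "w \<in> borel_measurable borel" "\<And>x. x \<notin> S \<Longrightarrow> w x = 0"
    "AE x in lebesgue_on S. v x = w x" "w \<in> square_integrable lborel"
    using borel_representative_L2[OF S v] by blast
  have vm: "v \<in> borel_measurable (lebesgue_on S)" using v by (simp add: square_integrable_def)
  have b: "box_bump k a b \<in> borel_measurable borel" for k and a b :: "real^'n"
    by (intro borel_measurable_continuous_onI flat_alg_continuous flat_alg_box_bump)
  have "AE x in lborel. x \<in> interior S \<longrightarrow> w x = 0"
  proof (rule fundamental_lemma_box_bump)
    show "integrable lborel (\<lambda>x. indicator (cbox a b) x * w x)" for a b
      by (rule square_integrable_mult[OF indicator_cbox_square_integrable w(4)])
    show "(LINT x|lborel. w x * box_bump k a b x) = 0" if "cbox a b \<subseteq> interior S" for k a b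
      using z[OF that] integral_lebesgue_on_representative[OF S vm w(1-3) b] by simp
  qed (use w in auto)
  then have "AE x in lebesgue_on S. x \<in> interior S \<longrightarrow> w x = 0"
    unfolding AE_lebesgue_on_iff[OF S] by eventually_elim blast
  with w(3) show ?thesis by eventually_elim auto
qed

lemma smooth_iter_partial_continuous: "smooth f \<Longrightarrow> continuous_on UNIV (iter_partial_deriv is f)"
  unfolding smooth_def by (blast intro: continuous_at_imp_continuous_on differentiable_imp_continuous_within)

text \<open>Off the closed support every iterate is locally zero, which determines
  \<open>frechet_derivative\<close> there whatever the function does elsewhere.\<close>

lemma iter_partial_deriv_outside:
  assumes "x \<notin> closure {x. f x \<noteq> 0}"
  shows "iter_partial_deriv is f x = 0"
  using assms
proof (induction "is" arbitrary: x)
  case Nil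
  then show ?case using closure_subset[of "{x. f x \<noteq> 0}"] by (auto simp: iter_partial_deriv_def)
next
  case (Cons i "is")
  have eq: "iter_partial_deriv (i # is) f = partial_deriv i (iter_partial_deriv is f)"
    by (simp add: iter_partial_deriv_def)
  have "((\<lambda>x. 0::real) has_derivative (\<lambda>v. 0)) (at x)" by simp
  then have "(iter_partial_deriv is f has_derivative (\<lambda>v. 0)) (at x)"
    by (rule has_derivative_transform_within_open[of _ _ _ _ "- closure {x. f x \<noteq> 0}"]) (use Cons in auto)
  then show ?case unfolding eq partial_deriv_def by (metis frechet_derivative_at)
qed

lemma test_function_deriv:
  assumes "test_function S \<phi>"
  shows "multi_deriv \<beta> \<phi> \<in> borel_measurable borel" "multi_deriv \<beta> \<phi> \<in> square_integrable lborel"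
proof -
  have t: "smooth \<phi>" "compact (closure {x. \<phi> x \<noteq> 0})" using assms by (auto simp: test_function_def)
  have c: "continuous_on UNIV (multi_deriv \<beta> \<phi>)"
    unfolding multi_deriv_def by (rule smooth_iter_partial_continuous[OF t(1)])
  then show m: "multi_deriv \<beta> \<phi> \<in> borel_measurable borel" by (rule borel_measurable_continuous_onI)
  have z: "multi_deriv \<beta> \<phi> x = 0" if "x \<notin> closure {x. \<phi> x \<noteq> 0}" for x
    unfolding multi_deriv_def by (rule iter_partial_deriv_outside[OF that])
  obtain a where a: "closure {x. \<phi> x \<noteq> 0} \<subseteq> cbox (-a) a"
    using bounded_subset_cbox_symmetric[OF compact_imp_bounded[OF t(2)]] by blast
  have "bounded (multi_deriv \<beta> \<phi> ` closure {x. \<phi> x \<noteq> 0})"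
    by (intro compact_imp_bounded compact_continuous_image[OF _ t(2)] continuous_on_subset[OF c]) simp
  then obtain B where B: "B > 0" "\<And>x. x \<in> closure {x. \<phi> x \<noteq> 0} \<Longrightarrow> \<bar>multi_deriv \<beta> \<phi> x\<bar> \<le> B"
    unfolding bounded_pos by auto
  show "multi_deriv \<beta> \<phi> \<in> square_integrable lborel"
  proof (rule bounded_support_square_integrable[OF m])
    show "\<bar>multi_deriv \<beta> \<phi> x\<bar> \<le> B" for x
      using B z[of x] by (cases "x \<in> closure {x. \<phi> x \<noteq> 0}") auto
    show "multi_deriv \<beta> \<phi> x = 0" if "x \<notin> cbox (-a) a" for x using z a that by blast
  qed
qed

text \<open>The list behind \<open>multi_deriv\<close> is chosen arbitrarily. For the degrees 0 and
  1 it is forced, and no derivative of another order is ever computed explicitly.\<close>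

lemma multi_deriv_zero:
  fixes \<phi> :: "real^'n::finite \<Rightarrow> real"
  shows "multi_deriv (\<lambda>i. 0) \<phi> = \<phi>"
proof -
  have "(SOME is. count_list is = (\<lambda>i. 0)) = ([] :: 'n list)"
  proof (rule some_equality)
    fix xs :: "'n list" assume "count_list xs = (\<lambda>i. 0)"
    then show "xs = []" by (cases xs) (auto simp: fun_eq_iff split: if_splits)
  qed auto
  then show ?thesis by (simp add: multi_deriv_def iter_partial_deriv_def)
qed

lemma multi_deriv_single: "multi_deriv (\<lambda>j. if j = i then 1 else 0) \<phi> = partial_deriv i \<phi>"
proof -
  have "(SOME is. count_list is = (\<lambda>j. if j = i then 1 else 0)) = [i]"
  proof (rule some_equality)
    show "count_list [i] = (\<lambda>j. if j = i then 1 else 0)" by auto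
    fix xs assume c: "count_list xs = (\<lambda>j. if j = i then 1 else 0)"
    have s: "set xs = {i}"
    proof (rule set_eqI)
      show "x \<in> set xs \<longleftrightarrow> x \<in> {i}" for x
        using fun_cong[OF c, of x] count_list_0_iff[of xs x] by (auto split: if_splits)
    qed
    have "length xs = (\<Sum>x\<in>set xs. count_list xs x)" by (simp add: sum_count_set[symmetric])
    then have "length xs = 1" using s c by simp
    then show "xs = [i]" using s by (cases xs) auto
  qed
  then show ?thesis by (simp add: multi_deriv_def iter_partial_deriv_def)
qed

lemma test_function_L2:
  assumes "test_function S \<phi>"
  shows "\<phi> \<in> borel_measurable borel" "\<phi> \<in> square_integrable lborel"
  using test_function_deriv[OF assms, of "\<lambda>i. 0"] unfolding multi_deriv_zero by blast+

lemma test_function_box_bump: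
  assumes "cbox a b \<subseteq> interior S"
  shows "test_function S (box_bump k a b)"
proof (rule flat_alg_test_function[OF flat_alg_box_bump _ assms])
  show "box_bump k a b x = 0" if "x \<notin> cbox a b" for x
    using that box_bump_outside box_subset_cbox[of a b] by blast
qed

text \<open>The boundary of \<open>S\<close> is assumed to be a null set so that test functions, whose supports lie in
  the interior, determine weak derivatives almost everywhere on \<open>S\<close>.\<close>

locale sobolev_domain =
  fixes S :: "(real^'n::finite) set"
  assumes borel: "S \<in> sets borel"
    and null_boundary: "AE x in lebesgue_on S. x \<in> interior S"
begin

abbreviation ip :: "(real^'n \<Rightarrow> real) \<Rightarrow> (real^'n \<Rightarrow> real) \<Rightarrow> real" where
  "ip f g \<equiv> LINT x|lebesgue_on S. f x * g x"

abbreviation L :: "(real^'n \<Rightarrow> real) set" where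
  "L \<equiv> square_integrable (lebesgue_on S)"

abbreviation deg :: "('n \<Rightarrow> nat) \<Rightarrow> nat" where
  "deg \<beta> \<equiv> \<Sum>i\<in>UNIV. \<beta> i"

text \<open>The same choice as inside \<open>sobolev_norm\<close>, so that the norms agree
  literally. As it is made for each function separately, \<open>D \<beta>\<close> is linear only
  almost everywhere.\<close>

definition D :: "('n \<Rightarrow> nat) \<Rightarrow> (real^'n \<Rightarrow> real) \<Rightarrow> (real^'n \<Rightarrow> real)" where
  "D \<beta> h = (SOME v. L2_weak_deriv S \<beta> h v)"

lemma weak_deriv_iff: "L2_weak_deriv S \<beta> h v \<longleftrightarrow> h \<in> L \<and> v \<in> L \<and>
    (\<forall>\<phi>. test_function S \<phi> \<longrightarrow> ip h (multi_deriv \<beta> \<phi>) = (-1) ^ deg \<beta> * ip v \<phi>)"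
  by (simp add: L2_weak_deriv_def L2_space_eq)

lemma test_L: "test_function S \<phi> \<Longrightarrow> \<phi> \<in> L" "test_function S \<phi> \<Longrightarrow> multi_deriv \<beta> \<phi> \<in> L"
  using square_integrable_lebesgue_on[OF borel] test_function_L2 test_function_deriv by blast+

lemma ip_cong_AE:
  assumes "f \<in> L" "f' \<in> L" "g \<in> L" "AE x in lebesgue_on S. f x = f' x"
  shows "ip f g = ip f' g"
proof (rule integral_cong_AE)
  show "AE x in lebesgue_on S. f x * g x = f' x * g x" using assms(4) by eventually_elim simp
qed (use assms(1-3) in \<open>auto simp: square_integrable_def\<close>)

lemma weak_deriv_cong:
  assumes "L2_weak_deriv S \<beta> h v" "h' \<in> L" "v' \<in> L"
    "AE x in lebesgue_on S. h x = h' x" "AE x in lebesgue_on S. v x = v' x"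
  shows "L2_weak_deriv S \<beta> h' v'"
proof -
  have L: "h \<in> L" "v \<in> L" using assms(1) by (auto simp: weak_deriv_iff)
  have "ip h' (multi_deriv \<beta> \<phi>) = (-1) ^ deg \<beta> * ip v' \<phi>" if t: "test_function S \<phi>" for \<phi>
    using assms(1) t ip_cong_AE[OF L(1) assms(2) test_L(2)[OF t] assms(4), of \<beta>]
      ip_cong_AE[OF L(2) assms(3) test_L(1)[OF t] assms(5)] by (simp add: weak_deriv_iff)
  then show ?thesis using assms(2,3) by (simp add: weak_deriv_iff)
qed

text \<open>Box bumps are test functions and annihilate the difference of two weak derivatives. The
  fundamental lemma settles the interior, and the boundary is a null set.\<close>

lemma weak_deriv_unique:
  assumes v: "L2_weak_deriv S \<beta> h v" and w: "L2_weak_deriv S \<beta> h w"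
  shows "AE x in lebesgue_on S. v x = w x"
proof -
  have L: "v \<in> L" "w \<in> L" using v w by (auto simp: weak_deriv_iff)
  have "AE x in lebesgue_on S. x \<in> interior S \<longrightarrow> v x - w x = 0"
  proof (rule du_Bois_Reymond[OF borel])
    show "(\<lambda>x. v x - w x) \<in> L" by (rule L2.diff_mem[OF L])
    fix k a b assume ab: "cbox a b \<subseteq> interior S"
    note t = test_function_box_bump[OF ab, of k]
    have "(-1) ^ deg \<beta> * ip v (box_bump k a b) = (-1) ^ deg \<beta> * ip w (box_bump k a b)"
      using v w t by (simp add: weak_deriv_iff)
    then have "ip v (box_bump k a b) = ip w (box_bump k a b)" by simp
    then show "ip (\<lambda>x. v x - w x) (box_bump k a b) = 0"
      using L2.lin_left[OF L test_L(1)[OF t], of 1 "-1"] by simp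
  qed
  with null_boundary show ?thesis by eventually_elim auto
qed

lemma weak_deriv_lin:
  assumes v: "L2_weak_deriv S \<beta> h v" and w: "L2_weak_deriv S \<beta> k w"
  shows "L2_weak_deriv S \<beta> (\<lambda>x. a * h x + b * k x) (\<lambda>x. a * v x + b * w x)"
proof -
  have L: "h \<in> L" "k \<in> L" "v \<in> L" "w \<in> L" using v w by (auto simp: weak_deriv_iff)
  show ?thesis
    unfolding weak_deriv_iff
  proof (intro conjI allI impI)
    fix \<phi> assume t: "test_function S \<phi>"
    have "ip h (multi_deriv \<beta> \<phi>) = (-1) ^ deg \<beta> * ip v \<phi>" "ip k (multi_deriv \<beta> \<phi>) = (-1) ^ deg \<beta> * ip w \<phi>"
      using v w t by (auto simp: weak_deriv_iff)
    then show "ip (\<lambda>x. a * h x + b * k x) (multi_deriv \<beta> \<phi>) = (- 1) ^ deg \<beta> * ip (\<lambda>x. a * v x + b * w x) \<phi>"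
      unfolding L2.lin_left[OF L(1,2) test_L(2)[OF t]] L2.lin_left[OF L(3,4) test_L(1)[OF t]]
      by (simp add: algebra_simps)
  qed (use L square_integrable_lin[OF L(1,2)] square_integrable_lin[OF L(3,4)] in auto)
qed

lemma weak_deriv_zero: "h \<in> L \<Longrightarrow> L2_weak_deriv S (\<lambda>i. 0) h h"
  by (simp add: weak_deriv_iff multi_deriv_zero)

lemma ip_limit:
  assumes f: "\<And>k. f k \<in> L" "h \<in> L" "g \<in> L" and lim: "(\<lambda>k. L2.nrm (lebesgue_on S) (\<lambda>x. f k x - h x)) \<longlonglongrightarrow> 0"
  shows "(\<lambda>k. ip (f k) g) \<longlonglongrightarrow> ip h g"
proof -
  have "(\<lambda>k. ip (f k) g - ip h g) \<longlonglongrightarrow> 0"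
  proof (rule Lim_null_comparison)
    show "(\<lambda>k. L2.nrm (lebesgue_on S) (\<lambda>x. f k x - h x) * L2.nrm (lebesgue_on S) g) \<longlonglongrightarrow> 0"
      by (rule tendsto_mult_left_zero[OF lim])
    have "ip (f k) g - ip h g = ip (\<lambda>x. f k x - h x) g" for k
      using L2.lin_left[OF f(1) f(2) f(3), of 1 k "-1"] by simp
    then show "\<forall>\<^sub>F k in sequentially. norm (ip (f k) g - ip h g)
        \<le> L2.nrm (lebesgue_on S) (\<lambda>x. f k x - h x) * L2.nrm (lebesgue_on S) g"
      using L2.Cauchy_Schwarz[OF L2.diff_mem[OF f(1) f(2)] f(3)] by simp
  qed
  then show ?thesis by (simp add: LIM_zero_iff)
qed

text \<open>Weak differentiation has a closed graph: with the test function fixed, both sides of its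
  defining identity are continuous in the L2 norm.\<close>

lemma weak_deriv_limit:
  assumes fv: "\<And>k. L2_weak_deriv S \<beta> (f k) (v k)" and hw: "h \<in> L" "w \<in> L"
    and "(\<lambda>k. L2.nrm (lebesgue_on S) (\<lambda>x. f k x - h x)) \<longlonglongrightarrow> 0"
    and "(\<lambda>k. L2.nrm (lebesgue_on S) (\<lambda>x. v k x - w x)) \<longlonglongrightarrow> 0"
  shows "L2_weak_deriv S \<beta> h w"
  unfolding weak_deriv_iff
proof (intro conjI allI impI hw)
  fix \<phi> assume t: "test_function S \<phi>"
  have L: "f k \<in> L" "v k \<in> L" for k using fv by (auto simp: weak_deriv_iff)
  have "(\<lambda>k. ip (f k) (multi_deriv \<beta> \<phi>)) \<longlonglongrightarrow> ip h (multi_deriv \<beta> \<phi>)"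
    by (rule ip_limit[OF L(1) hw(1) test_L(2)[OF t] assms(4)])
  moreover have "(\<lambda>k. (-1) ^ deg \<beta> * ip (v k) \<phi>) \<longlonglongrightarrow> (-1) ^ deg \<beta> * ip w \<phi>"
    by (intro tendsto_intros ip_limit[OF L(2) hw(2) test_L(1)[OF t] assms(5)])
  moreover have "ip (f k) (multi_deriv \<beta> \<phi>) = (-1) ^ deg \<beta> * ip (v k) \<phi>" for k
    using fv t by (auto simp: weak_deriv_iff)
  ultimately show "ip h (multi_deriv \<beta> \<phi>) = (-1) ^ deg \<beta> * ip w \<phi>"
    by (simp add: LIMSEQ_unique)
qed

lemma finite_multi_indices: "finite {\<beta> :: 'n \<Rightarrow> nat. deg \<beta> \<le> m}"
proof (rule finite_subset)
  show "{\<beta> :: 'n \<Rightarrow> nat. deg \<beta> \<le> m} \<subseteq> (UNIV \<rightarrow>\<^sub>E {..m})"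
  proof
    fix \<beta> :: "'n \<Rightarrow> nat" assume "\<beta> \<in> {\<beta>. deg \<beta> \<le> m}"
    then have "\<beta> i \<le> m" for i using member_le_sum[of i UNIV \<beta>] by simp
    then show "\<beta> \<in> UNIV \<rightarrow>\<^sub>E {..m}" by auto
  qed
  show "finite ((UNIV :: 'n set) \<rightarrow>\<^sub>E {..m})" by (intro finite_PiE) auto
qed

abbreviation H :: "nat \<Rightarrow> (real^'n \<Rightarrow> real) set" where "H m \<equiv> sobolev_space S m"

lemma D_weak:
  assumes "h \<in> H m" "deg \<beta> \<le> m"
  shows "L2_weak_deriv S \<beta> h (D \<beta> h)"
proof -
  have "\<exists>v. L2_weak_deriv S \<beta> h v" using assms by (simp add: sobolev_space_def)
  then show ?thesis unfolding D_def by (rule someI_ex)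
qed

lemma D_L: "h \<in> H m \<Longrightarrow> deg \<beta> \<le> m \<Longrightarrow> D \<beta> h \<in> L"
  using D_weak weak_deriv_iff by blast

lemma sobolev_L: "h \<in> H m \<Longrightarrow> h \<in> L"
  using D_weak[of h m "\<lambda>i. 0"] weak_deriv_iff by auto

lemma D_zero: "h \<in> H m \<Longrightarrow> AE x in lebesgue_on S. D (\<lambda>i. 0) h x = h x"
  using weak_deriv_unique[OF D_weak[of h m "\<lambda>i. 0"] weak_deriv_zero[OF sobolev_L]] by simp

lemma sobolev_lin:
  assumes "h \<in> H m" "k \<in> H m"
  shows "(\<lambda>x. a * h x + b * k x) \<in> H m"
proof -
  have "\<exists>v. L2_weak_deriv S \<beta> (\<lambda>x. a * h x + b * k x) v" if "deg \<beta> \<le> m" for \<beta>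
    using weak_deriv_lin[OF D_weak[OF assms(1) that] D_weak[OF assms(2) that]] by blast
  then show ?thesis by (simp add: sobolev_space_def)
qed

lemma D_lin:
  assumes "h \<in> H m" "k \<in> H m" "deg \<beta> \<le> m"
  shows "AE x in lebesgue_on S. D \<beta> (\<lambda>x. a * h x + b * k x) x = a * D \<beta> h x + b * D \<beta> k x"
  using assms by (intro weak_deriv_unique[OF D_weak weak_deriv_lin[OF D_weak D_weak]] sobolev_lin) auto

definition sip :: "nat \<Rightarrow> (real^'n \<Rightarrow> real) \<Rightarrow> (real^'n \<Rightarrow> real) \<Rightarrow> real" where
  "sip m h k = (\<Sum>\<beta> | deg \<beta> \<le> m. ip (D \<beta> h) (D \<beta> k))"

sublocale sob: semi_inner_space "H m" "sip m" for m
proof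
  fix h k l and a b :: real
  assume h: "h \<in> H m" and k: "k \<in> H m"
  show "(\<lambda>x. a * h x + b * k x) \<in> H m" by (rule sobolev_lin[OF h k])
  show "sip m h k = sip m k h" unfolding sip_def by (simp add: mult.commute)
  assume l: "l \<in> H m"
  have "ip (D \<beta> (\<lambda>x. a * h x + b * k x)) (D \<beta> l) = a * ip (D \<beta> h) (D \<beta> l) + b * ip (D \<beta> k) (D \<beta> l)"
    if "deg \<beta> \<le> m" for \<beta>
  proof -
    have "ip (D \<beta> (\<lambda>x. a * h x + b * k x)) (D \<beta> l) = ip (\<lambda>x. a * D \<beta> h x + b * D \<beta> k x) (D \<beta> l)"
      by (rule ip_cong_AE[OF D_L[OF sobolev_lin[OF h k] that] square_integrable_lin[OF D_L[OF h that] D_L[OF k that]]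
          D_L[OF l that] D_lin[OF h k that]])
    then show ?thesis using L2.lin_left[OF D_L[OF h that] D_L[OF k that] D_L[OF l that]] by simp
  qed
  then show "sip m (\<lambda>x. a * h x + b * k x) l = a * sip m h l + b * sip m k l"
    unfolding sip_def sum_distrib_left sum.distrib[symmetric] by (intro sum.cong) auto
next
  show "0 \<le> sip m h h" for h unfolding sip_def by (intro sum_nonneg) simp
qed

lemma sobolev_norm_eq: "sobolev_norm S m h = sob.nrm m h"
proof -
  have "(L2_norm S (D \<beta> h))\<^sup>2 = ip (D \<beta> h) (D \<beta> h)" for \<beta>
    by (simp add: L2_norm_def power2_eq_square[of "D \<beta> h _"])
  then show ?thesis
    unfolding sobolev_norm_def sob.nrm_def sip_def D_def by simp
qed

lemma sob_nrm_sq: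
  assumes "h \<in> H m"
  shows "(sob.nrm m h)\<^sup>2 = (\<Sum>\<beta> | deg \<beta> \<le> m. (L2.nrm (lebesgue_on S) (D \<beta> h))\<^sup>2)"
proof -
  have "ip (D \<beta> h) (D \<beta> h) = (L2.nrm (lebesgue_on S) (D \<beta> h))\<^sup>2" if "deg \<beta> \<le> m" for \<beta>
    by (rule L2.nrm_sq[OF D_L[OF assms that], symmetric])
  then show ?thesis unfolding sob.nrm_sq[OF assms] sip_def by (intro sum.cong) auto
qed

lemma D_le_nrm:
  assumes "h \<in> H m" "deg \<beta> \<le> m"
  shows "L2.nrm (lebesgue_on S) (D \<beta> h) \<le> sob.nrm m h"
proof (rule power2_le_imp_le)
  show "(L2.nrm (lebesgue_on S) (D \<beta> h))\<^sup>2 \<le> (sob.nrm m h)\<^sup>2"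
    unfolding sob_nrm_sq[OF assms(1)]
  proof (rule member_le_sum)
    show "\<beta> \<in> {\<beta>. deg \<beta> \<le> m}" using assms(2) by blast
  qed (rule zero_le_power2 finite_multi_indices)+
qed (rule sob.nrm_nonneg[OF assms(1)])

lemma nrm_eq_0:
  assumes "h \<in> H m" "sob.nrm m h = 0"
  shows "AE x in lebesgue_on S. h x = 0"
proof -
  have L: "D (\<lambda>i. 0) h \<in> L" using D_L[OF assms(1), of "\<lambda>i. 0"] by simp
  have "L2.nrm (lebesgue_on S) (D (\<lambda>i. 0) h) = 0"
    using D_le_nrm[OF assms(1), of "\<lambda>i. 0"] assms(2) L2.nrm_nonneg[OF L] by simp
  from L2_nrm_eq_0[OF L this] D_zero[OF assms(1)] show ?thesis by eventually_elim auto
qed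

lemma L2_nrm_cong_AE:
  assumes "f \<in> L" "g \<in> L" "AE x in lebesgue_on S. f x = g x"
  shows "L2.nrm (lebesgue_on S) f = L2.nrm (lebesgue_on S) g"
proof -
  have "ip f f = ip g f" by (rule ip_cong_AE[OF assms(1,2) assms(1) assms(3)])
  also have "\<dots> = ip f g" by (rule L2.comm[OF assms(2,1)])
  also have "\<dots> = ip g g" by (rule ip_cong_AE[OF assms(1,2) assms(2) assms(3)])
  finally show ?thesis by (simp only: L2.nrm_def)
qed

text \<open>The norm is built from chosen derivatives of \<open>h\<close>. Zero is one weak
  derivative of a null function, and uniqueness transfers this to the chosen ones.\<close>

lemma AE_zero_nrm:
  assumes "h \<in> H m" "AE x in lebesgue_on S. h x = 0"
  shows "sob.nrm m h = 0"
proof -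
  have "L2.nrm (lebesgue_on S) (D \<beta> h) = 0" if "deg \<beta> \<le> m" for \<beta>
  proof -
    have z: "(\<lambda>x. 0) \<in> L" by (simp add: square_integrable_def)
    have "L2_weak_deriv S \<beta> (\<lambda>x. 0) (\<lambda>x. 0)" by (simp add: weak_deriv_iff z)
    then have "L2_weak_deriv S \<beta> h (\<lambda>x. 0)"
      by (rule weak_deriv_cong[OF _ sobolev_L[OF assms(1)] z]) (use assms(2) in auto)
    from L2_nrm_cong_AE[OF D_L[OF assms(1) that] z weak_deriv_unique[OF D_weak[OF assms(1) that] this]]
    show ?thesis using L2.nrm_zero[OF z] by simp
  qed
  then have "(sob.nrm m h)\<^sup>2 = 0" unfolding sob_nrm_sq[OF assms(1)] by (intro sum.neutral) auto
  then show ?thesis by simp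
qed

text \<open>All derivatives converge in L2 separately. The limit at the multi-index 0 is the
  candidate, and closedness of weak differentiation recognises the other limits as its
  derivatives.\<close>

lemma sobolev_complete:
  assumes f: "\<And>k. f k \<in> H m"
    and cauchy: "\<And>e. e > 0 \<Longrightarrow> \<exists>K. \<forall>j\<ge>K. \<forall>k\<ge>K. sob.nrm m (\<lambda>x. f j x - f k x) < e"
  shows "\<exists>h\<in>H m. (\<lambda>k. sob.nrm m (\<lambda>x. f k x - h x)) \<longlonglongrightarrow> 0"
proof -
  have diff: "AE x in lebesgue_on S. D \<beta> (\<lambda>x. h x - k x) x = D \<beta> h x - D \<beta> k x"
    if "h \<in> H m" "k \<in> H m" "deg \<beta> \<le> m" for h k \<beta>
    using D_lin[OF that, of 1 "-1"] by simp
  have "\<exists>w\<in>L. (\<lambda>k. L2.nrm (lebesgue_on S) (\<lambda>x. D \<beta> (f k) x - w x)) \<longlonglongrightarrow> 0" if \<beta>: "deg \<beta> \<le> m" for \<beta>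
  proof (rule L2_complete)
    show "D \<beta> (f k) \<in> L" for k by (rule D_L[OF f \<beta>])
    fix e :: real assume "e > 0"
    then obtain K where K: "\<And>j k. j \<ge> K \<Longrightarrow> k \<ge> K \<Longrightarrow> sob.nrm m (\<lambda>x. f j x - f k x) < e"
      using cauchy by blast
    have "L2.nrm (lebesgue_on S) (\<lambda>x. D \<beta> (f j) x - D \<beta> (f k) x) \<le> sob.nrm m (\<lambda>x. f j x - f k x)" for j k
      using L2_nrm_cong_AE[OF D_L[OF sob.diff_mem[OF f f] \<beta>] L2.diff_mem[OF D_L[OF f \<beta>] D_L[OF f \<beta>]] diff[OF f f \<beta>], of j k]
        D_le_nrm[OF sob.diff_mem[OF f f] \<beta>, of j k] by simp
    then show "\<exists>K. \<forall>j\<ge>K. \<forall>k\<ge>K. L2.nrm (lebesgue_on S) (\<lambda>x. D \<beta> (f j) x - D \<beta> (f k) x) < e"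
      using K by (intro exI[of _ K] allI impI) (rule order_le_less_trans)
  qed
  then have "\<forall>\<beta>. \<exists>w. deg \<beta> \<le> m \<longrightarrow> w \<in> L \<and> (\<lambda>k. L2.nrm (lebesgue_on S) (\<lambda>x. D \<beta> (f k) x - w x)) \<longlonglongrightarrow> 0"
    by blast
  from choice[OF this]
obtain w where w: "\<And>\<beta>. deg \<beta> \<le> m \<Longrightarrow> w \<beta> \<in> L"
    "\<And>\<beta>. deg \<beta> \<le> m \<Longrightarrow> (\<lambda>k. L2.nrm (lebesgue_on S) (\<lambda>x. D \<beta> (f k) x - w \<beta> x)) \<longlonglongrightarrow> 0"
    by blast
  define h where "h = w (\<lambda>i. 0)"
  have hL: "h \<in> L" unfolding h_def by (rule w) simp
  have "L2.nrm (lebesgue_on S) (\<lambda>x. D (\<lambda>i. 0) (f k) x - h x) = L2.nrm (lebesgue_on S) (\<lambda>x. f k x - h x)" for k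
    by (rule L2_nrm_cong_AE[OF L2.diff_mem[OF D_L[OF f] hL] L2.diff_mem[OF sobolev_L[OF f] hL]])
      (use D_zero[OF f[of k]] in auto)
  then have fh: "(\<lambda>k. L2.nrm (lebesgue_on S) (\<lambda>x. f k x - h x)) \<longlonglongrightarrow> 0"
    using w(2)[of "\<lambda>i. 0"] by (simp add: h_def)
  have wd: "L2_weak_deriv S \<beta> h (w \<beta>)" if "deg \<beta> \<le> m" for \<beta>
    by (rule weak_deriv_limit[OF D_weak[OF f that] hL w(1)[OF that] fh w(2)[OF that]])
  then have hH: "h \<in> H m" by (auto simp: sobolev_space_def)
  have "(\<lambda>k. (sob.nrm m (\<lambda>x. f k x - h x))\<^sup>2) \<longlonglongrightarrow> (\<Sum>\<beta> | deg \<beta> \<le> m. 0\<^sup>2)"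
    unfolding sob_nrm_sq[OF sob.diff_mem[OF f hH]]
  proof (intro tendsto_sum tendsto_power)
    fix \<beta> assume "\<beta> \<in> {\<beta>. deg \<beta> \<le> m}"
    then have \<beta>: "deg \<beta> \<le> m" by simp
    have "AE x in lebesgue_on S. D \<beta> (\<lambda>x. f k x - h x) x = D \<beta> (f k) x - w \<beta> x" for k
      using diff[OF f[of k] hH \<beta>] weak_deriv_unique[OF D_weak[OF hH \<beta>] wd[OF \<beta>]]
      by eventually_elim simp
    from L2_nrm_cong_AE[OF D_L[OF sob.diff_mem[OF f hH] \<beta>] L2.diff_mem[OF D_L[OF f \<beta>] w(1)[OF \<beta>]] this] w(2)[OF \<beta>]
    show "(\<lambda>k. L2.nrm (lebesgue_on S) (D \<beta> (\<lambda>x. f k x - h x))) \<longlonglongrightarrow> 0" by simp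
  qed
  then have "(\<lambda>k. sqrt ((sob.nrm m (\<lambda>x. f k x - h x))\<^sup>2)) \<longlonglongrightarrow> sqrt (\<Sum>\<beta> | deg \<beta> \<le> m. 0\<^sup>2)"
    by (rule tendsto_real_sqrt)
  then have "(\<lambda>k. sob.nrm m (\<lambda>x. f k x - h x)) \<longlonglongrightarrow> 0"
    using sob.nrm_nonneg[OF sob.diff_mem[OF f hH]] by simp
  with hH show ?thesis by blast
qed

end

section \<open>Dilations and a Hardy inequality\<close>

lemma nn_integral_scale:
  fixes f :: "'a::euclidean_space \<Rightarrow> ennreal"
  assumes c: "c > 0" and f: "f \<in> borel_measurable borel"
  shows "(\<integral>\<^sup>+x. f x \<partial>lborel) = ennreal (c ^ DIM('a)) * (\<integral>\<^sup>+x. f (c *\<^sub>R x) \<partial>lborel)"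
proof -
  have "(\<integral>\<^sup>+x. f x \<partial>lborel) = (\<integral>\<^sup>+x. f x \<partial>density (distr lborel borel (\<lambda>x. 0 + c *\<^sub>R x)) (\<lambda>_. ennreal (\<bar>c\<bar> ^ DIM('a))))"
    using lborel_affine[of c "0::'a"] c by simp
  also have "\<dots> = (\<integral>\<^sup>+x. ennreal (\<bar>c\<bar> ^ DIM('a)) * f (0 + c *\<^sub>R x) \<partial>lborel)"
    using f by (subst nn_integral_density) (auto simp: nn_integral_distr)
  also have "\<dots> = ennreal (c ^ DIM('a)) * (\<integral>\<^sup>+x. f (c *\<^sub>R x) \<partial>lborel)"
    using f c by (simp add: nn_integral_cmult)
  finally show ?thesis .
qed

lemma integral_scale:
  fixes f :: "'a::euclidean_space \<Rightarrow> real"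
  assumes c: "c > 0" and f: "f \<in> borel_measurable borel"
  shows "(LINT x|lborel. f x) = c ^ DIM('a) * (LINT x|lborel. f (c *\<^sub>R x))"
proof -
  have "(LINT x|lborel. f x) = (LINT x|density (distr lborel borel (\<lambda>x. 0 + c *\<^sub>R x)) (\<lambda>_. ennreal (\<bar>c\<bar> ^ DIM('a))). f x)"
    using lborel_affine[of c "0::'a"] c by simp
  also have "\<dots> = (LINT x|distr lborel borel (\<lambda>x. 0 + c *\<^sub>R x). (\<bar>c\<bar> ^ DIM('a)) *\<^sub>R f x)"
    using f by (intro integral_density) auto
  also have "\<dots> = (LINT x|lborel. (\<bar>c\<bar> ^ DIM('a)) *\<^sub>R f (0 + c *\<^sub>R x))"
    using f by (intro integral_distr) auto
  finally show ?thesis using c by simp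
qed

lemma square_integrable_scale:
  fixes f :: "'a::euclidean_space \<Rightarrow> real"
  assumes c: "c > 0" and f: "f \<in> square_integrable lborel"
  shows "(\<lambda>x. f (c *\<^sub>R x)) \<in> square_integrable lborel"
proof (rule square_integrableI_nn)
  have fm[measurable]: "f \<in> borel_measurable borel" using f by (simp add: square_integrable_def)
  show "(\<lambda>x. f (c *\<^sub>R x)) \<in> borel_measurable lborel" by measurable
  have "ennreal (c ^ DIM('a)) * (\<integral>\<^sup>+x. ennreal ((f (c *\<^sub>R x))\<^sup>2) \<partial>lborel) = (\<integral>\<^sup>+x. ennreal ((f x)\<^sup>2) \<partial>lborel)"
    by (rule nn_integral_scale[OF c, symmetric]) measurable
  also have "\<dots> < \<infinity>" unfolding square_integrable_nn[OF f] by simp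
  finally show "(\<integral>\<^sup>+x. ennreal ((f (c *\<^sub>R x))\<^sup>2) \<partial>lborel) < \<infinity>"
    using c by (auto simp: ennreal_mult_less_top)
qed

section \<open>Differentiating integrals, and test functions under dilation\<close>

lemma has_derivative_under_integral:
  fixes F F' :: "real \<Rightarrow> 'a \<Rightarrow> real"
  assumes t0: "t0 \<in> {a<..<b}"
    and F: "\<And>t. t \<in> {a<..<b} \<Longrightarrow> integrable M (F t)"
    and F': "\<And>t x. t \<in> {a<..<b} \<Longrightarrow> x \<in> space M \<Longrightarrow> ((\<lambda>t. F t x) has_real_derivative F' t x) (at t)"
    and bd: "\<And>t x. t \<in> {a<..<b} \<Longrightarrow> x \<in> space M \<Longrightarrow> \<bar>F' t x\<bar> \<le> G x"
    and G: "integrable M G"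
  shows "integrable M (F' t0)"
    and "((\<lambda>t. \<integral>x. F t x \<partial>M) has_real_derivative (\<integral>x. F' t0 x \<partial>M)) (at t0)"
proof -
  define e where "e = min (t0 - a) (b - t0)"
  have e: "e > 0" "\<And>h. \<bar>h\<bar> < e \<Longrightarrow> t0 + h \<in> {a<..<b}" using t0 by (auto simp: e_def)
  \<comment> \<open>The mean value inequality makes the majorant of the derivative a majorant of all
    difference quotients.\<close>
  have lip: "\<bar>(F (t0 + h) x - F t0 x) / h\<bar> \<le> G x" if h: "\<bar>h\<bar> < e" and x: "x \<in> space M" for h x
  proof -
    have "norm (F (t0 + h) x - F t0 x) \<le> G x * norm (t0 + h - t0)"
    proof (rule field_differentiable_bound)
      show "convex {a<..<b}" by simp
      show "((\<lambda>t. F t x) has_field_derivative F' t x) (at t within {a<..<b})" if "t \<in> {a<..<b}" for t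
        by (rule has_field_derivative_at_within[OF F'[OF that x]])
      show "norm (F' t x) \<le> G x" if "t \<in> {a<..<b}" for t using bd[OF that x] by simp
    qed (use e(2)[OF h] t0 in auto)
    moreover have "0 \<le> G x" using bd[OF t0 x] by simp
    ultimately show ?thesis by (cases "h = 0") (auto simp: field_simps)
  qed
  have key: "(\<lambda>i. ((\<integral>x. F (t0 + X i) x \<partial>M) - (\<integral>x. F t0 x \<partial>M)) / X i) \<longlonglongrightarrow> (\<integral>x. F' t0 x \<partial>M) \<and> integrable M (F' t0)"
    if X: "X \<longlonglongrightarrow> 0" "\<And>i. X i \<noteq> 0" "\<And>i. \<bar>X i\<bar> < e" for X
  proof -
    have int: "integrable M (\<lambda>x. (F (t0 + X i) x - F t0 x) / X i)" for i
      using F[OF e(2)[OF X(3)]] F[OF t0] by auto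
    have lim: "(\<lambda>i. (F (t0 + X i) x - F t0 x) / X i) \<longlonglongrightarrow> F' t0 x" if "x \<in> space M" for x
    proof -
      have "((\<lambda>h. (F (t0 + h) x - F t0 x) / h) \<longlongrightarrow> F' t0 x) (at 0)"
        using F'[OF t0 that] by (simp add: DERIV_def)
      then show ?thesis using X(1,2) unfolding tendsto_at_iff_sequentially by (auto simp: o_def)
    qed
    have meas: "F' t0 \<in> borel_measurable M"
      by (rule borel_measurable_LIMSEQ_real[OF lim borel_measurable_integrable[OF int]])
    have "(\<lambda>i. \<integral>x. (F (t0 + X i) x - F t0 x) / X i \<partial>M) \<longlonglongrightarrow> (\<integral>x. F' t0 x \<partial>M)"
      by (rule integral_dominated_convergence[OF meas borel_measurable_integrable[OF int] G])
        (use lim lip[OF X(3)] in auto)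
    moreover have "(\<integral>x. (F (t0 + X i) x - F t0 x) / X i \<partial>M) = ((\<integral>x. F (t0 + X i) x \<partial>M) - (\<integral>x. F t0 x \<partial>M)) / X i" for i
      using F[OF e(2)[OF X(3)]] F[OF t0] by (simp add: Bochner_Integration.integral_diff)
    moreover have "integrable M (F' t0)"
      by (rule Bochner_Integration.integrable_bound[OF G meas]) (use bd[OF t0] in \<open>auto intro!: AE_I2 order_trans[OF _ abs_ge_self]\<close>)
    ultimately show ?thesis using X(2) by simp
  qed
  \<comment> \<open>One concrete sequence tending to 0 is enough to read off the integrability of
    \<open>F' t0\<close> from \<open>key\<close>.\<close>
  define Y where "Y i = e / real (Suc (Suc i))" for i
  have "(\<lambda>i. e * inverse (real (Suc (Suc i)))) \<longlonglongrightarrow> e * 0"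
    by (intro tendsto_intros LIMSEQ_Suc[OF LIMSEQ_inverse_real_of_nat])
  then have "Y \<longlonglongrightarrow> 0" by (simp add: Y_def[abs_def] divide_inverse)
  moreover have "\<bar>Y i\<bar> < e" "Y i \<noteq> 0" for i using e(1) by (auto simp: Y_def field_simps intro: add_pos_nonneg)
  ultimately show "integrable M (F' t0)" using key by blast
  show "((\<lambda>t. \<integral>x. F t x \<partial>M) has_real_derivative (\<integral>x. F' t0 x \<partial>M)) (at t0)"
    unfolding DERIV_def tendsto_at_iff_sequentially
  proof (intro allI impI)
    fix X :: "nat \<Rightarrow> real" assume X0: "\<forall>i. X i \<in> UNIV - {0}" and X: "X \<longlonglongrightarrow> 0"
    obtain N where N: "\<And>i. i \<ge> N \<Longrightarrow> \<bar>X i\<bar> < e" using LIMSEQ_D[OF X e(1)] by auto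
    have "(\<lambda>i. ((\<integral>x. F (t0 + X (i + N)) x \<partial>M) - (\<integral>x. F t0 x \<partial>M)) / X (i + N)) \<longlonglongrightarrow> (\<integral>x. F' t0 x \<partial>M)"
      using key[of "\<lambda>i. X (i + N)"] LIMSEQ_ignore_initial_segment[OF X] X0 N by auto
    then show "((\<lambda>h. ((\<integral>x. F (t0 + h) x \<partial>M) - (\<integral>x. F t0 x \<partial>M)) / h) \<circ> X) \<longlonglongrightarrow> (\<integral>x. F' t0 x \<partial>M)"
      unfolding o_def by (rule LIMSEQ_offset)
  qed
qed

lemma flat_alg_scale: "flat_alg f \<Longrightarrow> flat_alg (\<lambda>x. f (c *\<^sub>R x))"
proof (induction rule: flat_alg.induct)
  case (flat j c' i d)
  have "flat_alg (\<lambda>x::real^'a. flat j ((c' * c) * x $ i + d))" by (rule flat_alg.flat)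
  then show ?case by (simp add: mult.assoc)
next
  case (coord i)
  show ?case by (simp add: flat_alg.intros)
qed (simp_all add: flat_alg.intros)

lemma flat_alg_bounded:
  assumes "flat_alg f" "\<And>x. x \<notin> cbox a b \<Longrightarrow> f x = 0"
  obtains B where "B \<ge> 0" "\<And>x. \<bar>f x\<bar> \<le> B"
proof -
  have "bounded (f ` cbox a b)"
    by (intro compact_imp_bounded compact_continuous_image continuous_on_subset[OF flat_alg_continuous[OF assms(1)]]) auto
  then obtain B where "B > 0" "\<And>x. x \<in> cbox a b \<Longrightarrow> \<bar>f x\<bar> \<le> B" unfolding bounded_pos by auto
  moreover from this have "\<bar>f x\<bar> \<le> B" for x using assms(2)[of x] by (cases "x \<in> cbox a b") auto
  ultimately show thesis by (intro that[of B]) auto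
qed

lemma partial_deriv_outside_cbox:
  assumes "\<And>x. x \<notin> cbox a b \<Longrightarrow> f x = 0" "x \<notin> cbox a b"
  shows "partial_deriv i f x = 0"
proof -
  have "closure {x. f x \<noteq> 0} \<subseteq> cbox a b" using assms(1) by (intro closure_minimal) auto
  then show ?thesis using iter_partial_deriv_outside[of x f "[i]"] assms(2) by (auto simp: iter_partial_deriv_def)
qed

lemma flat_alg_borel: "flat_alg f \<Longrightarrow> f \<in> borel_measurable borel"
  by (intro borel_measurable_continuous_onI flat_alg_continuous)

text \<open>Summed over \<open>i\<close> this is the divergence of the field \<open>y\<close> times
  \<open>\<phi> (t *\<^sub>R y)\<close>, and its product with \<open>t ^ (n - 1)\<close> is the
  derivative of \<open>t ^ n * \<phi> (t *\<^sub>R y)\<close> in \<open>t\<close>, where n is the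
  dimension. A derivative in the dilation parameter thus becomes spatial derivatives of test
  functions.\<close>

lemma partial_deriv_coord_mult_scale:
  assumes "flat_alg \<phi>"
  shows "partial_deriv i (\<lambda>y. y $ i * \<phi> (t *\<^sub>R y)) y = \<phi> (t *\<^sub>R y) + y $ i * (t * partial_deriv i \<phi> (t *\<^sub>R y))"
proof -
  have "((\<lambda>y. t *\<^sub>R y) has_derivative (\<lambda>v. t *\<^sub>R v)) (at y)"
    by (intro has_derivative_scaleR_right has_derivative_ident)
  from has_derivative_compose[OF this flat_alg_partial(2)[OF assms]]
  have 1: "((\<lambda>y. \<phi> (t *\<^sub>R y)) has_derivative (\<lambda>v. \<Sum>k\<in>UNIV. (t *\<^sub>R v) $ k * partial_deriv k \<phi> (t *\<^sub>R y))) (at y)" .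
  have 2: "((\<lambda>y::real^'a. y $ i) has_derivative (\<lambda>v. v $ i)) (at y)"
    by (rule bounded_linear_imp_has_derivative[OF bounded_linear_vec_nth])
  have "y $ i * (\<Sum>k\<in>UNIV. (t *\<^sub>R v) $ k * partial_deriv k \<phi> (t *\<^sub>R y)) + v $ i * \<phi> (t *\<^sub>R y)
    = (\<Sum>k\<in>UNIV. v $ k * (y $ i * (t * partial_deriv k \<phi> (t *\<^sub>R y)) + (if k = i then \<phi> (t *\<^sub>R y) else 0)))" for v
    unfolding distrib_left sum.distrib sum_vec_delta sum_distrib_left
    by (intro arg_cong2[of _ _ _ _ "(+)"] sum.cong) (auto simp: algebra_simps)
  with has_derivative_mult[OF 2 1]
  have "((\<lambda>y. y $ i * \<phi> (t *\<^sub>R y)) has_derivative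
    (\<lambda>v. \<Sum>k\<in>UNIV. v $ k * (y $ i * (t * partial_deriv k \<phi> (t *\<^sub>R y)) + (if k = i then \<phi> (t *\<^sub>R y) else 0)))) (at y)"
    by simp
  from partial_deriv_eq[OF this, of i] show ?thesis by simp
qed

section \<open>Dilations of a function with a weak gradient outside the ball\<close>

locale weak_gradient =
  fixes r :: real and w :: "real^'n::finite \<Rightarrow> real" and g :: "'n \<Rightarrow> real^'n \<Rightarrow> real"
  assumes r: "r > 0"
    and w: "w \<in> square_integrable lborel" and g: "\<And>i. g i \<in> square_integrable lborel"
    and weak: "\<And>\<phi> i a b. flat_alg \<phi> \<Longrightarrow> (\<And>x. x \<notin> cbox a b \<Longrightarrow> \<phi> x = 0) \<Longrightarrow>
        cbox a b \<subseteq> {y. r < norm y} \<Longrightarrow>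
        (LINT y|lborel. w y * partial_deriv i \<phi> y) = - (LINT y|lborel. g i y * \<phi> y)"
begin

lemma meas[measurable]: "w \<in> borel_measurable borel" "g i \<in> borel_measurable borel"
  using w g[of i] by (auto simp: square_integrable_def)

text \<open>Formally \<open>K t y\<close> is the derivative of \<open>- w(y / t)\<close> with respect to \<open>t\<close>.\<close>

definition K :: "real \<Rightarrow> real^'n \<Rightarrow> real" where
  "K t y = (1 / t\<^sup>2) * (\<Sum>i\<in>UNIV. g i ((1 / t) *\<^sub>R y) * y $ i)"

text \<open>\<open>w\<close> itself cannot be differentiated. A substitution moves the dilation to
  the test function, which is differentiated in \<open>t\<close>; the weak gradient is applied, and
  a second substitution moves the dilation back. Since \<open>t \<le> 1\<close>, the support of the
  dilated test function stays outside the ball.\<close>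

lemma dilation_derivative:
  assumes \<phi>: "flat_alg \<phi>" "\<And>x. x \<notin> cbox a b \<Longrightarrow> \<phi> x = 0" "cbox a b \<subseteq> {y. r < norm y}"
    and t: "0 < t" "t \<le> 1"
  shows "((\<lambda>t. LINT y|lborel. w ((1 / t) *\<^sub>R y) * \<phi> y) has_real_derivative - (LINT y|lborel. K t y * \<phi> y)) (at t)"
proof -
  let ?n = "CARD('n)"
  have [measurable]: "\<phi> \<in> borel_measurable borel" "partial_deriv i \<phi> \<in> borel_measurable borel" for i
    using flat_alg_borel \<phi>(1) flat_alg_partial(1) by blast+
  define \<psi> where "\<psi> i t y = \<phi> (t *\<^sub>R y) + y $ i * (t * partial_deriv i \<phi> (t *\<^sub>R y))" for i t y
  define F where "F t y = w y * (t ^ ?n * \<phi> (t *\<^sub>R y))" for t y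
  define F' where "F' t y = w y * (t ^ (?n - 1) * (\<Sum>i\<in>UNIV. \<psi> i t y))" for t y
  obtain B0 where B0: "B0 \<ge> 0" "\<And>x. \<bar>\<phi> x\<bar> \<le> B0" using flat_alg_bounded[OF \<phi>(1,2)] by blast
  have pz: "partial_deriv i \<phi> x = 0" if "x \<notin> cbox a b" for i x
    using partial_deriv_outside_cbox[OF \<phi>(2) that] .
  have "\<exists>B\<ge>0. \<forall>x. \<bar>partial_deriv i \<phi> x\<bar> \<le> B" for i
    using flat_alg_bounded[OF flat_alg_partial(1)[OF \<phi>(1), of i] pz] by metis
  then obtain Bi where Bi: "\<And>i. Bi i \<ge> 0" "\<And>i x. \<bar>partial_deriv i \<phi> x\<bar> \<le> Bi i" by metis
  obtain R where R: "R > 0" "\<And>x. x \<in> cbox a b \<Longrightarrow> norm x \<le> R"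
    using bounded_cbox[of a b] unfolding bounded_pos by blast
  \<comment> \<open>If \<open>\<tau> > t / 2\<close> and \<open>\<tau> *\<^sub>R y\<close> lies in
    the support, then \<open>norm y\<close> is at most \<open>R / \<tau>\<close>, hence below
    \<open>2 * R / t\<close>: one box contains all dilated supports.\<close>
  define \<rho> where "\<rho> = 2 * R / t"
  have "bounded (cball (0::real^'n) \<rho>)" by simp
  then obtain c where c: "cball (0::real^'n) \<rho> \<subseteq> cbox (-c) c" using bounded_subset_cbox_symmetric by blast
  define C where "C = 2 ^ ?n * (\<Sum>i\<in>UNIV. B0 + \<rho> * (2 * Bi i))"
  have \<rho>0: "\<rho> \<ge> 0" using R t by (simp add: \<rho>_def)
  have supp: "\<tau> *\<^sub>R y \<notin> cbox a b" if "\<tau> \<in> {t/2<..<2}" "y \<notin> cbox (-c) c" for \<tau> y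
  proof
    assume "\<tau> *\<^sub>R y \<in> cbox a b"
    then have "\<tau> * norm y \<le> R" using R(2)[of "\<tau> *\<^sub>R y"] that t by simp
    moreover have "t / 2 * norm y \<le> \<tau> * norm y" using that by (intro mult_right_mono) auto
    ultimately have "norm y \<le> \<rho>" using t by (simp add: \<rho>_def field_simps)
    then show False using c that by auto
  qed
  have \<psi>b: "\<bar>\<psi> i \<tau> y\<bar> \<le> B0 + \<rho> * (2 * Bi i)" if \<tau>: "\<tau> \<in> {t/2<..<2}" for i \<tau> y
  proof (cases "\<tau> *\<^sub>R y \<in> cbox a b")
    case True
    then have "\<tau> * norm y \<le> R" using R(2)[of "\<tau> *\<^sub>R y"] that t by simp
    moreover have "t / 2 * norm y \<le> \<tau> * norm y" using that by (intro mult_right_mono) auto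
    ultimately have "norm y \<le> \<rho>" using t by (simp add: \<rho>_def field_simps)
    then have "\<bar>y $ i\<bar> \<le> \<rho>" using component_le_norm_cart[of y i] by simp
    moreover have "\<bar>\<tau> * partial_deriv i \<phi> (\<tau> *\<^sub>R y)\<bar> \<le> 2 * Bi i"
      unfolding abs_mult using \<tau> t Bi by (intro mult_mono) auto
    ultimately have "\<bar>y $ i * (\<tau> * partial_deriv i \<phi> (\<tau> *\<^sub>R y))\<bar> \<le> \<rho> * (2 * Bi i)"
      unfolding abs_mult[of "y $ i"] using \<rho>0 by (intro mult_mono) auto
    then show ?thesis unfolding \<psi>_def using B0(2)[of "\<tau> *\<^sub>R y"] by linarith
  next
    case False
    then show ?thesis unfolding \<psi>_def using \<phi>(2) pz B0(1) \<rho>0 Bi(1)[of i] by simp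
  qed
  have C: "\<bar>F' \<tau> y\<bar> \<le> \<bar>w y * (C * indicator (cbox (-c) c) y)\<bar>" if \<tau>: "\<tau> \<in> {t/2<..<2}" for \<tau> y
  proof (cases "y \<in> cbox (-c) c")
    case True
    have "\<bar>\<Sum>i\<in>UNIV. \<psi> i \<tau> y\<bar> \<le> (\<Sum>i\<in>UNIV. B0 + \<rho> * (2 * Bi i))"
      by (rule order_trans[OF sum_abs sum_mono[OF \<psi>b[OF \<tau>]]])
    moreover have "\<bar>\<tau> ^ (?n - 1)\<bar> \<le> 2 ^ ?n"
    proof -
      have "\<tau> ^ (?n - 1) \<le> 2 ^ (?n - 1)" using \<tau> t by (intro power_mono) auto
      also have "\<dots> \<le> (2::real) ^ ?n" by (intro power_increasing) auto
      finally show ?thesis using \<tau> t by simp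
    qed
    ultimately have "\<bar>\<tau> ^ (?n - 1) * (\<Sum>i\<in>UNIV. \<psi> i \<tau> y)\<bar> \<le> C"
      unfolding abs_mult C_def by (intro mult_mono) auto
    then have "\<bar>\<tau> ^ (?n - 1) * (\<Sum>i\<in>UNIV. \<psi> i \<tau> y)\<bar> \<le> \<bar>C\<bar>" by linarith
    then show ?thesis using True unfolding F'_def abs_mult[of "w y"] by (intro mult_left_mono) auto
  next
    case False
    then have "\<psi> i \<tau> y = 0" for i using supp[OF \<tau> False] \<phi>(2) pz by (simp add: \<psi>_def)
    then show ?thesis by (simp add: F'_def)
  qed
  have wi: "integrable lborel (\<lambda>y. w y * (C * indicator (cbox (-c) c) y))" for C :: real
    using square_integrable_mult[OF w indicator_cbox_square_integrable[of "-c" c]]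
    by (simp add: mult.left_commute[of _ C])
  have Fint: "integrable lborel (F \<tau>)" if \<tau>: "\<tau> \<in> {t/2<..<2}" for \<tau>
  proof (rule Bochner_Integration.integrable_bound[OF wi])
    show "F \<tau> \<in> borel_measurable lborel" unfolding F_def by measurable
    have "\<bar>F \<tau> y\<bar> \<le> \<bar>w y * ((\<tau> ^ ?n * B0) * indicator (cbox (-c) c) y)\<bar>" for y
      using B0 supp[OF \<tau>, of y] \<phi>(2) t \<tau> unfolding F_def abs_mult[of "w y"]
      by (intro mult_left_mono) (auto simp: abs_mult indicator_def intro!: mult_left_mono)
    then show "AE y in lborel. norm (F \<tau> y) \<le> norm (w y * ((\<tau> ^ ?n * B0) * indicator (cbox (-c) c) y))" by simp
  qed
  have Fder: "((\<lambda>t. F t y) has_real_derivative F' \<tau> y) (at \<tau>)" if \<tau>: "\<tau> \<in> {t/2<..<2}" for \<tau> y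
  proof -
    have "((\<lambda>\<tau>. \<tau> *\<^sub>R y) has_derivative (\<lambda>h. h *\<^sub>R y)) (at \<tau>)"
      by (intro has_derivative_scaleR_left has_derivative_ident)
    note * = has_derivative_compose[OF this flat_alg_partial(2)[OF \<phi>(1)]]
    have "((\<lambda>\<tau>. \<phi> (\<tau> *\<^sub>R y)) has_derivative (\<lambda>h. (\<Sum>k\<in>UNIV. y $ k * partial_deriv k \<phi> (\<tau> *\<^sub>R y)) * h)) (at \<tau>)"
    proof -
      have "(\<Sum>k\<in>UNIV. (h *\<^sub>R y) $ k * partial_deriv k \<phi> (\<tau> *\<^sub>R y))
        = (\<Sum>k\<in>UNIV. y $ k * partial_deriv k \<phi> (\<tau> *\<^sub>R y)) * h" for h
        unfolding sum_distrib_right by (intro sum.cong) (simp_all add: mult_ac)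
      with * show ?thesis by (simp only:)
    qed
    then have d: "((\<lambda>\<tau>. \<phi> (\<tau> *\<^sub>R y)) has_real_derivative (\<Sum>k\<in>UNIV. y $ k * partial_deriv k \<phi> (\<tau> *\<^sub>R y))) (at \<tau>)"
      by (simp add: has_field_derivative_def)
    have "((\<lambda>t. w y * (t ^ ?n * \<phi> (t *\<^sub>R y))) has_real_derivative
       w y * (real ?n * \<tau> ^ (?n - 1) * \<phi> (\<tau> *\<^sub>R y) + \<tau> ^ ?n * (\<Sum>k\<in>UNIV. y $ k * partial_deriv k \<phi> (\<tau> *\<^sub>R y)))) (at \<tau>)"
      by (auto intro!: derivative_eq_intros d simp: algebra_simps)
    moreover have "\<tau> ^ ?n = \<tau> ^ (?n - 1) * \<tau>" by (simp add: power_eq_if)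
    ultimately show ?thesis unfolding F_def F'_def \<psi>_def
      by (simp add: sum.distrib sum_distrib_left algebra_simps)
  qed
  have t0: "t \<in> {t/2<..<2}" using t by auto
  note der = has_derivative_under_integral[OF t0 Fint Fder C integrable_abs[OF wi]]
  have 1: "((\<lambda>\<tau>. LINT y|lborel. F \<tau> y) has_real_derivative (LINT y|lborel. F' t y)) (at t)" by (rule der)
  have Fm: "F \<tau> \<in> borel_measurable borel" for \<tau> unfolding F_def by measurable
  have 2: "(LINT y|lborel. F \<tau> y) = (LINT y|lborel. w ((1 / \<tau>) *\<^sub>R y) * \<phi> y)" if "\<tau> > 0" for \<tau>
  proof -
    have "(LINT y|lborel. F \<tau> y) = (1 / \<tau>) ^ ?n * (LINT y|lborel. F \<tau> ((1 / \<tau>) *\<^sub>R y))"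
      using that integral_scale[OF _ Fm, of "1/\<tau>" \<tau>] by simp
    also have "(LINT y|lborel. F \<tau> ((1 / \<tau>) *\<^sub>R y)) = (LINT y|lborel. \<tau> ^ ?n * (w ((1 / \<tau>) *\<^sub>R y) * \<phi> y))"
      using that by (simp add: F_def algebra_simps)
    also have "(1 / \<tau>) ^ ?n * \<dots> = (LINT y|lborel. w ((1 / \<tau>) *\<^sub>R y) * \<phi> y)"
      using that by (simp add: power_one_over)
    finally show ?thesis .
  qed
  define q where "q i y = g i y * (y $ i * \<phi> (t *\<^sub>R y))" for i y
  have qm: "q i \<in> borel_measurable borel" for i unfolding q_def by measurable
  have \<psi>w: "(LINT y|lborel. w y * \<psi> i t y) = - (LINT y|lborel. q i y)" for i
  proof -
    have "flat_alg (\<lambda>y. y $ i * \<phi> (t *\<^sub>R y))" by (intro flat_alg.mult flat_alg.coord flat_alg_scale \<phi>(1))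
    moreover have sc: "t *\<^sub>R y \<in> cbox a b \<longleftrightarrow> y \<in> cbox ((1/t) *\<^sub>R a) ((1/t) *\<^sub>R b)" for y
      using t by (auto simp: mem_box_cart field_simps)
    moreover have "y $ i * \<phi> (t *\<^sub>R y) = 0" if "y \<notin> cbox ((1/t) *\<^sub>R a) ((1/t) *\<^sub>R b)" for y
      using \<phi>(2) sc that by simp
    moreover have "cbox ((1/t) *\<^sub>R a) ((1/t) *\<^sub>R b) \<subseteq> {y. r < norm y}"
    proof
      fix y assume "y \<in> cbox ((1/t) *\<^sub>R a) ((1/t) *\<^sub>R b)"
      then have "r < t * norm y" using sc[of y] \<phi>(3) t by auto
      also have "\<dots> \<le> 1 * norm y" using t by (intro mult_right_mono) auto
      finally show "y \<in> {y. r < norm y}" by simp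
    qed
    ultimately have "(LINT y|lborel. w y * partial_deriv i (\<lambda>y. y $ i * \<phi> (t *\<^sub>R y)) y)
        = - (LINT y|lborel. g i y * (y $ i * \<phi> (t *\<^sub>R y)))"
      by (intro weak)
    then show ?thesis unfolding partial_deriv_coord_mult_scale[OF \<phi>(1)] \<psi>_def q_def .
  qed
  have \<psi>int: "integrable lborel (\<lambda>y. w y * \<psi> i t y)" for i
  proof (rule Bochner_Integration.integrable_bound[OF wi])
    show "(\<lambda>y. w y * \<psi> i t y) \<in> borel_measurable lborel" unfolding \<psi>_def by measurable
    have "\<bar>w y * \<psi> i t y\<bar> \<le> \<bar>w y * ((B0 + \<rho> * (2 * Bi i)) * indicator (cbox (-c) c) y)\<bar>" for y
    proof (cases "y \<in> cbox (-c) c")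
      case True
      then show ?thesis using \<psi>b[OF t0, of i y] unfolding abs_mult[of "w y"] by (intro mult_left_mono) auto
    next
      case False
      then show ?thesis using supp[OF t0 False] \<phi>(2) pz by (simp add: \<psi>_def)
    qed
    then show "AE y in lborel. norm (w y * \<psi> i t y) \<le> norm (w y * ((B0 + \<rho> * (2 * Bi i)) * indicator (cbox (-c) c) y))" by simp
  qed
  have qint: "integrable lborel (\<lambda>y. g i ((1 / t) *\<^sub>R y) * (y $ i * \<phi> y))" for i
  proof (rule square_integrable_mult[OF square_integrable_scale[OF _ g]])
    show "0 < 1 / t" using t by simp
    have "flat_alg (\<lambda>y. y $ i * \<phi> y)" by (intro flat_alg.mult flat_alg.coord \<phi>(1))
    moreover have "y $ i * \<phi> y = 0" if "y \<notin> cbox a b" for y using \<phi>(2) that by simp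
    moreover from flat_alg_bounded[OF calculation] obtain B where "\<And>x. \<bar>x $ i * \<phi> x\<bar> \<le> B" by blast
    ultimately show "(\<lambda>y. y $ i * \<phi> y) \<in> square_integrable lborel"
      by (intro bounded_support_square_integrable flat_alg_borel)
  qed
  have "(LINT y|lborel. F' t y) = t ^ (?n - 1) * (\<Sum>i\<in>UNIV. LINT y|lborel. w y * \<psi> i t y)"
  proof -
    have "F' t y = t ^ (?n - 1) * (\<Sum>i\<in>UNIV. w y * \<psi> i t y)" for y
      unfolding F'_def sum_distrib_left[symmetric] by (simp only: mult.left_commute)
    then show ?thesis using \<psi>int by (simp add: Bochner_Integration.integral_sum)
  qed
  also have "\<dots> = - (\<Sum>i\<in>UNIV. t ^ (?n - 1) * (LINT y|lborel. q i y))"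
    unfolding \<psi>w by (simp add: sum_negf sum_distrib_left)
  also have "(\<lambda>i. t ^ (?n - 1) * (LINT y|lborel. q i y)) = (\<lambda>i. (1 / t\<^sup>2) * (LINT y|lborel. g i ((1 / t) *\<^sub>R y) * (y $ i * \<phi> y)))"
  proof
    fix i
    have "(LINT y|lborel. q i y) = (1 / t) ^ ?n * (LINT y|lborel. q i ((1 / t) *\<^sub>R y))"
      using t integral_scale[OF _ qm, of "1/t" i] by simp
    also have "(LINT y|lborel. q i ((1 / t) *\<^sub>R y)) = (LINT y|lborel. (1 / t) * (g i ((1 / t) *\<^sub>R y) * (y $ i * \<phi> y)))"
      using t by (simp add: q_def algebra_simps)
    also have "\<dots> = (1 / t) * (LINT y|lborel. g i ((1 / t) *\<^sub>R y) * (y $ i * \<phi> y))" by simp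
    also have "t ^ (?n - 1) * ((1 / t) ^ ?n * ((1 / t) * (LINT y|lborel. g i ((1 / t) *\<^sub>R y) * (y $ i * \<phi> y))))
       = (1 / t\<^sup>2) * (LINT y|lborel. g i ((1 / t) *\<^sub>R y) * (y $ i * \<phi> y))"
    proof -
      have "t ^ ?n = t ^ (?n - 1) * t" by (simp add: power_eq_if)
      then show ?thesis using t by (simp add: power_one_over power2_eq_square field_simps)
    qed
    finally show "t ^ (?n - 1) * (LINT y|lborel. q i y) = (1 / t\<^sup>2) * (LINT y|lborel. g i ((1 / t) *\<^sub>R y) * (y $ i * \<phi> y))" .
  qed
  also have "(\<Sum>i\<in>UNIV. (1 / t\<^sup>2) * (LINT y|lborel. g i ((1 / t) *\<^sub>R y) * (y $ i * \<phi> y))) = (LINT y|lborel. K t y * \<phi> y)"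
  proof -
    have "K t y * \<phi> y = (\<Sum>i\<in>UNIV. (1 / t\<^sup>2) * (g i ((1 / t) *\<^sub>R y) * (y $ i * \<phi> y)))" for y
      unfolding K_def sum_distrib_left sum_distrib_right by (intro sum.cong) (simp_all add: mult_ac)
    then show ?thesis using qint by (simp add: Bochner_Integration.integral_sum)
  qed
  finally have 3: "(LINT y|lborel. F' t y) = - (LINT y|lborel. K t y * \<phi> y)" .
  show ?thesis
    unfolding 3[symmetric]
    by (rule has_field_derivative_transform_within_open[OF 1, of "{0<..}"]) (use t 2 in auto)
qed

end

lemma nn_integral_powr_near_zero:
  fixes e c :: real
  assumes "-1 < e" "c \<ge> 0"
  shows "(\<integral>\<^sup>+t. ennreal (t powr e) * indicator {0..c} t \<partial>lborel) = ennreal (c powr (e + 1) / (e + 1))"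
  using nn_integral_has_integral_lebesgue'[OF _ has_integral_powr_from_0[of e c]] assms by simp

lemma borel_measurable_vec_nth'[measurable (raw)]:
  fixes f :: "'a \<Rightarrow> real^'n::finite"
  assumes "f \<in> borel_measurable M"
  shows "(\<lambda>x. f x $ i) \<in> borel_measurable M"
proof (rule measurable_compose[OF assms])
  show "(\<lambda>x::real^'n. x $ i) \<in> borel_measurable borel"
    by (intro borel_measurable_continuous_onI continuous_intros)
qed

context weak_gradient begin

lemma K_meas[measurable (raw)]:
  assumes [measurable]: "f \<in> borel_measurable M" "h \<in> borel_measurable M"
  shows "(\<lambda>x. K (f x) (h x)) \<in> borel_measurable M"
  unfolding K_def by measurable

lemma K_sq_bound:
  assumes "0 < t"
  shows "(K t y)\<^sup>2 \<le> (1 / t\<^sup>2)\<^sup>2 * (\<Sum>i\<in>UNIV. (g i ((1 / t) *\<^sub>R y))\<^sup>2) * (norm y)\<^sup>2"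
proof -
  have "(norm y)\<^sup>2 = (\<Sum>i\<in>UNIV. (y $ i)\<^sup>2)"
    by (simp add: norm_vec_def L2_set_def sum_nonneg)
  then show ?thesis
    unfolding K_def power_mult_distrib using Cauchy_Schwarz_ineq_sum[of "\<lambda>i. g i ((1 / t) *\<^sub>R y)" "\<lambda>i. y $ i" UNIV]
    by (auto simp: mult.assoc intro!: mult_left_mono)
qed

lemma nn_integral_contract_le:
  fixes f :: "real^'n \<Rightarrow> ennreal"
  assumes "0 < \<tau>" "\<tau> \<le> 1" and [measurable]: "f \<in> borel_measurable borel"
  shows "(\<integral>\<^sup>+y. f ((1 / \<tau>) *\<^sub>R y) \<partial>lborel) \<le> (\<integral>\<^sup>+y. f y \<partial>lborel)"
proof -
  have "(\<integral>\<^sup>+y. f ((1 / \<tau>) *\<^sub>R y) \<partial>lborel) = ennreal (\<tau> ^ DIM(real^'n)) * (\<integral>\<^sup>+y. f ((1 / \<tau>) *\<^sub>R (\<tau> *\<^sub>R y)) \<partial>lborel)"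
    using assms by (intro nn_integral_scale) measurable
  also have "\<dots> \<le> 1 * (\<integral>\<^sup>+y. f y \<partial>lborel)"
    using assms by (intro mult_mono) (auto intro: power_le_one)
  finally show ?thesis by simp
qed

text \<open>Joint integrability is the requirement of Fubini's theorem. Keeping
  \<open>\<tau>\<close> away from 0 bounds \<open>1 / \<tau>\<^sup>2\<close>, and the bounded
  support of \<open>p\<close> tames the factors \<open>y $ i\<close>.\<close>

lemma K_integrable:
  assumes t: "0 < t" "t \<le> 1"
    and p[measurable]: "p \<in> borel_measurable borel" and pB: "\<And>x. \<bar>p x\<bar> \<le> B" and p0: "\<And>x. x \<notin> cbox a b \<Longrightarrow> p x = 0"
  shows "integrable (lborel \<Otimes>\<^sub>M lborel) (\<lambda>(\<tau>, y). indicator {t..1} \<tau> * (K \<tau> y * p y) :: real)"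
proof (rule integrableI_bounded)
  show "(\<lambda>(\<tau>, y). indicator {t..1} \<tau> * (K \<tau> y * p y)) \<in> borel_measurable (lborel \<Otimes>\<^sub>M lborel)"
    by measurable
  obtain R where R: "R > 0" "\<And>x. x \<in> cbox a b \<Longrightarrow> norm x \<le> R"
    using bounded_cbox[of a b] unfolding bounded_pos by blast
  define q where "q i y = y $ i * p y" for i y
  have [measurable]: "q i \<in> borel_measurable borel" for i unfolding q_def by measurable
  have q: "q i \<in> square_integrable lborel" for i
  proof (rule bounded_support_square_integrable)
    have "0 \<le> B" using pB[of 0] by linarith
    show "\<bar>q i y\<bar> \<le> R * B" for y
    proof (cases "y \<in> cbox a b")
      case True
      then show ?thesis
        unfolding q_def abs_mult using R(2)[OF True] component_le_norm_cart[of y i] pB[of y] R(1)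
        by (intro mult_mono) auto
    next
      case False
      then show ?thesis using R \<open>0 \<le> B\<close> by (simp add: q_def p0)
    qed
    show "q i y = 0" if "y \<notin> cbox a b" for y using p0[OF that] by (simp add: q_def)
  qed measurable
  define C where "C = ennreal (1 / t\<^sup>2) * (\<Sum>i\<in>UNIV. (\<integral>\<^sup>+y. ennreal ((g i y)\<^sup>2) \<partial>lborel) + (\<integral>\<^sup>+y. ennreal ((q i y)\<^sup>2) \<partial>lborel))"
  have C: "C < \<infinity>"
    unfolding C_def square_integrable_nn[OF g] square_integrable_nn[OF q]
    by (simp add: ennreal_mult_less_top)
  have pt: "ennreal (norm (indicator {t..1} \<tau> * (K \<tau> y * p y)))
      \<le> indicator {t..1} \<tau> * (ennreal (1 / t\<^sup>2) * (\<Sum>i\<in>UNIV. ennreal ((g i ((1 / \<tau>) *\<^sub>R y))\<^sup>2) + ennreal ((q i y)\<^sup>2)))" for \<tau> y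
  proof (cases "\<tau> \<in> {t..1}")
    case True
    then have "t\<^sup>2 \<le> \<tau>\<^sup>2" "\<tau> > 0" using t by (auto intro: power_mono)
    then have t2: "1 / \<tau>\<^sup>2 \<le> 1 / t\<^sup>2" using t by (intro divide_left_mono) auto
    have "K \<tau> y * p y = (1 / \<tau>\<^sup>2) * (\<Sum>i\<in>UNIV. g i ((1 / \<tau>) *\<^sub>R y) * q i y)"
      by (simp add: K_def q_def sum_distrib_left sum_distrib_right mult_ac)
    also have "\<bar>\<dots>\<bar> \<le> (1 / t\<^sup>2) * (\<Sum>i\<in>UNIV. (g i ((1 / \<tau>) *\<^sub>R y))\<^sup>2 + (q i y)\<^sup>2)"
      unfolding abs_mult using t2 by (intro mult_mono order_trans[OF sum_abs sum_mono[OF abs_mult_le_sum_squares]]) auto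
    finally have "ennreal \<bar>K \<tau> y * p y\<bar> \<le> ennreal ((1 / t\<^sup>2) * (\<Sum>i\<in>UNIV. (g i ((1 / \<tau>) *\<^sub>R y))\<^sup>2 + (q i y)\<^sup>2))"
      by (rule ennreal_leI)
    also have "\<dots> = ennreal (1 / t\<^sup>2) * (\<Sum>i\<in>UNIV. ennreal ((g i ((1 / \<tau>) *\<^sub>R y))\<^sup>2 + (q i y)\<^sup>2))"
      by (subst ennreal_mult) (simp_all add: sum_nonneg sum_ennreal del: ennreal_plus)
    also have "\<dots> = ennreal (1 / t\<^sup>2) * (\<Sum>i\<in>UNIV. ennreal ((g i ((1 / \<tau>) *\<^sub>R y))\<^sup>2) + ennreal ((q i y)\<^sup>2))"
      by simp
    finally show ?thesis using True by (simp del: ennreal_plus)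
  qed simp
  have m: "(\<lambda>z. ennreal (norm (case z of (\<tau>, y) \<Rightarrow> indicator {t..1} \<tau> * (K \<tau> y * p y))))
      \<in> borel_measurable (lborel \<Otimes>\<^sub>M lborel)"
    by measurable
  have "(\<integral>\<^sup>+z. ennreal (norm (case z of (\<tau>, y) \<Rightarrow> indicator {t..1} \<tau> * (K \<tau> y * p y))) \<partial>(lborel \<Otimes>\<^sub>M lborel))
    = (\<integral>\<^sup>+\<tau>. \<integral>\<^sup>+y. ennreal (norm (indicator {t..1} \<tau> * (K \<tau> y * p y))) \<partial>lborel \<partial>lborel)"
    using lborel.nn_integral_fst[OF m] by simp
  also have "\<dots> \<le> (\<integral>\<^sup>+\<tau>. C * indicator {t..1} \<tau> \<partial>lborel)"
  proof (rule nn_integral_mono)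
    fix \<tau> :: real
    show "(\<integral>\<^sup>+y. ennreal (norm (indicator {t..1} \<tau> * (K \<tau> y * p y))) \<partial>lborel) \<le> C * indicator {t..1} \<tau>"
    proof (cases "\<tau> \<in> {t..1}")
      case True
      then have \<tau>: "0 < \<tau>" "\<tau> \<le> 1" using t by auto
      have "(\<integral>\<^sup>+y. ennreal (norm (indicator {t..1} \<tau> * (K \<tau> y * p y))) \<partial>lborel)
        \<le> (\<integral>\<^sup>+y. ennreal (1 / t\<^sup>2) * (\<Sum>i\<in>UNIV. ennreal ((g i ((1 / \<tau>) *\<^sub>R y))\<^sup>2) + ennreal ((q i y)\<^sup>2)) \<partial>lborel)"
      proof (rule nn_integral_mono)
        fix y
        show "ennreal (norm (indicator {t..1} \<tau> * (K \<tau> y * p y)))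
          \<le> ennreal (1 / t\<^sup>2) * (\<Sum>i\<in>UNIV. ennreal ((g i ((1 / \<tau>) *\<^sub>R y))\<^sup>2) + ennreal ((q i y)\<^sup>2))"
          using pt[of \<tau> y] True by simp
      qed
      also have "\<dots> = ennreal (1 / t\<^sup>2) * (\<Sum>i\<in>UNIV. (\<integral>\<^sup>+y. ennreal ((g i ((1 / \<tau>) *\<^sub>R y))\<^sup>2) \<partial>lborel) + (\<integral>\<^sup>+y. ennreal ((q i y)\<^sup>2) \<partial>lborel))"
        by (simp add: nn_integral_cmult nn_integral_sum nn_integral_add)
      also have "\<dots> \<le> C"
        unfolding C_def using \<tau> by (intro mult_left_mono sum_mono add_mono nn_integral_contract_le) auto
      finally show ?thesis using True by simp
    qed simp
  qed
  also have "\<dots> = C * emeasure lborel {t..1}" by (simp add: nn_integral_cmult)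
  also have "\<dots> < \<infinity>" using C t by (simp add: ennreal_mult_less_top)
  finally show "(\<integral>\<^sup>+z. ennreal (norm (case z of (\<tau>, y) \<Rightarrow> indicator {t..1} \<tau> * (K \<tau> y * p y))) \<partial>(lborel \<Otimes>\<^sub>M lborel)) < \<infinity>" .
qed

text \<open>Formally this is \<open>w ((1 / t) *\<^sub>R y) - w y\<close>.\<close>

definition V :: "real \<Rightarrow> real^'n \<Rightarrow> real" where
  "V t y = (LINT \<tau>|lborel. indicator {t..1} \<tau> * K \<tau> y)"

lemma V_meas[measurable]: "V t \<in> borel_measurable borel"
proof -
  have "(\<lambda>(y, \<tau>). indicator {t..1} \<tau> * K \<tau> y) \<in> borel_measurable (borel \<Otimes>\<^sub>M (lborel :: real measure))"
    by measurable
  then show ?thesis unfolding V_def[abs_def] by (rule lborel.borel_measurable_lebesgue_integral)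
qed

lemma V_Fubini:
  assumes t: "0 < t" "t \<le> 1"
    and p: "p \<in> borel_measurable borel" "\<And>x. \<bar>p x\<bar> \<le> B" "\<And>x. x \<notin> cbox a b \<Longrightarrow> p x = 0"
  shows "integrable lborel (\<lambda>y. V t y * p y)"
    "integrable lborel (\<lambda>\<tau>. indicator {t..1} \<tau> * (LINT y|lborel. K \<tau> y * p y))"
    "(LINT y|lborel. V t y * p y) = (LINT \<tau>|lborel. indicator {t..1} \<tau> * (LINT y|lborel. K \<tau> y * p y))"
proof -
  note int = K_integrable[OF assms]
  have V: "V t y * p y = (LINT \<tau>|lborel. indicator {t..1} \<tau> * (K \<tau> y * p y))" for y
    unfolding V_def by (simp add: mult.assoc[symmetric])
  have K: "indicator {t..1} \<tau> * (LINT y|lborel. K \<tau> y * p y) = (LINT y|lborel. indicator {t..1} \<tau> * (K \<tau> y * p y))" for \<tau>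
    by simp
  show "integrable lborel (\<lambda>y. V t y * p y)" unfolding V using lborel_pair.integrable_snd[OF int] by simp
  show "integrable lborel (\<lambda>\<tau>. indicator {t..1} \<tau> * (LINT y|lborel. K \<tau> y * p y))"
    unfolding K using lborel_pair.integrable_fst[OF int] by simp
  show "(LINT y|lborel. V t y * p y) = (LINT \<tau>|lborel. indicator {t..1} \<tau> * (LINT y|lborel. K \<tau> y * p y))"
    unfolding V K by (rule lborel_pair.Fubini_integral[OF int])
qed

text \<open>Tested against a bump, the identity is the fundamental theorem of calculus for
  \<open>A\<close>, with Fubini exchanging the integrals in \<tau> and y. The fundamental lemma then
  makes it pointwise, so that no representative absolutely continuous on rays has to be
  constructed.\<close>

lemma radial_absolute_continuity:
  assumes t: "0 < t" "t \<le> 1"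
  shows "AE y in lborel. r < norm y \<longrightarrow> w y = w ((1 / t) *\<^sub>R y) - V t y"
proof -
  define u where "u y = w y - w ((1 / t) *\<^sub>R y) + V t y" for y
  have wt: "(\<lambda>y. w ((1 / t) *\<^sub>R y)) \<in> square_integrable lborel"
    using t by (intro square_integrable_scale w) auto
  have um: "u \<in> borel_measurable borel" unfolding u_def by measurable
  have "AE y in lborel. y \<in> {y. r < norm y} \<longrightarrow> u y = 0"
  proof (rule fundamental_lemma_box_bump[OF _ um])
    show "open {y :: real^'n. r < norm y}" by (intro open_Collect_less continuous_intros)
    fix a b :: "real^'n" assume ab: "cbox a b \<subseteq> {y. r < norm y}"
    have "integrable lborel (\<lambda>y. V t y * indicator (cbox a b) y)"
      by (rule V_Fubini(1)[OF t]) (auto simp: indicator_def)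
    then have "integrable lborel (\<lambda>y. indicator (cbox a b) y * w y - indicator (cbox a b) y * w ((1 / t) *\<^sub>R y) + V t y * indicator (cbox a b) y)"
      by (intro Bochner_Integration.integrable_add Bochner_Integration.integrable_diff
          square_integrable_mult[OF indicator_cbox_square_integrable w] square_integrable_mult[OF indicator_cbox_square_integrable wt])
    then show "integrable lborel (\<lambda>y. indicator (cbox a b) y * u y)"
      by (simp add: u_def algebra_simps)
    fix k
    let ?\<phi> = "box_bump k a b"
    have \<phi>: "flat_alg ?\<phi>" by (rule flat_alg_box_bump)
    have \<phi>0: "?\<phi> x = 0" if "x \<notin> cbox a b" for x
      using box_bump_outside[of x a b k] box_subset_cbox[of a b] that by blast
    have \<phi>m: "?\<phi> \<in> borel_measurable borel" by (rule flat_alg_borel[OF \<phi>])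
    have \<phi>b: "\<bar>?\<phi> x\<bar> \<le> 1" for x using box_bump_bounds[of k a b x] by simp
    have \<phi>L: "?\<phi> \<in> square_integrable lborel" by (rule bounded_support_square_integrable[OF \<phi>m \<phi>b \<phi>0])
    note VF = V_Fubini[OF t \<phi>m \<phi>b \<phi>0]
    define A where "A \<tau> = (LINT y|lborel. w ((1 / \<tau>) *\<^sub>R y) * ?\<phi> y)" for \<tau>
    define Q where "Q \<tau> = (LINT y|lborel. K \<tau> y * ?\<phi> y)" for \<tau>
    have "((\<lambda>\<tau>. - Q \<tau>) has_integral (A 1 - A t)) {t..1}"
    proof (rule fundamental_theorem_of_calculus[OF t(2)])
      fix \<tau> assume "\<tau> \<in> {t..1}"
      then have "(A has_real_derivative - Q \<tau>) (at \<tau>)"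
        unfolding A_def[abs_def] Q_def using t by (intro dilation_derivative[OF \<phi> \<phi>0 ab]) auto
      then show "(A has_vector_derivative - Q \<tau>) (at \<tau> within {t..1})"
        unfolding has_real_derivative_iff_has_vector_derivative by (rule has_vector_derivative_at_within)
    qed
    from has_integral_neg[OF this] have "(Q has_integral (A t - A 1)) {t..1}" by simp
    then have "((\<lambda>\<tau>. if \<tau> \<in> {t..1} then Q \<tau> else 0) has_integral (A t - A 1)) UNIV"
      by (simp only: has_integral_restrict_UNIV)
    moreover have "(\<lambda>\<tau>. if \<tau> \<in> {t..1} then Q \<tau> else 0) = (\<lambda>\<tau>. indicator {t..1} \<tau> * Q \<tau>)" by auto
    moreover have "((\<lambda>\<tau>. indicator {t..1} \<tau> * Q \<tau>) has_integral (LINT \<tau>|lborel. indicator {t..1} \<tau> * Q \<tau>)) UNIV"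
      unfolding Q_def by (rule has_integral_integral_lborel[OF VF(2)])
    ultimately have "(LINT \<tau>|lborel. indicator {t..1} \<tau> * Q \<tau>) = A t - A 1"
      by (metis has_integral_unique)
    then have V: "(LINT y|lborel. V t y * ?\<phi> y) = A t - A 1"
      using VF(3) by (simp add: Q_def)
    have "(LINT y|lborel. u y * ?\<phi> y) = (LINT y|lborel. w y * ?\<phi> y - w ((1 / t) *\<^sub>R y) * ?\<phi> y + V t y * ?\<phi> y)"
      by (simp add: u_def algebra_simps)
    also have "\<dots> = A 1 - A t + (A t - A 1)"
      using square_integrable_mult[OF w \<phi>L] square_integrable_mult[OF wt \<phi>L] VF(1) V
      by (simp add: A_def)
    finally show "(LINT y|lborel. u y * ?\<phi> y) = 0" by simp
  qed
  then show ?thesis by (auto simp: u_def elim!: eventually_mono)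
qed

text \<open>Cauchy-Schwarz against the indicator of \<open>{1/3..1}\<close>, an interval of length
  at most 1. The constant is \<open>9\<^sup>2 * (2 * r)\<^sup>2\<close>, from
  \<open>1 / \<tau>\<^sup>2 \<le> 9\<close> and \<open>norm y \<le> 2 * r\<close>. The right-hand
  side is the same for all admissible \<open>t\<close>.\<close>

lemma V_sq_bound:
  assumes t: "1/3 \<le> t" and y: "norm y \<le> 2 * r"
  shows "ennreal ((V t y)\<^sup>2) \<le> ennreal (324 * r\<^sup>2) *
    (\<integral>\<^sup>+\<tau>. indicator {1/3..1} \<tau> * (\<Sum>i\<in>UNIV. ennreal ((g i ((1 / \<tau>) *\<^sub>R y))\<^sup>2)) \<partial>lborel)"
proof -
  have pt: "(ennreal \<bar>indicator {t..1} \<tau> * K \<tau> y\<bar>)\<^sup>2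
      \<le> ennreal (324 * r\<^sup>2) * (indicator {1/3..1} \<tau> * (\<Sum>i\<in>UNIV. ennreal ((g i ((1 / \<tau>) *\<^sub>R y))\<^sup>2)))" for \<tau>
  proof (cases "\<tau> \<in> {t..1}")
    case True
    then have \<tau>: "1/3 \<le> \<tau>" "\<tau> \<le> 1" "\<tau> > 0" using t by auto
    have "(1/3)\<^sup>2 \<le> \<tau>\<^sup>2" using \<tau> by (intro power_mono) auto
    then have "1 / \<tau>\<^sup>2 \<le> 9" using \<tau> by (simp add: power2_eq_square field_simps)
    then have "(1 / \<tau>\<^sup>2)\<^sup>2 \<le> 9\<^sup>2" by (intro power_mono) auto
    moreover have "(norm y)\<^sup>2 \<le> (2 * r)\<^sup>2" using y by (intro power_mono) auto
    ultimately have "(1 / \<tau>\<^sup>2)\<^sup>2 * (norm y)\<^sup>2 \<le> 9\<^sup>2 * (2 * r)\<^sup>2" by (intro mult_mono) auto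
    then have c: "(1 / \<tau>\<^sup>2)\<^sup>2 * (norm y)\<^sup>2 \<le> 324 * r\<^sup>2" by (simp add: power_mult_distrib)
    have "(K \<tau> y)\<^sup>2 \<le> ((1 / \<tau>\<^sup>2)\<^sup>2 * (norm y)\<^sup>2) * (\<Sum>i\<in>UNIV. (g i ((1 / \<tau>) *\<^sub>R y))\<^sup>2)"
      using K_sq_bound[OF \<tau>(3), of y] by (simp only: mult_ac)
    also have "\<dots> \<le> (324 * r\<^sup>2) * (\<Sum>i\<in>UNIV. (g i ((1 / \<tau>) *\<^sub>R y))\<^sup>2)"
      by (rule mult_right_mono[OF c]) (simp add: sum_nonneg)
    finally have "ennreal ((K \<tau> y)\<^sup>2) \<le> ennreal ((324 * r\<^sup>2) * (\<Sum>i\<in>UNIV. (g i ((1 / \<tau>) *\<^sub>R y))\<^sup>2))"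
      by (rule ennreal_leI)
    also have "\<dots> = ennreal (324 * r\<^sup>2) * (\<Sum>i\<in>UNIV. ennreal ((g i ((1 / \<tau>) *\<^sub>R y))\<^sup>2))"
      by (subst ennreal_mult) (simp_all add: sum_nonneg sum_ennreal)
    finally show ?thesis using True \<tau> by (simp add: ennreal_power)
  qed simp
  have "ennreal ((V t y)\<^sup>2) = (ennreal \<bar>V t y\<bar>)\<^sup>2" by (simp add: ennreal_power)
  also have "\<dots> \<le> (\<integral>\<^sup>+\<tau>. ennreal \<bar>indicator {t..1} \<tau> * K \<tau> y\<bar> \<partial>lborel)\<^sup>2"
  proof (rule power_mono)
    show "ennreal \<bar>V t y\<bar> \<le> (\<integral>\<^sup>+\<tau>. ennreal \<bar>indicator {t..1} \<tau> * K \<tau> y\<bar> \<partial>lborel)"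
    proof (cases "integrable lborel (\<lambda>\<tau>. indicator {t..1} \<tau> * K \<tau> y)")
      case True
      from integral_norm_bound_ennreal[OF this] show ?thesis unfolding V_def by simp
    next
      \<comment> \<open>The Bochner integral of a function that is not integrable is 0 by
        convention.\<close>
      case False
      then show ?thesis unfolding V_def by (simp add: not_integrable_integral_eq)
    qed
  qed simp
  also have "\<dots> = (\<integral>\<^sup>+\<tau>. indicator {1/3..1} \<tau> * ennreal \<bar>indicator {t..1} \<tau> * K \<tau> y\<bar> \<partial>lborel)\<^sup>2"
    using t by (intro arg_cong[of _ _ "\<lambda>x. x\<^sup>2"] nn_integral_cong) (auto split: split_indicator)
  also have "\<dots> \<le> (\<integral>\<^sup>+\<tau>. (indicator {1/3..1::real} \<tau>)\<^sup>2 \<partial>lborel) * (\<integral>\<^sup>+\<tau>. (ennreal \<bar>indicator {t..1} \<tau> * K \<tau> y\<bar>)\<^sup>2 \<partial>lborel)"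
    by (rule Cauchy_Schwarz_nn_integral) measurable
  also have "\<dots> \<le> 1 * (\<integral>\<^sup>+\<tau>. ennreal (324 * r\<^sup>2) * (indicator {1/3..1} \<tau> * (\<Sum>i\<in>UNIV. ennreal ((g i ((1 / \<tau>) *\<^sub>R y))\<^sup>2))) \<partial>lborel)"
  proof (intro mult_mono nn_integral_mono pt)
    have "(\<integral>\<^sup>+\<tau>. (indicator {1/3..1::real} \<tau>)\<^sup>2 \<partial>lborel) = (\<integral>\<^sup>+\<tau>. indicator {1/3..1::real} \<tau> \<partial>lborel)"
      by (intro nn_integral_cong) (auto split: split_indicator)
    then show "(\<integral>\<^sup>+\<tau>. (indicator {1/3..1::real} \<tau>)\<^sup>2 \<partial>lborel) \<le> 1" by (simp add: ennreal_le_1)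
  qed auto
  also have "\<dots> = ennreal (324 * r\<^sup>2) * (\<integral>\<^sup>+\<tau>. indicator {1/3..1} \<tau> * (\<Sum>i\<in>UNIV. ennreal ((g i ((1 / \<tau>) *\<^sub>R y))\<^sup>2)) \<partial>lborel)"
    by (simp add: nn_integral_cmult)
  finally show ?thesis .
qed

end

text \<open>After the substitution of \<open>\<tau> *\<^sub>R y\<close> for \<open>y\<close> and an
  exchange of integrals, the weight is integrated along the ray through a fixed \<open>y\<close>.
  The ray crosses the sphere at a right angle, and a singularity of order s < 1 is integrable there,
  uniformly in \<open>y\<close>.\<close>

lemma dilated_weight_bound:
  fixes G :: "real^'n::finite \<Rightarrow> ennreal" and r s :: real
  assumes r: "r > 0" and s: "s < 1" and G[measurable]: "G \<in> borel_measurable borel"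
  defines "W \<equiv> \<lambda>y. ennreal ((norm y - r) powr (- s)) * indicator {y. r < norm y \<and> norm y < 2 * r} y"
  shows "(\<integral>\<^sup>+\<tau>. indicator {1/3..1} \<tau> * (\<integral>\<^sup>+y. G ((1 / \<tau>) *\<^sub>R y) * W y \<partial>lborel) \<partial>lborel)
    \<le> ennreal (r powr (- s) / (1 - s)) * (\<integral>\<^sup>+y. G y \<partial>lborel)"
proof -
  have [measurable]: "W \<in> borel_measurable borel" unfolding W_def by measurable
  have "(\<integral>\<^sup>+\<tau>. indicator {1/3..1} \<tau> * (\<integral>\<^sup>+y. G ((1 / \<tau>) *\<^sub>R y) * W y \<partial>lborel) \<partial>lborel)
    \<le> (\<integral>\<^sup>+\<tau>. \<integral>\<^sup>+y. indicator {1/3..1} \<tau> * (G y * W (\<tau> *\<^sub>R y)) \<partial>lborel \<partial>lborel)"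
  proof (rule nn_integral_mono)
    fix \<tau> :: real
    show "indicator {1/3..1} \<tau> * (\<integral>\<^sup>+y. G ((1 / \<tau>) *\<^sub>R y) * W y \<partial>lborel)
      \<le> (\<integral>\<^sup>+y. indicator {1/3..1} \<tau> * (G y * W (\<tau> *\<^sub>R y)) \<partial>lborel)"
    proof (cases "\<tau> \<in> {1/3..1}")
      case True
      then have \<tau>: "0 < \<tau>" "\<tau> \<le> 1" by auto
      have "(\<integral>\<^sup>+y. G ((1 / \<tau>) *\<^sub>R y) * W y \<partial>lborel)
        = ennreal (\<tau> ^ DIM(real^'n)) * (\<integral>\<^sup>+y. G ((1 / \<tau>) *\<^sub>R (\<tau> *\<^sub>R y)) * W (\<tau> *\<^sub>R y) \<partial>lborel)"
        using \<tau> by (intro nn_integral_scale) measurable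
      also have "\<dots> \<le> 1 * (\<integral>\<^sup>+y. G y * W (\<tau> *\<^sub>R y) \<partial>lborel)"
        using \<tau> by (intro mult_mono) (auto intro: power_le_one)
      finally show ?thesis using True by simp
    qed simp
  qed
  also have "\<dots> = (\<integral>\<^sup>+y. \<integral>\<^sup>+\<tau>. indicator {1/3..1} \<tau> * (G y * W (\<tau> *\<^sub>R y)) \<partial>lborel \<partial>lborel)"
    by (rule lborel_pair.Fubini'[symmetric]) measurable
  also have "\<dots> \<le> (\<integral>\<^sup>+y. ennreal (r powr (- s) / (1 - s)) * G y \<partial>lborel)"
  proof (rule nn_integral_mono)
    fix y :: "real^'n"
    have "(\<integral>\<^sup>+\<tau>. indicator {1/3..1} \<tau> * W (\<tau> *\<^sub>R y) \<partial>lborel) \<le> ennreal (r powr (- s) / (1 - s))"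
    proof (cases "r < norm y")
      case False
      have "indicator {1/3..1} \<tau> * W (\<tau> *\<^sub>R y) = 0" for \<tau>
      proof (cases "\<tau> \<in> {1/3..1}")
        case True
        then have "\<tau> * norm y \<le> 1 * norm y" by (intro mult_right_mono) auto
        then show ?thesis using True False by (auto simp: W_def)
      qed simp
      then have "(\<integral>\<^sup>+\<tau>. indicator {1/3..1} \<tau> * W (\<tau> *\<^sub>R y) \<partial>lborel) = (\<integral>\<^sup>+\<tau>. 0 \<partial>(lborel :: real measure))"
        by (intro nn_integral_cong)
      then show ?thesis by simp
    next
      case True
      define \<rho> where "\<rho> = norm y"
      have \<rho>: "r < \<rho>" "0 < \<rho>" using True r by (auto simp: \<rho>_def)
      \<comment> \<open>In the variable \<open>u = \<rho> * \<tau> - r\<close> the weight is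
        \<open>u powr (- s)\<close> on a part of \<open>{0..r}\<close>. The Jacobian
        \<open>\<rho>\<close>, larger than \<open>r\<close>, absorbs one factor \<open>r\<close> of
        the value of the integral.\<close>
      define f where "f u = ennreal (u powr (- s)) * indicator {0..r} u" for u :: real
      have [measurable]: "f \<in> borel_measurable borel" unfolding f_def by measurable
      have "ennreal \<rho> * (\<integral>\<^sup>+\<tau>. indicator {1/3..1} \<tau> * W (\<tau> *\<^sub>R y) \<partial>lborel) \<le> ennreal \<rho> * (\<integral>\<^sup>+\<tau>. f (- r + \<rho> * \<tau>) \<partial>lborel)"
        by (intro mult_left_mono nn_integral_mono)
          (auto simp: W_def f_def \<rho>_def[symmetric] mult.commute split: split_indicator)
      also have "\<dots> = (\<integral>\<^sup>+u. f u \<partial>lborel)"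
        using nn_integral_real_affine[of f \<rho> "- r"] \<rho> by simp
      also have "\<dots> = ennreal (r powr (1 - s) / (1 - s))"
        unfolding f_def using nn_integral_powr_near_zero[of "- s" r] s r by simp
      also have "r powr (1 - s) = r * r powr (- s)" using r by (simp add: powr_diff powr_minus_divide)
      also have "ennreal (r * r powr (- s) / (1 - s)) \<le> ennreal (\<rho> * (r powr (- s) / (1 - s)))"
        using \<rho> r s by (intro ennreal_leI) (simp add: divide_right_mono mult_right_mono)
      also have "\<dots> = ennreal \<rho> * ennreal (r powr (- s) / (1 - s))" using \<rho> s by (intro ennreal_mult) auto
      finally show ?thesis using \<rho> by (simp add: ennreal_mult_le_mult_iff)
    qed
    then have "G y * (\<integral>\<^sup>+\<tau>. indicator {1/3..1} \<tau> * W (\<tau> *\<^sub>R y) \<partial>lborel) \<le> G y * ennreal (r powr (- s) / (1 - s))"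
      by (rule mult_left_mono) simp
    also have "G y * (\<integral>\<^sup>+\<tau>. indicator {1/3..1} \<tau> * W (\<tau> *\<^sub>R y) \<partial>lborel)
        = (\<integral>\<^sup>+\<tau>. indicator {1/3..1} \<tau> * (G y * W (\<tau> *\<^sub>R y)) \<partial>lborel)"
      by (subst nn_integral_cmult[symmetric]) (auto simp: mult_ac)
    finally show "(\<integral>\<^sup>+\<tau>. indicator {1/3..1} \<tau> * (G y * W (\<tau> *\<^sub>R y)) \<partial>lborel) \<le> ennreal (r powr (- s) / (1 - s)) * G y"
      by (simp add: mult.commute)
  qed
  also have "\<dots> = ennreal (r powr (- s) / (1 - s)) * (\<integral>\<^sup>+y. G y \<partial>lborel)" by (simp add: nn_integral_cmult)
  finally show ?thesis .
qed

text \<open>Averaging the identity \<open>w(y) = w(y/t) - V(t, y)\<close> over \<open>t\<close> smears the singular weight of the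
  sphere over a shell, so that both terms on the right are controlled by unweighted norms.\<close>

lemma (in weak_gradient) Hardy_near_sphere:
  assumes s: "s < 1"
  defines "W \<equiv> \<lambda>y. ennreal ((norm y - r) powr (- s)) * indicator {y :: real^'n. r < norm y \<and> norm y < 2 * r} y"
  shows "(\<integral>\<^sup>+y. ennreal ((w y)\<^sup>2) * W y \<partial>lborel) \<le> ennreal (12 + 648 * r\<^sup>2) * (ennreal (r powr (- s) / (1 - s)) *
    ((\<integral>\<^sup>+y. ennreal ((w y)\<^sup>2) \<partial>lborel) + (\<Sum>i\<in>UNIV. \<integral>\<^sup>+y. ennreal ((g i y)\<^sup>2) \<partial>lborel)))"
proof -
  have [measurable]: "W \<in> borel_measurable borel" unfolding W_def by measurable
  define \<Gamma> where "\<Gamma> y = (\<Sum>i\<in>UNIV. ennreal ((g i y)\<^sup>2))" for y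
  have [measurable]: "\<Gamma> \<in> borel_measurable borel" unfolding \<Gamma>_def by measurable
  define c where "c = ennreal (r powr (- s) / (1 - s))"
  define I where "I = (\<integral>\<^sup>+y. ennreal ((w y)\<^sup>2) * W y \<partial>lborel)"
  define P where "P t = (\<integral>\<^sup>+y. ennreal ((w ((1 / t) *\<^sub>R y))\<^sup>2) * W y \<partial>lborel)" for t
  define Q where "Q t = (\<integral>\<^sup>+y. \<Gamma> ((1 / t) *\<^sub>R y) * W y \<partial>lborel)" for t
  have [measurable]: "P \<in> borel_measurable borel" "Q \<in> borel_measurable borel"
    unfolding P_def Q_def by measurable
  have P: "(\<integral>\<^sup>+\<tau>. indicator {1/3..1} \<tau> * P \<tau> \<partial>lborel) \<le> c * (\<integral>\<^sup>+y. ennreal ((w y)\<^sup>2) \<partial>lborel)"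
    unfolding P_def c_def W_def by (rule dilated_weight_bound[OF r s]) measurable
  have Q: "(\<integral>\<^sup>+\<tau>. indicator {1/3..1} \<tau> * Q \<tau> \<partial>lborel) \<le> c * (\<integral>\<^sup>+y. \<Gamma> y \<partial>lborel)"
    unfolding Q_def c_def W_def by (rule dilated_weight_bound[OF r s]) measurable
  have sup: "W y \<noteq> 0 \<Longrightarrow> r < norm y \<and> norm y \<le> 2 * r" for y
    by (auto simp: W_def split: split_indicator_asm)
  have VW: "(\<integral>\<^sup>+y. ennreal ((V t y)\<^sup>2) * W y \<partial>lborel) \<le> ennreal (324 * r\<^sup>2) * (c * (\<integral>\<^sup>+y. \<Gamma> y \<partial>lborel))"
    if t: "1/3 \<le> t" for t
  proof -
    have "(\<integral>\<^sup>+y. ennreal ((V t y)\<^sup>2) * W y \<partial>lborel)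
      \<le> (\<integral>\<^sup>+y. ennreal (324 * r\<^sup>2) * (\<integral>\<^sup>+\<tau>. indicator {1/3..1} \<tau> * (\<Gamma> ((1 / \<tau>) *\<^sub>R y) * W y) \<partial>lborel) \<partial>lborel)"
    proof (rule nn_integral_mono)
      fix y
      have "ennreal ((V t y)\<^sup>2) * W y \<le> ennreal (324 * r\<^sup>2) * (\<integral>\<^sup>+\<tau>. indicator {1/3..1} \<tau> * \<Gamma> ((1 / \<tau>) *\<^sub>R y) \<partial>lborel) * W y"
      proof (cases "W y = 0")
        case False
        then show ?thesis unfolding \<Gamma>_def using sup[OF False] by (intro mult_right_mono V_sq_bound[OF t]) auto
      qed simp
      also have "\<dots> = ennreal (324 * r\<^sup>2) * (\<integral>\<^sup>+\<tau>. indicator {1/3..1} \<tau> * (\<Gamma> ((1 / \<tau>) *\<^sub>R y) * W y) \<partial>lborel)"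
        by (simp add: mult.assoc nn_integral_multc[symmetric])
      finally show "ennreal ((V t y)\<^sup>2) * W y
        \<le> ennreal (324 * r\<^sup>2) * (\<integral>\<^sup>+\<tau>. indicator {1/3..1} \<tau> * (\<Gamma> ((1 / \<tau>) *\<^sub>R y) * W y) \<partial>lborel)" .
    qed
    also have "\<dots> = ennreal (324 * r\<^sup>2) * (\<integral>\<^sup>+y. \<integral>\<^sup>+\<tau>. indicator {1/3..1} \<tau> * (\<Gamma> ((1 / \<tau>) *\<^sub>R y) * W y) \<partial>lborel \<partial>lborel)"
      by (rule nn_integral_cmult) measurable
    also have "(\<integral>\<^sup>+y. \<integral>\<^sup>+\<tau>. indicator {1/3..1} \<tau> * (\<Gamma> ((1 / \<tau>) *\<^sub>R y) * W y) \<partial>lborel \<partial>lborel)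
       = (\<integral>\<^sup>+\<tau>. \<integral>\<^sup>+y. indicator {1/3..1} \<tau> * (\<Gamma> ((1 / \<tau>) *\<^sub>R y) * W y) \<partial>lborel \<partial>lborel)"
      by (rule lborel_pair.Fubini') measurable
    also have "\<dots> = (\<integral>\<^sup>+\<tau>. indicator {1/3..1} \<tau> * Q \<tau> \<partial>lborel)"
      unfolding Q_def by (intro nn_integral_cong nn_integral_cmult) measurable
    finally show ?thesis using Q by (meson mult_left_mono order_trans zero_le)
  qed
  have step: "I \<le> 2 * P t + 2 * (ennreal (324 * r\<^sup>2) * (c * (\<integral>\<^sup>+y. \<Gamma> y \<partial>lborel)))" if t: "t \<in> {1/3..1/2}" for t
  proof -
    have t01: "0 < t" "t \<le> 1" using t by auto
    have "I \<le> (\<integral>\<^sup>+y. 2 * (ennreal ((w ((1 / t) *\<^sub>R y))\<^sup>2) * W y) + 2 * (ennreal ((V t y)\<^sup>2) * W y) \<partial>lborel)"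
      unfolding I_def
    proof (rule nn_integral_mono_AE)
      show "AE y in lborel. ennreal ((w y)\<^sup>2) * W y \<le> 2 * (ennreal ((w ((1 / t) *\<^sub>R y))\<^sup>2) * W y) + 2 * (ennreal ((V t y)\<^sup>2) * W y)"
        using radial_absolute_continuity[OF t01]
      proof eventually_elim
        case (elim y)
        show ?case
        proof (cases "W y = 0")
          case False
          then have "w y = w ((1 / t) *\<^sub>R y) - V t y" using elim sup by blast
          moreover have "(a - b)\<^sup>2 \<le> 2 * a\<^sup>2 + 2 * b\<^sup>2" for a b :: real
            using zero_le_power2[of "a + b"] by (simp add: power2_eq_square algebra_simps)
          ultimately have "ennreal ((w y)\<^sup>2) \<le> ennreal (2 * (w ((1 / t) *\<^sub>R y))\<^sup>2 + 2 * (V t y)\<^sup>2)"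
            by (intro ennreal_leI) simp
          also have "\<dots> = 2 * ennreal ((w ((1 / t) *\<^sub>R y))\<^sup>2) + 2 * ennreal ((V t y)\<^sup>2)"
            by (simp add: ennreal_mult)
          finally have "ennreal ((w y)\<^sup>2) * W y \<le> (2 * ennreal ((w ((1 / t) *\<^sub>R y))\<^sup>2) + 2 * ennreal ((V t y)\<^sup>2)) * W y"
            by (rule mult_right_mono) simp
          then show ?thesis by (simp add: distrib_right mult.assoc)
        qed simp
      qed
    qed
    also have "\<dots> = 2 * P t + 2 * (\<integral>\<^sup>+y. ennreal ((V t y)\<^sup>2) * W y \<partial>lborel)"
      unfolding P_def by (simp add: nn_integral_add nn_integral_cmult)
    also have "\<dots> \<le> 2 * P t + 2 * (ennreal (324 * r\<^sup>2) * (c * (\<integral>\<^sup>+y. \<Gamma> y \<partial>lborel)))"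
      using t by (intro add_left_mono mult_left_mono VW) auto
    finally show ?thesis .
  qed
  \<comment> \<open>\<open>step\<close> holds on an interval of length 1/6. Integrating it over
    \<open>t\<close> and multiplying by 6 produces the constants 12 = 6 * 2 and 648 = 2 *
    324.\<close>
  define A where "A = 2 * (ennreal (324 * r\<^sup>2) * (c * (\<integral>\<^sup>+y. \<Gamma> y \<partial>lborel)))"
  have "I * ennreal (1/6) = (\<integral>\<^sup>+t. I * indicator {1/3..1/2::real} t \<partial>lborel)"
    by (simp add: nn_integral_cmult)
  also have "\<dots> \<le> (\<integral>\<^sup>+t. 2 * (indicator {1/3..1} t * P t) + A * indicator {1/3..1/2::real} t \<partial>lborel)"
    using step by (intro nn_integral_mono) (auto simp: A_def split: split_indicator)
  also have "\<dots> = 2 * (\<integral>\<^sup>+t. indicator {1/3..1} t * P t \<partial>lborel) + A * ennreal (1/6)"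
    by (simp add: nn_integral_add nn_integral_cmult)
  also have "\<dots> \<le> 2 * (c * (\<integral>\<^sup>+y. ennreal ((w y)\<^sup>2) \<partial>lborel)) + A * ennreal (1/6)"
    by (intro add_right_mono mult_left_mono P) auto
  finally have "6 * (I * ennreal (1/6)) \<le> 6 * (2 * (c * (\<integral>\<^sup>+y. ennreal ((w y)\<^sup>2) \<partial>lborel)) + A * ennreal (1/6))"
    by (rule mult_left_mono) simp
  moreover have six: "(6 :: ennreal) * (x * ennreal (1/6)) = x" for x
  proof -
    have "(6 :: ennreal) * ennreal (1/6) = 1"
      using ennreal_mult[of 6 "1/6"] by simp
    then show ?thesis by (metis mult.commute mult.left_commute mult.right_neutral)
  qed
  ultimately have "I \<le> 12 * (c * (\<integral>\<^sup>+y. ennreal ((w y)\<^sup>2) \<partial>lborel)) + A"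
    by (simp only: six distrib_left) (simp add: mult.assoc[symmetric])
  also have "A = ennreal (648 * r\<^sup>2) * (c * (\<integral>\<^sup>+y. \<Gamma> y \<partial>lborel))"
    unfolding A_def using ennreal_mult[of 2 "324 * r\<^sup>2"] by (simp add: mult.assoc[symmetric])
  also have "12 * (c * (\<integral>\<^sup>+y. ennreal ((w y)\<^sup>2) \<partial>lborel)) + ennreal (648 * r\<^sup>2) * (c * (\<integral>\<^sup>+y. \<Gamma> y \<partial>lborel))
    \<le> ennreal (12 + 648 * r\<^sup>2) * (c * (\<integral>\<^sup>+y. ennreal ((w y)\<^sup>2) \<partial>lborel)) + ennreal (12 + 648 * r\<^sup>2) * (c * (\<integral>\<^sup>+y. \<Gamma> y \<partial>lborel))"
    by (intro add_mono mult_right_mono) (auto simp: ennreal_leI)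
  also have "\<dots> = ennreal (12 + 648 * r\<^sup>2) * (c * ((\<integral>\<^sup>+y. ennreal ((w y)\<^sup>2) \<partial>lborel) + (\<integral>\<^sup>+y. \<Gamma> y \<partial>lborel)))"
    by (simp only: distrib_left)
  also have "(\<integral>\<^sup>+y. \<Gamma> y \<partial>lborel) = (\<Sum>i\<in>UNIV. \<integral>\<^sup>+y. ennreal ((g i y)\<^sup>2) \<partial>lborel)"
    unfolding \<Gamma>_def by (rule nn_integral_sum) measurable
  finally show ?thesis unfolding I_def c_def .
qed

section \<open>Bounds for the Poisson kernel\<close>

lemma nn_integral_translate:
  fixes f :: "'a::euclidean_space \<Rightarrow> ennreal"
  assumes [measurable]: "f \<in> borel_measurable borel"
  shows "(\<integral>\<^sup>+y. f (y - x) \<partial>lborel) = (\<integral>\<^sup>+y. f y \<partial>lborel)"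
proof -
  have "(\<integral>\<^sup>+y. f y \<partial>lborel) = (\<integral>\<^sup>+y. f y \<partial>distr lborel borel ((+) (- x)))"
    by (simp add: lborel_distr_plus)
  also have "\<dots> = (\<integral>\<^sup>+y. f (- x + y) \<partial>lborel)" by (subst nn_integral_distr) auto
  finally show ?thesis by simp
qed

lemma nn_integral_powr_to_inf:
  fixes a e :: real
  assumes "e < -1" "a > 0"
  shows "(\<integral>\<^sup>+t. ennreal (t powr e) * indicator {a..} t \<partial>lborel) = ennreal (a powr (e + 1) / (- e - 1))"
proof -
  have "- (a powr (e + 1)) / (e + 1) = a powr (e + 1) / (- e - 1)" using assms by (simp add: field_simps)
  then show ?thesis
    using nn_integral_has_integral_lebesgue'[OF _ has_integral_powr_to_inf[OF assms]] by simp
qed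

text \<open>Negative powers of the norm are written as superpositions of indicators of balls, so that only
  the volume of balls is needed and no integration in polar coordinates.\<close>

lemma norm_powr_layer_cake:
  fixes z :: "'a::euclidean_space"
  assumes "a > 0" "z \<noteq> 0"
  shows "ennreal (norm z powr (- a)) = ennreal a * (\<integral>\<^sup>+t. ennreal (t powr (- a - 1)) * indicator {norm z..} t \<partial>lborel)"
  using assms nn_integral_powr_to_inf[of "- a - 1" "norm z"] by (simp add: ennreal_mult[symmetric])

text \<open>The ball of radius \<open>t\<close> contributes a volume of order
  \<open>t powr n\<close>, which leaves \<open>t powr (- s - 1)\<close> on
  \<open>{d..}\<close>.\<close>

lemma nn_integral_norm_powr_tail:
  fixes d s :: real
  assumes d: "d > 0" and s: "s > 0"
  defines "n \<equiv> real DIM('a::euclidean_space)"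
  shows "(\<integral>\<^sup>+z. ennreal (norm z powr (- (n + s))) * indicator {z :: 'a. d \<le> norm z} z \<partial>lborel)
    \<le> ennreal ((n + s) * unit_ball_vol n / s * d powr (- s))"
proof -
  have n: "n > 0" by (simp add: n_def)
  have "(\<integral>\<^sup>+z. ennreal (norm z powr (- (n + s))) * indicator {z :: 'a. d \<le> norm z} z \<partial>lborel)
    \<le> (\<integral>\<^sup>+z. ennreal (n + s) * (\<integral>\<^sup>+t. ennreal (t powr (- (n + s) - 1)) * indicator {d..} t * indicator {z :: 'a. norm z \<le> t} z \<partial>lborel) \<partial>lborel)"
  proof (rule nn_integral_mono)
    fix z :: 'a
    show "ennreal (norm z powr (- (n + s))) * indicator {z. d \<le> norm z} z
      \<le> ennreal (n + s) * (\<integral>\<^sup>+t. ennreal (t powr (- (n + s) - 1)) * indicator {d..} t * indicator {z. norm z \<le> t} z \<partial>lborel)"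
    proof (cases "d \<le> norm z")
      case True
      then have "z \<noteq> 0" using d by auto
      have "ennreal (norm z powr (- (n + s))) = ennreal (n + s) * (\<integral>\<^sup>+t. ennreal (t powr (- (n + s) - 1)) * indicator {norm z..} t \<partial>lborel)"
        by (rule norm_powr_layer_cake) (use n s \<open>z \<noteq> 0\<close> in auto)
      also have "\<dots> \<le> ennreal (n + s) * (\<integral>\<^sup>+t. ennreal (t powr (- (n + s) - 1)) * indicator {d..} t * indicator {z. norm z \<le> t} z \<partial>lborel)"
        using True by (intro mult_left_mono nn_integral_mono) (auto split: split_indicator)
      finally show ?thesis using True by simp
    qed simp
  qed
  also have "\<dots> = ennreal (n + s) * (\<integral>\<^sup>+z. \<integral>\<^sup>+t. ennreal (t powr (- (n + s) - 1)) * indicator {d..} t * indicator {z :: 'a. norm z \<le> t} z \<partial>lborel \<partial>lborel)"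
    by (rule nn_integral_cmult) measurable
  also have "(\<integral>\<^sup>+z. \<integral>\<^sup>+t. ennreal (t powr (- (n + s) - 1)) * indicator {d..} t * indicator {z :: 'a. norm z \<le> t} z \<partial>lborel \<partial>lborel)
    = (\<integral>\<^sup>+t. \<integral>\<^sup>+z. ennreal (t powr (- (n + s) - 1)) * indicator {d..} t * indicator {z :: 'a. norm z \<le> t} z \<partial>lborel \<partial>lborel)"
    by (rule lborel_pair.Fubini') measurable
  also have "\<dots> = (\<integral>\<^sup>+t. ennreal (unit_ball_vol n) * (ennreal (t powr (- s - 1)) * indicator {d..} t) \<partial>lborel)"
  proof (rule nn_integral_cong)
    fix t :: real
    show "(\<integral>\<^sup>+z. ennreal (t powr (- (n + s) - 1)) * indicator {d..} t * indicator {z :: 'a. norm z \<le> t} z \<partial>lborel)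
      = ennreal (unit_ball_vol n) * (ennreal (t powr (- s - 1)) * indicator {d..} t)"
    proof (cases "d \<le> t")
      case True
      have e: "{z :: 'a. norm z \<le> t} = cball 0 t" by auto
      have "t > 0" using True d by simp
      then have "t powr (- (n + s) - 1) * t ^ DIM('a) = t powr (- s - 1)"
        by (simp add: powr_realpow[symmetric] powr_add[symmetric] n_def)
      then have *: "ennreal (t powr (- (n + s) - 1)) * ennreal (unit_ball_vol n * t ^ DIM('a)) = ennreal (unit_ball_vol n) * ennreal (t powr (- s - 1))"
        using \<open>t > 0\<close> n by (simp add: ennreal_mult[symmetric] mult.left_commute)
      show ?thesis using True \<open>t > 0\<close> *
        by (simp add: e nn_integral_cmult emeasure_cball n_def)
    qed simp
  qed
  also have "\<dots> = ennreal (unit_ball_vol n) * ennreal (d powr (- s) / s)"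
    using nn_integral_powr_to_inf[of "- s - 1" d] d s by (simp add: nn_integral_cmult)
  also have "ennreal (n + s) * (ennreal (unit_ball_vol n) * ennreal (d powr (- s) / s))
    = ennreal ((n + s) * unit_ball_vol n / s * d powr (- s))"
    using n s by (simp add: ennreal_mult[symmetric] del: ennreal_plus)
  finally show ?thesis .
qed

text \<open>Radii up to \<open>R\<close> contribute \<open>t powr (s - 1)\<close>, integrable at 0
  because s > 0. Beyond \<open>R\<close> the volume no longer grows, and
  \<open>t powr (s - n - 1)\<close> is integrable at infinity because s < n, with n the
  dimension.\<close>

lemma nn_integral_norm_powr_local:
  fixes R s :: real
  assumes R: "R > 0" and s: "0 < s" "s < real DIM('a::euclidean_space)"
  shows "(\<integral>\<^sup>+z. ennreal (norm z powr (s - real DIM('a))) * indicator {z :: 'a. norm z \<le> R} z \<partial>lborel) < \<infinity>"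
proof -
  define n where "n = real DIM('a)"
  have n: "n - s > 0" using s by (simp add: n_def)
  define \<omega> where "\<omega> = unit_ball_vol n"
  have "(\<integral>\<^sup>+z. ennreal (norm z powr (s - n)) * indicator {z :: 'a. norm z \<le> R} z \<partial>lborel)
    \<le> (\<integral>\<^sup>+z. ennreal (n - s) * (\<integral>\<^sup>+t. ennreal (t powr (s - n - 1)) * indicator {0<..} t * indicator {z :: 'a. norm z \<le> min t R} z \<partial>lborel) \<partial>lborel)"
  proof (rule nn_integral_mono)
    fix z :: 'a
    show "ennreal (norm z powr (s - n)) * indicator {z. norm z \<le> R} z
      \<le> ennreal (n - s) * (\<integral>\<^sup>+t. ennreal (t powr (s - n - 1)) * indicator {0<..} t * indicator {z. norm z \<le> min t R} z \<partial>lborel)"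
    proof (cases "norm z \<le> R \<and> z \<noteq> 0")
      case True
      have "ennreal (norm z powr (- (n - s))) = ennreal (n - s) * (\<integral>\<^sup>+t. ennreal (t powr (- (n - s) - 1)) * indicator {norm z..} t \<partial>lborel)"
        by (rule norm_powr_layer_cake) (use n True in auto)
      also have "\<dots> \<le> ennreal (n - s) * (\<integral>\<^sup>+t. ennreal (t powr (s - n - 1)) * indicator {0<..} t * indicator {z. norm z \<le> min t R} z \<partial>lborel)"
      proof (intro mult_left_mono nn_integral_mono)
        fix t :: real
        have "0 < norm z" using True by simp
        then show "ennreal (t powr (- (n - s) - 1)) * indicator {norm z..} t
          \<le> ennreal (t powr (s - n - 1)) * indicator {0<..} t * indicator {z. norm z \<le> min t R} z"
          using True by (auto simp del: zero_less_norm_iff split: split_indicator)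
      qed simp
      finally show ?thesis using True by simp
    qed auto
  qed
  also have "\<dots> = ennreal (n - s) * (\<integral>\<^sup>+z. \<integral>\<^sup>+t. ennreal (t powr (s - n - 1)) * indicator {0<..} t * indicator {z :: 'a. norm z \<le> min t R} z \<partial>lborel \<partial>lborel)"
    by (rule nn_integral_cmult) measurable
  also have "(\<integral>\<^sup>+z. \<integral>\<^sup>+t. ennreal (t powr (s - n - 1)) * indicator {0<..} t * indicator {z :: 'a. norm z \<le> min t R} z \<partial>lborel \<partial>lborel)
    = (\<integral>\<^sup>+t. \<integral>\<^sup>+z. ennreal (t powr (s - n - 1)) * indicator {0<..} t * indicator {z :: 'a. norm z \<le> min t R} z \<partial>lborel \<partial>lborel)"
    by (rule lborel_pair.Fubini') measurable
  also have "\<dots> \<le> (\<integral>\<^sup>+t. ennreal \<omega> * (ennreal (t powr (s - 1)) * indicator {0..R} t)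
      + ennreal (\<omega> * R ^ DIM('a)) * (ennreal (t powr (s - n - 1)) * indicator {R..} t) \<partial>lborel)"
  proof (rule nn_integral_mono)
    fix t :: real
    show "(\<integral>\<^sup>+z. ennreal (t powr (s - n - 1)) * indicator {0<..} t * indicator {z :: 'a. norm z \<le> min t R} z \<partial>lborel)
      \<le> ennreal \<omega> * (ennreal (t powr (s - 1)) * indicator {0..R} t) + ennreal (\<omega> * R ^ DIM('a)) * (ennreal (t powr (s - n - 1)) * indicator {R..} t)"
    proof (cases "t > 0")
      case True
      have e: "{z :: 'a. norm z \<le> min t R} = cball 0 (min t R)" by auto
      have "(\<integral>\<^sup>+z. ennreal (t powr (s - n - 1)) * indicator {0<..} t * indicator {z :: 'a. norm z \<le> min t R} z \<partial>lborel)
        = ennreal (t powr (s - n - 1)) * ennreal (\<omega> * (min t R) ^ DIM('a))"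
      proof -
        have "emeasure lborel {z :: 'a. norm z \<le> min t R} = ennreal (\<omega> * (min t R) ^ DIM('a))"
          unfolding e \<omega>_def n_def using True R by (simp add: emeasure_cball)
        moreover have "{z :: 'a. norm z \<le> min t R} \<in> sets lborel" by (simp add: e)
        ultimately show ?thesis using True by (simp only: nn_integral_cmult_indicator) simp
      qed
      also have "\<dots> \<le> ennreal \<omega> * (ennreal (t powr (s - 1)) * indicator {0..R} t) + ennreal (\<omega> * R ^ DIM('a)) * (ennreal (t powr (s - n - 1)) * indicator {R..} t)"
      proof (cases "t \<le> R")
        case t: True
        have "t powr (s - n - 1) * t ^ DIM('a) = t powr (s - 1)"
          using True by (simp add: powr_realpow[symmetric] powr_add[symmetric] n_def)
        then have "ennreal (t powr (s - n - 1)) * ennreal (\<omega> * t ^ DIM('a)) = ennreal \<omega> * ennreal (t powr (s - 1))"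
          using True by (simp add: ennreal_mult[symmetric] mult.left_commute \<omega>_def n_def)
        then show ?thesis using True t by (simp add: min_def)
      next
        case False
        then show ?thesis using True by (simp add: min_def mult.commute)
      qed
      finally show ?thesis .
    qed simp
  qed
  also have "\<dots> = ennreal \<omega> * ennreal (R powr s / s) + ennreal (\<omega> * R ^ DIM('a)) * ennreal (R powr (s - n) / (n - s))"
    using nn_integral_powr_near_zero[of "s - 1" R] nn_integral_powr_to_inf[of "s - n - 1" R] s R n
    by (simp add: nn_integral_add nn_integral_cmult)
  finally have "(\<integral>\<^sup>+z. ennreal (norm z powr (s - n)) * indicator {z :: 'a. norm z \<le> R} z \<partial>lborel)
    \<le> ennreal (n - s) * (ennreal \<omega> * ennreal (R powr s / s) + ennreal (\<omega> * R ^ DIM('a)) * ennreal (R powr (s - n) / (n - s)))"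
    by (simp add: mult_left_mono)
  also have "\<dots> < \<infinity>" by (simp add: ennreal_mult_less_top)
  finally show ?thesis unfolding n_def .
qed

text \<open>Split at \<open>\<tau> = A\<close>: below, the second factor is at most
  \<open>A powr (- n)\<close>; above, it is at most \<open>\<tau> powr (- n)\<close>. Both parts
  scale like \<open>A powr (1 - s - n)\<close>.\<close>

lemma nn_integral_singular_weight:
  fixes A s n :: real
  assumes A: "A > 0" and s: "0 < s" "s < 1" and n: "n \<ge> 1"
  shows "(\<integral>\<^sup>+\<tau>. ennreal (\<tau> powr (- s) * (A + \<tau>) powr (- n)) * indicator {0<..} \<tau> \<partial>lborel)
    \<le> ennreal ((1 / (1 - s) + 1 / (n + s - 1)) * A powr (1 - s - n))"
proof -
  have "(\<integral>\<^sup>+\<tau>. ennreal (\<tau> powr (- s) * (A + \<tau>) powr (- n)) * indicator {0<..} \<tau> \<partial>lborel)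
    \<le> (\<integral>\<^sup>+\<tau>. ennreal (A powr (- n)) * (ennreal (\<tau> powr (- s)) * indicator {0..A} \<tau>)
        + ennreal (\<tau> powr (- s - n)) * indicator {A..} \<tau> \<partial>lborel)"
  proof (rule nn_integral_mono)
    fix \<tau> :: real
    show "ennreal (\<tau> powr (- s) * (A + \<tau>) powr (- n)) * indicator {0<..} \<tau>
      \<le> ennreal (A powr (- n)) * (ennreal (\<tau> powr (- s)) * indicator {0..A} \<tau>) + ennreal (\<tau> powr (- s - n)) * indicator {A..} \<tau>"
    proof (cases "\<tau> > 0")
      case True
      show ?thesis
      proof (cases "\<tau> \<le> A")
        case t: True
        have "(A + \<tau>) powr (- n) \<le> A powr (- n)" using A True n by (intro powr_mono2') auto
        then have "\<tau> powr (- s) * (A + \<tau>) powr (- n) \<le> A powr (- n) * \<tau> powr (- s)"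
          unfolding mult.commute[of "\<tau> powr (- s)"] by (rule mult_right_mono) simp
        then have "ennreal (\<tau> powr (- s) * (A + \<tau>) powr (- n)) \<le> ennreal (A powr (- n)) * ennreal (\<tau> powr (- s))"
          by (simp add: ennreal_mult[symmetric] ennreal_leI)
        then show ?thesis using True t by (simp add: add_increasing2)
      next
        case False
        have "(A + \<tau>) powr (- n) \<le> \<tau> powr (- n)" using A True n by (intro powr_mono2') auto
        then have "\<tau> powr (- s) * (A + \<tau>) powr (- n) \<le> \<tau> powr (- s) * \<tau> powr (- n)"
          by (rule mult_left_mono) simp
        also have "\<dots> = \<tau> powr (- s - n)" by (simp add: powr_add[symmetric])
        finally show ?thesis using True False by (simp add: ennreal_leI)
      qed
    qed simp
  qed
  also have "\<dots> = ennreal (A powr (- n)) * ennreal (A powr (1 - s) / (1 - s)) + ennreal (A powr (1 - s - n) / (n + s - 1))"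
  proof -
    have e: "- s - n + 1 = 1 - s - n" "- (- s - n) - 1 = n + s - 1" by simp_all
    have "(\<integral>\<^sup>+\<tau>. ennreal (\<tau> powr (- s - n)) * indicator {A..} \<tau> \<partial>lborel) = ennreal (A powr (1 - s - n) / (n + s - 1))"
      using nn_integral_powr_to_inf[of "- s - n" A, unfolded e] A s n by simp
    then show ?thesis
      using nn_integral_powr_near_zero[of "- s" A] A s by (simp add: nn_integral_add nn_integral_cmult)
  qed
  also have "ennreal (A powr (- n)) * ennreal (A powr (1 - s) / (1 - s)) = ennreal (A powr (1 - s - n) / (1 - s))"
    using s by (simp add: ennreal_mult[symmetric] powr_add[symmetric] algebra_simps)
  also have "ennreal (A powr (1 - s - n) / (1 - s)) + ennreal (A powr (1 - s - n) / (n + s - 1))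
    = ennreal ((1 / (1 - s) + 1 / (n + s - 1)) * A powr (1 - s - n))"
    using s n by (simp add: ennreal_plus[symmetric] distrib_right del: ennreal_plus)
  finally show ?thesis .
qed

text \<open>Along a ray the singular weight \<open>(\<bar>y\<bar> - r)\<^sup>-\<^sup>s\<close> may be traded for \<open>\<bar>x - y\<bar>\<^sup>-\<^sup>s\<close>: with \<open>A\<close> the
  distance from \<open>x\<close> to the point where the ray leaves the ball, both radial integrals are comparable
  to \<open>A\<^sup>1\<^sup>-\<^sup>s\<^sup>-\<^sup>n\<close>.\<close>

lemma radial_comparison:
  fixes x y :: "'a::euclidean_space" and r s :: real
  assumes r: "r > 0" and s: "0 < s" "s < 1" and x: "norm x < r"
  defines "n \<equiv> real DIM('a)"
  defines "F \<equiv> \<lambda>y :: 'a. ennreal ((norm y - r) powr (- s) * norm (x - y) powr (- n)) * indicator {y. r < norm y \<and> norm y < 2 * r} y"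
    and "G \<equiv> \<lambda>y :: 'a. ennreal (norm (x - y) powr (- (n + s))) * indicator {y. r < norm y} y"
  shows "(\<integral>\<^sup>+\<mu>. indicator {1..2} \<mu> * F (\<mu> *\<^sub>R y) \<partial>lborel)
    \<le> ennreal (3 powr n * (1 / (1 - s) + 1 / (n + s - 1)) * 2 powr (n + s)) * (\<integral>\<^sup>+\<mu>. indicator {1/2..6} \<mu> * G (\<mu> *\<^sub>R y) \<partial>lborel)"
proof (cases "r / 2 < norm y \<and> norm y < 2 * r")
  case False
  have "indicator {1..2} \<mu> * F (\<mu> *\<^sub>R y) = 0" for \<mu>
  proof (cases "\<mu> \<in> {1..2}")
    case True
    then have "\<mu> * norm y \<le> 2 * norm y" "norm y \<le> \<mu> * norm y"
      using mult_right_mono[of \<mu> 2 "norm y"] mult_right_mono[of 1 \<mu> "norm y"] by auto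
    then have "\<not> (r < \<mu> * norm y \<and> \<mu> * norm y < 2 * r)" using False by auto
    then show ?thesis using True by (simp add: F_def)
  qed simp
  then have "(\<integral>\<^sup>+\<mu>. indicator {1..2} \<mu> * F (\<mu> *\<^sub>R y) \<partial>lborel) = (\<integral>\<^sup>+\<mu>. 0 \<partial>(lborel :: real measure))"
    by (intro nn_integral_cong)
  then show ?thesis by simp
next
  case y: True
  have n: "n \<ge> 1" by (simp add: n_def)
  define \<rho> where "\<rho> = norm y"
  have \<rho>: "r / 2 < \<rho>" "\<rho> < 2 * r" "0 < \<rho>" using y r by (auto simp: \<rho>_def)
  \<comment> \<open>The point at which the ray through \<open>y\<close> leaves the ball.\<close>
  define p where "p = (r / \<rho>) *\<^sub>R y"
  have np: "norm p = r" using \<rho> r by (simp add: p_def \<rho>_def[symmetric])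
  define A where "A = norm (x - p)"
  have A0: "A > 0" using np x by (auto simp: A_def)
  have A2: "A \<le> 2 * r" using norm_triangle_ineq4[of x p] np x by (simp add: A_def)
  have dist: "norm (\<mu> *\<^sub>R y - p) = \<mu> * \<rho> - r" if "r < \<mu> * \<rho>" for \<mu>
  proof -
    have "\<mu> *\<^sub>R y - p = (\<mu> - r / \<rho>) *\<^sub>R y" by (simp add: p_def scaleR_left_diff_distrib)
    then have "norm (\<mu> *\<^sub>R y - p) = \<bar>(\<mu> - r / \<rho>) * \<rho>\<bar>" by (simp add: \<rho>_def abs_mult)
    also have "(\<mu> - r / \<rho>) * \<rho> = \<mu> * \<rho> - r" using \<rho> by (simp add: field_simps)
    finally show ?thesis using that by simp
  qed
  \<comment> \<open>\<open>A\<close> is at most the distance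
    \<open>norm (x - \<mu> *\<^sub>R y)\<close> plus the excess \<open>\<mu> * \<rho> - r\<close>,
    and the excess is at most that distance because \<open>x\<close> lies in the ball; hence the
    factor 3.\<close>
  have lower: "A + (\<mu> * \<rho> - r) \<le> 3 * norm (x - \<mu> *\<^sub>R y)" if \<mu>: "r < \<mu> * \<rho>" "\<mu> > 0" for \<mu>
  proof -
    have "A \<le> norm (x - \<mu> *\<^sub>R y) + (\<mu> * \<rho> - r)"
      using norm_triangle_ineq[of "x - \<mu> *\<^sub>R y" "\<mu> *\<^sub>R y - p"] dist[OF \<mu>(1)] by (simp add: A_def)
    moreover have "\<mu> * \<rho> - r \<le> norm (x - \<mu> *\<^sub>R y)"
      using norm_triangle_ineq2[of "\<mu> *\<^sub>R y" x] x \<mu>(2) by (simp add: norm_minus_commute \<rho>_def)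
    ultimately show ?thesis by linarith
  qed
  have upper: "norm (x - \<mu> *\<^sub>R y) \<le> 2 * A" "norm (x - \<mu> *\<^sub>R y) > 0" if \<mu>: "r < \<mu> * \<rho>" "\<mu> * \<rho> < r + A" "\<mu> > 0" for \<mu>
  proof -
    show "norm (x - \<mu> *\<^sub>R y) \<le> 2 * A"
      using norm_triangle_ineq[of "x - p" "p - \<mu> *\<^sub>R y"] dist[OF \<mu>(1)] \<mu>(2) by (simp add: A_def norm_minus_commute)
    show "norm (x - \<mu> *\<^sub>R y) > 0" using lower[OF \<mu>(1,3)] A0 \<mu>(1) by linarith
  qed
  define c where "c = 1 / (1 - s) + 1 / (n + s - 1)"
  have c: "c \<ge> 0" using s n by (auto simp: c_def)
  define f where "f \<tau> = ennreal (\<tau> powr (- s) * (A + \<tau>) powr (- n)) * indicator {0<..} \<tau>" for \<tau> :: real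
  have [measurable]: "f \<in> borel_measurable borel" unfolding f_def by measurable
  have "ennreal \<rho> * (\<integral>\<^sup>+\<mu>. indicator {1..2} \<mu> * F (\<mu> *\<^sub>R y) \<partial>lborel)
    \<le> ennreal \<rho> * (\<integral>\<^sup>+\<mu>. ennreal (3 powr n) * f (- r + \<rho> * \<mu>) \<partial>lborel)"
  proof (intro mult_left_mono nn_integral_mono)
    fix \<mu> :: real
    show "indicator {1..2} \<mu> * F (\<mu> *\<^sub>R y) \<le> ennreal (3 powr n) * f (- r + \<rho> * \<mu>)"
    proof (cases "\<mu> \<in> {1..2} \<and> r < \<mu> * \<rho>")
      case True
      have l: "A + (\<mu> * \<rho> - r) \<le> 3 * norm (x - \<mu> *\<^sub>R y)" using lower[of \<mu>] True by simp
      have "norm (x - \<mu> *\<^sub>R y) powr (- n) = 3 powr n * (3 * norm (x - \<mu> *\<^sub>R y)) powr (- n)"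
        by (simp add: powr_mult powr_minus_divide)
      also have "\<dots> \<le> 3 powr n * (A + (\<mu> * \<rho> - r)) powr (- n)"
        using l A0 True n by (intro mult_left_mono powr_mono2') auto
      finally have "(\<mu> * \<rho> - r) powr (- s) * norm (x - \<mu> *\<^sub>R y) powr (- n)
        \<le> (\<mu> * \<rho> - r) powr (- s) * (3 powr n * (A + (\<mu> * \<rho> - r)) powr (- n))"
        by (rule mult_left_mono) simp
      then have "ennreal ((\<mu> * \<rho> - r) powr (- s) * norm (x - \<mu> *\<^sub>R y) powr (- n))
        \<le> ennreal (3 powr n * ((\<mu> * \<rho> - r) powr (- s) * (A + (\<mu> * \<rho> - r)) powr (- n)))"
        by (intro ennreal_leI) (simp only: mult_ac)
      also have "\<dots> = ennreal (3 powr n) * f (- r + \<rho> * \<mu>)"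
        using True by (simp add: f_def ennreal_mult mult.commute)
      finally show ?thesis using True by (auto simp: F_def \<rho>_def[symmetric] split: split_indicator)
    next
      case False
      then show ?thesis by (auto simp: F_def \<rho>_def[symmetric] split: split_indicator)
    qed
  qed simp
  also have "\<dots> = ennreal (3 powr n) * (ennreal \<rho> * (\<integral>\<^sup>+\<mu>. f (- r + \<rho> * \<mu>) \<partial>lborel))"
    by (simp add: nn_integral_cmult mult.left_commute)
  also have "ennreal \<rho> * (\<integral>\<^sup>+\<mu>. f (- r + \<rho> * \<mu>) \<partial>lborel) = (\<integral>\<^sup>+\<tau>. f \<tau> \<partial>lborel)"
    using nn_integral_real_affine[of f \<rho> "- r"] \<rho> by simp
  also have "\<dots> \<le> ennreal (c * A powr (1 - s - n))"
    unfolding f_def c_def by (rule nn_integral_singular_weight[OF A0 s n])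
  also have "A powr (1 - s - n) = A powr (- (n + s)) * A"
    using A0 powr_add[of A "- (n + s)" 1] by (simp add: algebra_simps)
  finally have 1: "ennreal \<rho> * (\<integral>\<^sup>+\<mu>. indicator {1..2} \<mu> * F (\<mu> *\<^sub>R y) \<partial>lborel)
    \<le> ennreal (3 powr n) * ennreal (c * (A powr (- (n + s)) * A))"
    by (simp add: mult_left_mono)
  \<comment> \<open>A lower bound for the other radial integral, from the stretch of length
    \<open>A\<close> beyond the exit point, where the distance to \<open>x\<close> is at most
    \<open>2 * A\<close>. There \<open>r < \<mu> * \<rho> < r + A \<le> 3 * r\<close>, and
    \<open>r / 2 < \<rho> < 2 * r\<close> confines \<open>\<mu>\<close> to
    \<open>{1/2..6}\<close>.\<close>
  define k where "k u = ennreal (A powr (- (n + s))) * indicator {0<..<A} u" for u :: real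
  have [measurable]: "k \<in> borel_measurable borel" unfolding k_def by measurable
  have "ennreal (A powr (- (n + s)) * A) = (\<integral>\<^sup>+u. k u \<partial>lborel)"
    unfolding k_def using A0 by (simp add: nn_integral_cmult ennreal_mult)
  also have "\<dots> = ennreal \<rho> * (\<integral>\<^sup>+\<mu>. k (- r + \<rho> * \<mu>) \<partial>lborel)"
    using nn_integral_real_affine[of k \<rho> "- r"] \<rho> by simp
  also have "\<dots> \<le> ennreal \<rho> * (\<integral>\<^sup>+\<mu>. ennreal (2 powr (n + s)) * (indicator {1/2..6} \<mu> * G (\<mu> *\<^sub>R y)) \<partial>lborel)"
  proof (intro mult_left_mono nn_integral_mono)
    fix \<mu> :: real
    show "k (- r + \<rho> * \<mu>) \<le> ennreal (2 powr (n + s)) * (indicator {1/2..6} \<mu> * G (\<mu> *\<^sub>R y))"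
    proof (cases "r < \<mu> * \<rho> \<and> \<mu> * \<rho> < r + A")
      case True
      then have "0 < \<mu>" using r \<rho> by (metis less_trans zero_less_mult_pos2)
      have "\<mu> * \<rho> < 3 * r" using True A2 by simp
      also have "3 * r < 6 * \<rho>" using \<rho> by simp
      finally have m2: "\<mu> < 6" using \<rho> by simp
      have "1/2 * \<rho> < \<mu> * \<rho>" using True \<rho> by linarith
      then have m1: "1/2 < \<mu>" by (rule mult_right_less_imp_less) (use \<rho> in simp)
      have u: "norm (x - \<mu> *\<^sub>R y) \<le> 2 * A" "norm (x - \<mu> *\<^sub>R y) > 0" using upper[of \<mu>] True \<open>0 < \<mu>\<close> by auto
      have "A powr (- (n + s)) = 2 powr (n + s) * (2 * A) powr (- (n + s))"
        using A0 by (simp add: powr_mult mult.assoc[symmetric] powr_add[symmetric])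
      also have "\<dots> \<le> 2 powr (n + s) * norm (x - \<mu> *\<^sub>R y) powr (- (n + s))"
        using u n s by (intro mult_left_mono powr_mono2') auto
      finally have "ennreal (A powr (- (n + s))) \<le> ennreal (2 powr (n + s)) * ennreal (norm (x - \<mu> *\<^sub>R y) powr (- (n + s)))"
        by (simp add: ennreal_mult[symmetric] ennreal_leI)
      then show ?thesis using True m1 m2 \<open>0 < \<mu>\<close> by (simp add: k_def G_def \<rho>_def[symmetric] mult.commute)
    next
      case False
      then have "k (- r + \<rho> * \<mu>) = 0" by (auto simp: k_def mult.commute split: split_indicator)
      then show ?thesis by simp
    qed
  qed simp
  also have "\<dots> = ennreal \<rho> * (ennreal (2 powr (n + s)) * (\<integral>\<^sup>+\<mu>. indicator {1/2..6} \<mu> * G (\<mu> *\<^sub>R y) \<partial>lborel))"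
    unfolding G_def by (subst nn_integral_cmult) measurable
  finally have 2: "ennreal (A powr (- (n + s)) * A)
    \<le> ennreal \<rho> * (ennreal (2 powr (n + s)) * (\<integral>\<^sup>+\<mu>. indicator {1/2..6} \<mu> * G (\<mu> *\<^sub>R y) \<partial>lborel))" .
  have "ennreal \<rho> * (\<integral>\<^sup>+\<mu>. indicator {1..2} \<mu> * F (\<mu> *\<^sub>R y) \<partial>lborel)
    \<le> ennreal (3 powr n) * (ennreal c * ennreal (A powr (- (n + s)) * A))"
    using 1 c A0 by (simp add: ennreal_mult)
  also have "\<dots> \<le> ennreal (3 powr n) * (ennreal c * (ennreal \<rho> * (ennreal (2 powr (n + s)) * (\<integral>\<^sup>+\<mu>. indicator {1/2..6} \<mu> * G (\<mu> *\<^sub>R y) \<partial>lborel))))"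
    by (intro mult_left_mono 2) auto
  also have "\<dots> = ennreal \<rho> * (ennreal (3 powr n * c * 2 powr (n + s)) * (\<integral>\<^sup>+\<mu>. indicator {1/2..6} \<mu> * G (\<mu> *\<^sub>R y) \<partial>lborel))"
    using c by (simp add: ennreal_mult mult_ac)
  finally show ?thesis using \<rho> unfolding c_def by (simp add: ennreal_mult_le_mult_iff)
qed

section \<open>Integrals of the kernel over the exterior and over the ball\<close>

lemma powr_rescale:
  fixes a c s :: real
  assumes "a \<ge> 0" "c > 0"
  shows "a powr (- s) = c powr s * (c * a) powr (- s)"
  using assms by (simp add: powr_mult mult.assoc[symmetric] powr_add[symmetric])

text \<open>An integral over space is comparable to an average of its dilates, so Fubini transfers
  \<open>radial_comparison\<close> from rays to space. Only the shell between radius r and 2r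
  requires it: further out, \<open>norm (x - y)\<close> is at most \<open>3 * (norm y - r)\<close>,
  and the weight can be traded directly.\<close>

lemma exterior_integral_bound:
  fixes r s :: real
  assumes r: "r > 0" and s: "0 < s" "s < 1"
  obtains C where "C \<ge> 0" "\<And>x :: 'a::euclidean_space. norm x < r \<Longrightarrow>
    (\<integral>\<^sup>+y. ennreal ((norm y - r) powr (- s) * norm (x - y) powr (- real DIM('a))) * indicator {y. r < norm y} y \<partial>lborel)
      \<le> ennreal (C * (r - norm x) powr (- s))"
proof -
  define n where "n = real DIM('a)"
  have n: "n \<ge> 1" by (simp add: n_def)
  define k where "k = 3 powr n * (1 / (1 - s) + 1 / (n + s - 1)) * 2 powr (n + s)"
  have k: "k \<ge> 0" using s n by (simp add: k_def)
  define T where "T = (n + s) * unit_ball_vol n / s"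
  have T: "T \<ge> 0" using s n by (simp add: T_def)
  \<comment> \<open>The Jacobians are at most \<open>2 ^ n\<close> in both substitutions, with n the
    dimension; 11/2 is the length of \<open>{1/2..6}\<close>, and \<open>3 powr s\<close> comes from
    the region beyond \<open>2 * r\<close>.\<close>
  define K where "K = 2 ^ DIM('a) * (k * (2 ^ DIM('a) * (11 / 2))) + 3 powr s"
  have K: "K \<ge> 0" using k by (simp add: K_def)
  show thesis
  proof (rule that[of "K * T"])
    show "K * T \<ge> 0" using K T by simp
    fix x :: 'a assume x: "norm x < r"
    define F where "F y = ennreal ((norm y - r) powr (- s) * norm (x - y) powr (- n)) * indicator {y. r < norm y \<and> norm y < 2 * r} y" for y
    define G where "G y = ennreal (norm (x - y) powr (- (n + s))) * indicator {y. r < norm y} y" for y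
    have [measurable]: "F \<in> borel_measurable borel" "G \<in> borel_measurable borel"
      unfolding F_def G_def by measurable
    have "(\<integral>\<^sup>+y. F y \<partial>lborel) = (\<integral>\<^sup>+\<mu>. indicator {1..2::real} \<mu> * (\<integral>\<^sup>+y. F y \<partial>lborel) \<partial>lborel)"
      by (simp add: nn_integral_multc)
    also have "\<dots> \<le> (\<integral>\<^sup>+\<mu>. ennreal (2 ^ DIM('a)) * (\<integral>\<^sup>+y. indicator {1..2::real} \<mu> * F (\<mu> *\<^sub>R y) \<partial>lborel) \<partial>lborel)"
    proof (rule nn_integral_mono)
      fix \<mu> :: real
      show "indicator {1..2} \<mu> * (\<integral>\<^sup>+y. F y \<partial>lborel) \<le> ennreal (2 ^ DIM('a)) * (\<integral>\<^sup>+y. indicator {1..2} \<mu> * F (\<mu> *\<^sub>R y) \<partial>lborel)"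
      proof (cases "\<mu> \<in> {1..2}")
        case True
        then have "(\<integral>\<^sup>+y. F y \<partial>lborel) = ennreal (\<mu> ^ DIM('a)) * (\<integral>\<^sup>+y. F (\<mu> *\<^sub>R y) \<partial>lborel)"
          by (intro nn_integral_scale) auto
        also have "\<dots> \<le> ennreal (2 ^ DIM('a)) * (\<integral>\<^sup>+y. F (\<mu> *\<^sub>R y) \<partial>lborel)"
          using True by (intro mult_right_mono ennreal_leI power_mono) auto
        finally show ?thesis using True by simp
      qed simp
    qed
    also have "\<dots> = ennreal (2 ^ DIM('a)) * (\<integral>\<^sup>+\<mu>. \<integral>\<^sup>+y. indicator {1..2::real} \<mu> * F (\<mu> *\<^sub>R y) \<partial>lborel \<partial>lborel)"
      by (rule nn_integral_cmult) measurable
    also have "(\<integral>\<^sup>+\<mu>. \<integral>\<^sup>+y. indicator {1..2::real} \<mu> * F (\<mu> *\<^sub>R y) \<partial>lborel \<partial>lborel)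
        = (\<integral>\<^sup>+y. \<integral>\<^sup>+\<mu>. indicator {1..2::real} \<mu> * F (\<mu> *\<^sub>R y) \<partial>lborel \<partial>lborel)"
      by (rule lborel_pair.Fubini'[symmetric]) measurable
    also have "\<dots> \<le> (\<integral>\<^sup>+y. ennreal k * (\<integral>\<^sup>+\<mu>. indicator {1/2..6} \<mu> * G (\<mu> *\<^sub>R y) \<partial>lborel) \<partial>lborel)"
      unfolding F_def G_def k_def n_def by (intro nn_integral_mono radial_comparison[OF r s x])
    also have "\<dots> = ennreal k * (\<integral>\<^sup>+y. \<integral>\<^sup>+\<mu>. indicator {1/2..6::real} \<mu> * G (\<mu> *\<^sub>R y) \<partial>lborel \<partial>lborel)"
      by (rule nn_integral_cmult) measurable
    also have "(\<integral>\<^sup>+y. \<integral>\<^sup>+\<mu>. indicator {1/2..6::real} \<mu> * G (\<mu> *\<^sub>R y) \<partial>lborel \<partial>lborel)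
        = (\<integral>\<^sup>+\<mu>. \<integral>\<^sup>+y. indicator {1/2..6::real} \<mu> * G (\<mu> *\<^sub>R y) \<partial>lborel \<partial>lborel)"
      by (rule lborel_pair.Fubini') measurable
    also have "\<dots> \<le> (\<integral>\<^sup>+\<mu>. ennreal (2 ^ DIM('a)) * (\<integral>\<^sup>+y. G y \<partial>lborel) * indicator {1/2..6::real} \<mu> \<partial>lborel)"
    proof (rule nn_integral_mono)
      fix \<mu> :: real
      show "(\<integral>\<^sup>+y. indicator {1/2..6} \<mu> * G (\<mu> *\<^sub>R y) \<partial>lborel) \<le> ennreal (2 ^ DIM('a)) * (\<integral>\<^sup>+y. G y \<partial>lborel) * indicator {1/2..6} \<mu>"
      proof (cases "\<mu> \<in> {1/2..6}")
        case True
        then have "(\<integral>\<^sup>+y. G (\<mu> *\<^sub>R y) \<partial>lborel) = ennreal ((1 / \<mu>) ^ DIM('a)) * (\<integral>\<^sup>+y. G (\<mu> *\<^sub>R ((1 / \<mu>) *\<^sub>R y)) \<partial>lborel)"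
          by (intro nn_integral_scale) auto
        also have "\<dots> = ennreal ((1 / \<mu>) ^ DIM('a)) * (\<integral>\<^sup>+y. G y \<partial>lborel)" using True by simp
        also have "\<dots> \<le> ennreal (2 ^ DIM('a)) * (\<integral>\<^sup>+y. G y \<partial>lborel)"
          using True by (intro mult_right_mono ennreal_leI power_mono) (auto simp: field_simps)
        finally show ?thesis using True by simp
      qed simp
    qed
    also have "\<dots> = ennreal (2 ^ DIM('a)) * (\<integral>\<^sup>+y. G y \<partial>lborel) * ennreal (11 / 2)"
      by (simp add: nn_integral_cmult)
    finally have near: "(\<integral>\<^sup>+y. F y \<partial>lborel)
      \<le> ennreal (2 ^ DIM('a)) * (ennreal k * (ennreal (2 ^ DIM('a)) * (\<integral>\<^sup>+y. G y \<partial>lborel) * ennreal (11 / 2)))"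
      by (simp add: mult_left_mono)
    have far: "ennreal ((norm y - r) powr (- s) * norm (x - y) powr (- n)) * indicator {y. r < norm y} y \<le> F y + ennreal (3 powr s) * G y" for y
    proof (cases "2 * r \<le> norm y")
      case True
      have xy: "norm (x - y) \<le> 3 * (norm y - r)" using norm_triangle_ineq4[of x y] x True by argo
      have xy0: "norm (x - y) > 0" using True x r by auto
      have "(norm y - r) powr (- s) = 3 powr s * (3 * (norm y - r)) powr (- s)"
        by (rule powr_rescale) (use True r in auto)
      also have "\<dots> \<le> 3 powr s * norm (x - y) powr (- s)"
        using xy xy0 s by (intro mult_left_mono powr_mono2') auto
      finally have "(norm y - r) powr (- s) * norm (x - y) powr (- n) \<le> 3 powr s * norm (x - y) powr (- s) * norm (x - y) powr (- n)"
        by (rule mult_right_mono) simp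
      also have "\<dots> = 3 powr s * norm (x - y) powr (- (n + s))"
        by (simp add: mult.assoc powr_add[symmetric] add.commute)
      finally have "ennreal ((norm y - r) powr (- s) * norm (x - y) powr (- n)) \<le> ennreal (3 powr s) * ennreal (norm (x - y) powr (- (n + s)))"
        by (simp add: ennreal_mult[symmetric] ennreal_leI)
      then show ?thesis using True r by (simp add: G_def add_increasing)
    next
      case False
      then show ?thesis by (cases "r < norm y") (auto simp: F_def add_increasing2)
    qed
    have G: "(\<integral>\<^sup>+y. G y \<partial>lborel) \<le> ennreal (T * (r - norm x) powr (- s))"
    proof -
      have "(\<integral>\<^sup>+y. G y \<partial>lborel) \<le> (\<integral>\<^sup>+y. ennreal (norm (y - x) powr (- (n + s))) * indicator {z. r - norm x \<le> norm z} (y - x) \<partial>lborel)"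
      proof (rule nn_integral_mono)
        fix y
        have "r < norm y \<Longrightarrow> r - norm x \<le> norm (y - x)" using norm_triangle_ineq2[of y x] by linarith
        then show "G y \<le> ennreal (norm (y - x) powr (- (n + s))) * indicator {z. r - norm x \<le> norm z} (y - x)"
          by (auto simp: G_def norm_minus_commute split: split_indicator)
      qed
      also have "\<dots> = (\<integral>\<^sup>+z. ennreal (norm z powr (- (n + s))) * indicator {z :: 'a. r - norm x \<le> norm z} z \<partial>lborel)"
      proof -
        define h where "h z = ennreal (norm z powr (- (n + s))) * indicator {z. r - norm x \<le> norm z} z" for z :: 'a
        have "h \<in> borel_measurable borel" unfolding h_def by measurable
        from nn_integral_translate[OF this, of x] show ?thesis unfolding h_def .
      qed
      also have "\<dots> \<le> ennreal (T * (r - norm x) powr (- s))"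
        unfolding T_def n_def by (rule nn_integral_norm_powr_tail) (use x s in auto)
      finally show ?thesis .
    qed
    have "(\<integral>\<^sup>+y. ennreal ((norm y - r) powr (- s) * norm (x - y) powr (- n)) * indicator {y. r < norm y} y \<partial>lborel)
      \<le> (\<integral>\<^sup>+y. F y + ennreal (3 powr s) * G y \<partial>lborel)"
      by (intro nn_integral_mono far)
    also have "\<dots> = (\<integral>\<^sup>+y. F y \<partial>lborel) + ennreal (3 powr s) * (\<integral>\<^sup>+y. G y \<partial>lborel)"
      by (simp add: nn_integral_add nn_integral_cmult)
    also have "\<dots> \<le> ennreal (2 ^ DIM('a)) * (ennreal k * (ennreal (2 ^ DIM('a)) * (\<integral>\<^sup>+y. G y \<partial>lborel) * ennreal (11 / 2)))
        + ennreal (3 powr s) * (\<integral>\<^sup>+y. G y \<partial>lborel)"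
      by (rule add_right_mono[OF near])
    also have "\<dots> = (ennreal (2 ^ DIM('a)) * (ennreal k * (ennreal (2 ^ DIM('a)) * ennreal (11 / 2))) + ennreal (3 powr s)) * (\<integral>\<^sup>+y. G y \<partial>lborel)"
      by (simp only: distrib_left distrib_right mult_ac)
    also have "ennreal (2 ^ DIM('a)) * (ennreal k * (ennreal (2 ^ DIM('a)) * ennreal (11 / 2))) + ennreal (3 powr s) = ennreal K"
    proof -
      have "ennreal (2 ^ DIM('a)) * (ennreal k * (ennreal (2 ^ DIM('a)) * ennreal (11 / 2))) = ennreal (2 ^ DIM('a) * (k * (2 ^ DIM('a) * (11 / 2))))"
      proof -
        have a: "ennreal (2 ^ DIM('a)) * ennreal (11 / 2) = ennreal (2 ^ DIM('a) * (11 / 2))"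
          by (rule ennreal_mult[symmetric]) auto
        have b: "ennreal k * ennreal (2 ^ DIM('a) * (11 / 2)) = ennreal (k * (2 ^ DIM('a) * (11 / 2)))"
          by (rule ennreal_mult[symmetric]) (use k in auto)
        show ?thesis unfolding a b by (rule ennreal_mult[symmetric]) (use k in auto)
      qed
      then show ?thesis unfolding K_def using k by (subst ennreal_plus) auto
    qed
    also have "ennreal K * (\<integral>\<^sup>+y. G y \<partial>lborel) \<le> ennreal K * ennreal (T * (r - norm x) powr (- s))"
      by (rule mult_left_mono[OF G]) simp
    also have "\<dots> = ennreal (K * T * (r - norm x) powr (- s))"
      using K T by (simp add: ennreal_mult[symmetric] mult.assoc)
    finally show "(\<integral>\<^sup>+y. ennreal ((norm y - r) powr (- s) * norm (x - y) powr (- real DIM('a))) * indicator {y. r < norm y} y \<partial>lborel)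
      \<le> ennreal (K * T * (r - norm x) powr (- s))" unfolding n_def .
  qed
qed

text \<open>The factor vanishing at the sphere tames the singularity:
  \<open>r - norm x \<le> norm (x - y)\<close> for \<open>y\<close> outside the ball, so within
  distance \<open>r\<close> of \<open>y\<close> the integrand is at most the power s - n of the
  distance, which is locally integrable. Farther away it is at most \<open>r powr (s - n)\<close>.
  Neither bound depends on \<open>y\<close>.\<close>

lemma interior_integral_bound:
  fixes r s :: real
  assumes r: "r > 0" and s: "0 < s" "s < 1"
  obtains C where "C \<ge> 0" "\<And>y :: 'a::euclidean_space. r < norm y \<Longrightarrow>
    (\<integral>\<^sup>+x. ennreal ((r - norm x) powr s * norm (x - y) powr (- real DIM('a))) * indicator (ball 0 r) x \<partial>lborel) \<le> ennreal C"
proof -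
  define n where "n = real DIM('a)"
  have n: "s < n" using s DIM_positive[where 'a = 'a] unfolding n_def by linarith
  define L where "L = (\<integral>\<^sup>+z. ennreal (norm z powr (s - n)) * indicator {z :: 'a. norm z \<le> r} z \<partial>lborel)"
  have L: "L < \<infinity>" unfolding L_def n_def by (rule nn_integral_norm_powr_local[OF r s(1)]) (use n in \<open>simp add: n_def\<close>)
  define U where "U = L + ennreal (r powr (s - n)) * emeasure lborel (ball (0::'a) r)"
  have U: "U < \<infinity>" using L emeasure_lborel_ball_finite[of "0::'a" r] unfolding U_def by (simp add: ennreal_mult_less_top)
  show thesis
  proof (rule that[of "enn2real U"])
    fix y :: 'a assume y: "r < norm y"
    have "(\<integral>\<^sup>+x. ennreal ((r - norm x) powr s * norm (x - y) powr (- n)) * indicator (ball 0 r) x \<partial>lborel)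
      \<le> (\<integral>\<^sup>+x. ennreal (norm (x - y) powr (s - n)) * indicator {z. norm z \<le> r} (x - y)
          + ennreal (r powr (s - n)) * indicator (ball 0 r) x \<partial>lborel)"
    proof (rule nn_integral_mono)
      fix x :: 'a
      show "ennreal ((r - norm x) powr s * norm (x - y) powr (- n)) * indicator (ball 0 r) x
        \<le> ennreal (norm (x - y) powr (s - n)) * indicator {z. norm z \<le> r} (x - y) + ennreal (r powr (s - n)) * indicator (ball 0 r) x"
      proof (cases "x \<in> ball 0 r")
        case True
        then have x: "norm x < r" by simp
        have le: "r - norm x \<le> norm (x - y)" using norm_triangle_ineq2[of y x] y by (simp add: norm_minus_commute)
        have e: "norm (x - y) powr (s - n) = norm (x - y) powr s * norm (x - y) powr (- n)" by (simp add: powr_add[symmetric])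
        have e': "r powr (s - n) = r powr s * r powr (- n)" by (simp add: powr_add[symmetric])
        show ?thesis
        proof (cases "norm (x - y) \<le> r")
          case near: True
          have "(r - norm x) powr s * norm (x - y) powr (- n) \<le> norm (x - y) powr (s - n)"
            unfolding e using x le s by (intro mult_right_mono powr_mono2) auto
          then show ?thesis using True near by (simp add: ennreal_leI add_increasing2)
        next
          case False
          have "(r - norm x) powr s * norm (x - y) powr (- n) \<le> r powr (s - n)"
            unfolding e' using x s False r by (intro mult_mono powr_mono2 powr_mono2') (auto simp: n_def)
          then show ?thesis using True False by (simp add: ennreal_leI)
        qed
      qed simp
    qed
    also have "\<dots> = L + ennreal (r powr (s - n)) * emeasure lborel (ball (0::'a) r)"
    proof -
      define h where "h z = ennreal (norm z powr (s - n)) * indicator {z. norm z \<le> r} z" for z :: 'a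
      have [measurable]: "h \<in> borel_measurable borel" unfolding h_def by measurable
      have m: "(\<lambda>x. ennreal (r powr (s - n)) * indicator (ball (0::'a) r) x) \<in> borel_measurable lborel"
        by (intro borel_measurable_times_ennreal borel_measurable_const borel_measurable_indicator) (simp only: sets_lborel borel_open open_ball)
      have "(\<integral>\<^sup>+x. h (x - y) + ennreal (r powr (s - n)) * indicator (ball 0 r) x \<partial>lborel)
        = (\<integral>\<^sup>+x. h (x - y) \<partial>lborel) + (\<integral>\<^sup>+x. ennreal (r powr (s - n)) * indicator (ball (0::'a) r) x \<partial>lborel)"
        by (rule nn_integral_add[OF _ m]) measurable
      moreover have "(\<integral>\<^sup>+x. h (x - y) \<partial>lborel) = L"
        using nn_integral_translate[of h y] by (simp add: h_def L_def)
      moreover have "(\<integral>\<^sup>+x. ennreal (r powr (s - n)) * indicator (ball (0::'a) r) x \<partial>lborel)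
        = ennreal (r powr (s - n)) * emeasure lborel (ball (0::'a) r)"
        by (rule nn_integral_cmult_indicator) (simp only: sets_lborel borel_open open_ball)
      ultimately show ?thesis unfolding h_def by simp
    qed
    finally show "(\<integral>\<^sup>+x. ennreal ((r - norm x) powr s * norm (x - y) powr (- real DIM('a))) * indicator (ball 0 r) x \<partial>lborel) \<le> ennreal (enn2real U)"
      using U by (simp add: U_def n_def)
  qed simp
qed

section \<open>The Poisson kernel: pointwise bounds and a weighted Schur test\<close>

definition poisson_const :: "real \<Rightarrow> nat \<Rightarrow> real" where
  "poisson_const s n = Gamma (real n / 2) * sin (pi * s) / pi powr (real n / 2 + 1)"

lemma poisson_const_pos:
  assumes "0 < s" "s < 1" "n > 0"
  shows "poisson_const s n > 0"
proof -
  have "sin (pi * s) > 0" using assms by (intro sin_gt_zero) auto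
  then show ?thesis using assms by (auto simp: poisson_const_def intro!: divide_pos_pos mult_pos_pos Gamma_real_pos)
qed

lemma poisson_kernel_bounds:
  fixes x y :: "real^'n::finite"
  assumes r: "r > 0" and s: "0 < s" "s < 1" and x: "norm x < r" and y: "r < norm y"
  shows "0 \<le> poisson_kernel s r y x"
    "poisson_kernel s r y x \<le> poisson_const s CARD('n) *
        ((r - norm x) powr s * (norm y - r) powr (- s) * norm (x - y) powr (- real CARD('n)))"
proof -
  have c: "poisson_const s CARD('n) > 0" by (rule poisson_const_pos[OF s]) simp
  have ne: "norm (x - y) > 0" using x y by auto
  have eq: "poisson_kernel s r y x = poisson_const s CARD('n) *
      (((r\<^sup>2 - (norm x)\<^sup>2) / ((norm y)\<^sup>2 - r\<^sup>2)) powr s * norm (x - y) powr (- real CARD('n)))"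
    using ne by (simp add: poisson_kernel_def poisson_const_def powr_minus_divide powr_realpow mult.assoc)
  show "0 \<le> poisson_kernel s r y x" unfolding eq using c by simp
  \<comment> \<open>Factor both differences of squares and use
    \<open>r + norm x \<le> 2 * r \<le> norm y + r\<close>.\<close>
  have "(r\<^sup>2 - (norm x)\<^sup>2) / ((norm y)\<^sup>2 - r\<^sup>2) \<le> (r - norm x) / (norm y - r)"
  proof -
    have 1: "r\<^sup>2 - (norm x)\<^sup>2 \<le> (r - norm x) * (2 * r)"
      using x by (simp add: square_diff_square_factored power2_eq_square mult.commute mult_left_mono)
    have 2: "(norm y - r) * (2 * r) \<le> (norm y)\<^sup>2 - r\<^sup>2"
      using y by (simp add: square_diff_square_factored power2_eq_square mult.commute mult_left_mono)
    have "(r\<^sup>2 - (norm x)\<^sup>2) / ((norm y)\<^sup>2 - r\<^sup>2) \<le> ((r - norm x) * (2 * r)) / ((norm y - r) * (2 * r))"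
      using 1 2 x y r by (intro frac_le) auto
    then show ?thesis using r by simp
  qed
  moreover have "0 \<le> (r\<^sup>2 - (norm x)\<^sup>2) / ((norm y)\<^sup>2 - r\<^sup>2)"
    using x y r by (intro divide_nonneg_nonneg) (auto simp: power_mono)
  ultimately have "((r\<^sup>2 - (norm x)\<^sup>2) / ((norm y)\<^sup>2 - r\<^sup>2)) powr s \<le> ((r - norm x) / (norm y - r)) powr s"
    using s by (intro powr_mono2) auto
  also have "\<dots> = (r - norm x) powr s * (norm y - r) powr (- s)"
    using x y by (simp add: powr_divide powr_minus_divide)
  finally show "poisson_kernel s r y x \<le> poisson_const s CARD('n) *
        ((r - norm x) powr s * (norm y - r) powr (- s) * norm (x - y) powr (- real CARD('n)))"
    unfolding eq using c by (intro mult_left_mono mult_right_mono) auto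
qed

definition sphere_weight :: "real \<Rightarrow> real \<Rightarrow> 'a::real_normed_vector \<Rightarrow> ennreal" where
  "sphere_weight r s y = ennreal ((norm y - r) powr (- s)) * indicator {y. r < norm y} y"

lemma sphere_weight_measurable[measurable]:
  "sphere_weight r s \<in> borel_measurable (borel :: 'a::euclidean_space measure)"
  unfolding sphere_weight_def by measurable

lemma poisson_kernel_measurable[measurable (raw)]:
  assumes [measurable]: "f \<in> borel_measurable M" "g \<in> borel_measurable M"
  shows "(\<lambda>z. poisson_kernel s r (f z :: real^'n::finite) (g z)) \<in> borel_measurable M"
  unfolding poisson_kernel_def by measurable

lemma poisson_kernel_sphere: "s > 0 \<Longrightarrow> norm y = r \<Longrightarrow> poisson_kernel s r y x = 0"
  by (simp add: poisson_kernel_def)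

lemma ball_measurable[measurable]: "ball (a :: 'a::metric_space) r \<in> sets borel"
  by (rule borel_open[OF open_ball])

text \<open>The kernel cut off to its domain and with values in \<open>ennreal\<close>, so that
  integrals may be exchanged before anything is known to be finite.\<close>

definition poisson_nn :: "real \<Rightarrow> real \<Rightarrow> (real^'n::finite) \<Rightarrow> real^'n \<Rightarrow> ennreal" where
  "poisson_nn s r y x = ennreal (poisson_kernel s r y x) * indicator {y. r < norm y} y * indicator (ball 0 r) x"

lemma poisson_nn_measurable[measurable (raw)]:
  assumes [measurable]: "f \<in> borel_measurable M" "g \<in> borel_measurable M"
  shows "(\<lambda>z. poisson_nn s r (f z :: real^'n::finite) (g z)) \<in> borel_measurable M"
  unfolding poisson_nn_def by measurable

lemma poisson_nn_le:
  fixes x y :: "real^'n::finite"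
  assumes r: "r > 0" and s: "0 < s" "s < 1"
  shows "poisson_nn s r y x \<le> ennreal (poisson_const s CARD('n)) *
    (ennreal ((r - norm x) powr s * (norm y - r) powr (- s) * norm (x - y) powr (- real DIM(real^'n)))
      * (indicator {y. r < norm y} y * indicator (ball 0 r) x))"
proof (cases "r < norm y \<and> norm x < r")
  case True
  have c: "poisson_const s CARD('n) > 0" by (rule poisson_const_pos[OF s]) simp
  have "ennreal (poisson_kernel s r y x) \<le> ennreal (poisson_const s CARD('n) *
        ((r - norm x) powr s * (norm y - r) powr (- s) * norm (x - y) powr (- real DIM(real^'n))))"
    using poisson_kernel_bounds(2)[OF r s, of x y] True by (intro ennreal_leI) simp
  also have "\<dots> = ennreal (poisson_const s CARD('n)) * ennreal ((r - norm x) powr s * (norm y - r) powr (- s) * norm (x - y) powr (- real DIM(real^'n)))"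
    by (rule ennreal_mult) (use c in auto)
  finally show ?thesis using True by (simp add: poisson_nn_def)
next
  case False
  then show ?thesis by (auto simp: poisson_nn_def split: split_indicator)
qed

text \<open>The last claim concerns every \<open>x\<close>, not almost every one: the Poisson
  operator is a pointwise integral and has to converge at each point of the ball.\<close>

lemma poisson_nn_L2_bound:
  fixes r s :: real
  assumes r: "r > 0" and s: "0 < s" "s < 1"
  obtains C where "C \<ge> 0"
    "\<And>w :: real^'n::finite \<Rightarrow> real. w \<in> borel_measurable borel \<Longrightarrow>
      (\<integral>\<^sup>+x. (\<integral>\<^sup>+y. poisson_nn s r y x * ennreal \<bar>w y\<bar> \<partial>lborel)\<^sup>2 \<partial>lborel)
        \<le> ennreal C * (\<integral>\<^sup>+y. ennreal ((w y)\<^sup>2) * sphere_weight r s y \<partial>lborel)"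
    "\<And>w (x :: real^'n). w \<in> borel_measurable borel \<Longrightarrow>
      (\<integral>\<^sup>+y. ennreal ((w y)\<^sup>2) * sphere_weight r s y \<partial>lborel) < \<infinity> \<Longrightarrow>
      (\<integral>\<^sup>+y. poisson_nn s r y x * ennreal \<bar>w y\<bar> \<partial>lborel) < \<infinity>"
proof -
  let ?n = "real DIM(real^'n)"
  define c where "c = poisson_const s CARD('n)"
  have c: "c > 0" unfolding c_def by (rule poisson_const_pos[OF s]) simp
  obtain C1 where C1: "C1 \<ge> 0" "\<And>x :: real^'n. norm x < r \<Longrightarrow>
    (\<integral>\<^sup>+y. ennreal ((norm y - r) powr (- s) * norm (x - y) powr (- ?n)) * indicator {y. r < norm y} y \<partial>lborel)
      \<le> ennreal (C1 * (r - norm x) powr (- s))" 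
    by (rule exterior_integral_bound[OF r s, where 'a = "real^'n"]) (rule that)
  obtain C2 where C2: "C2 \<ge> 0" "\<And>y :: real^'n. r < norm y \<Longrightarrow>
    (\<integral>\<^sup>+x. ennreal ((r - norm x) powr s * norm (x - y) powr (- ?n)) * indicator (ball 0 r) x \<partial>lborel) \<le> ennreal C2"

    by (rule interior_integral_bound[OF r s, where 'a = "real^'n"]) (rule that)
  have in_y: "(\<integral>\<^sup>+y. poisson_nn s r y x \<partial>lborel) \<le> ennreal (c * C1)" for x :: "real^'n"
  proof (cases "norm x < r")
    case True
    have "(\<integral>\<^sup>+y. poisson_nn s r y x \<partial>lborel)
      \<le> (\<integral>\<^sup>+y. ennreal (c * (r - norm x) powr s) * (ennreal ((norm y - r) powr (- s) * norm (x - y) powr (- ?n)) * indicator {y. r < norm y} y) \<partial>lborel)"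
    proof (rule nn_integral_mono)
      fix y :: "real^'n"
      have "ennreal c * ennreal ((r - norm x) powr s * (norm y - r) powr (- s) * norm (x - y) powr (- ?n))
        = ennreal (c * (r - norm x) powr s) * ennreal ((norm y - r) powr (- s) * norm (x - y) powr (- ?n))"
        using c by (simp add: ennreal_mult[symmetric] mult.assoc)
      then show "poisson_nn s r y x \<le> ennreal (c * (r - norm x) powr s) * (ennreal ((norm y - r) powr (- s) * norm (x - y) powr (- ?n)) * indicator {y. r < norm y} y)"
        using poisson_nn_le[OF r s, of y x] True by (simp add: c_def[symmetric] mult.assoc[symmetric])
    qed
    also have "\<dots> = ennreal (c * (r - norm x) powr s) * (\<integral>\<^sup>+y. ennreal ((norm y - r) powr (- s) * norm (x - y) powr (- ?n)) * indicator {y. r < norm y} y \<partial>lborel)"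
      by (rule nn_integral_cmult) measurable
    also have "\<dots> \<le> ennreal (c * (r - norm x) powr s) * ennreal (C1 * (r - norm x) powr (- s))"
      by (intro mult_left_mono C1(2) True) simp
    also have "\<dots> = ennreal (c * (r - norm x) powr s * (C1 * (r - norm x) powr (- s)))"
      by (rule ennreal_mult[symmetric]) (use c C1(1) in auto)
    also have "c * (r - norm x) powr s * (C1 * (r - norm x) powr (- s)) = c * C1 * ((r - norm x) powr s * (r - norm x) powr (- s))"
      by simp
    also have "(r - norm x) powr s * (r - norm x) powr (- s) = 1" using True by (simp add: powr_add[symmetric])
    finally show ?thesis by simp
  next
    case False
    then have "poisson_nn s r y x = 0" for y by (simp add: poisson_nn_def)
    then show ?thesis by simp
  qed
  have in_x: "(\<integral>\<^sup>+x. poisson_nn s r y x \<partial>lborel) \<le> ennreal (c * C2) * sphere_weight r s y" for y :: "real^'n"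
  proof (cases "r < norm y")
    case True
    have "(\<integral>\<^sup>+x. poisson_nn s r y x \<partial>lborel)
      \<le> (\<integral>\<^sup>+x. ennreal (c * (norm y - r) powr (- s)) * (ennreal ((r - norm x) powr s * norm (x - y) powr (- ?n)) * indicator (ball 0 r) x) \<partial>lborel)"
    proof (rule nn_integral_mono)
      fix x :: "real^'n"
      have "ennreal c * ennreal ((r - norm x) powr s * (norm y - r) powr (- s) * norm (x - y) powr (- ?n))
        = ennreal (c * (norm y - r) powr (- s)) * ennreal ((r - norm x) powr s * norm (x - y) powr (- ?n))"
        using c by (simp add: ennreal_mult[symmetric] mult_ac)
      then show "poisson_nn s r y x \<le> ennreal (c * (norm y - r) powr (- s)) * (ennreal ((r - norm x) powr s * norm (x - y) powr (- ?n)) * indicator (ball 0 r) x)"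
        using poisson_nn_le[OF r s, of y x] True by (simp add: c_def[symmetric] mult.assoc[symmetric])
    qed
    also have "\<dots> = ennreal (c * (norm y - r) powr (- s)) * (\<integral>\<^sup>+x. ennreal ((r - norm x) powr s * norm (x - y) powr (- ?n)) * indicator (ball 0 r) x \<partial>lborel)"
      by (rule nn_integral_cmult) measurable
    also have "\<dots> \<le> ennreal (c * (norm y - r) powr (- s)) * ennreal C2"
      by (intro mult_left_mono C2(2) True) simp
    also have "\<dots> = ennreal (c * C2) * ennreal ((norm y - r) powr (- s))"
      using c C2(1) by (simp add: ennreal_mult mult_ac)
    finally show ?thesis using True by (simp add: sphere_weight_def)
  next
    case False
    then have "poisson_nn s r y x = 0" for x by (simp add: poisson_nn_def)
    then show ?thesis by simp
  qed
  have cs: "(\<integral>\<^sup>+y. poisson_nn s r y x * ennreal \<bar>w y\<bar> \<partial>lborel)\<^sup>2 \<le> ennreal (c * C1) * (\<integral>\<^sup>+y. poisson_nn s r y x * ennreal ((w y)\<^sup>2) \<partial>lborel)"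
    if [measurable]: "w \<in> borel_measurable borel" for w and x :: "real^'n"
  proof -
    \<comment> \<open>A square root of the kernel. Cauchy-Schwarz pairs one root with the other root
      times \<open>w\<close>, so that the full kernel reappears in both integrals.\<close>
    define p where "p y = ennreal (sqrt (poisson_kernel s r y x)) * indicator {y. r < norm y} y * indicator (ball 0 r) x" for y
    have [measurable]: "p \<in> borel_measurable borel" unfolding p_def by measurable
    have pp: "p y * p y = poisson_nn s r y x" for y
    proof (cases "r < norm y \<and> norm x < r")
      case True
      then have "0 \<le> poisson_kernel s r y x" using poisson_kernel_bounds(1)[OF r s] by blast
      then show ?thesis using True by (simp add: p_def poisson_nn_def ennreal_mult[symmetric])
    next
      case False
      then show ?thesis by (auto simp: p_def poisson_nn_def split: split_indicator)
    qed
    have "(\<integral>\<^sup>+y. poisson_nn s r y x * ennreal \<bar>w y\<bar> \<partial>lborel)\<^sup>2 = (\<integral>\<^sup>+y. p y * (p y * ennreal \<bar>w y\<bar>) \<partial>lborel)\<^sup>2"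
      by (simp only: mult.assoc[symmetric] pp)
    also have "\<dots> \<le> (\<integral>\<^sup>+y. (p y)\<^sup>2 \<partial>lborel) * (\<integral>\<^sup>+y. (p y * ennreal \<bar>w y\<bar>)\<^sup>2 \<partial>lborel)"
      by (rule Cauchy_Schwarz_nn_integral) measurable
    also have "(\<lambda>y. (p y)\<^sup>2) = (\<lambda>y. poisson_nn s r y x)" by (simp add: power2_eq_square pp)
    also have "(\<lambda>y. (p y * ennreal \<bar>w y\<bar>)\<^sup>2) = (\<lambda>y. poisson_nn s r y x * ennreal ((w y)\<^sup>2))"
    proof
      fix y
      have "(ennreal \<bar>w y\<bar>)\<^sup>2 = ennreal ((w y)\<^sup>2)" by (simp add: ennreal_power)
      then show "(p y * ennreal \<bar>w y\<bar>)\<^sup>2 = poisson_nn s r y x * ennreal ((w y)\<^sup>2)"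
        by (simp add: power_mult_distrib power2_eq_square[of "p y"] pp)
    qed
    also have "(\<integral>\<^sup>+y. poisson_nn s r y x \<partial>lborel) * (\<integral>\<^sup>+y. poisson_nn s r y x * ennreal ((w y)\<^sup>2) \<partial>lborel)
      \<le> ennreal (c * C1) * (\<integral>\<^sup>+y. poisson_nn s r y x * ennreal ((w y)\<^sup>2) \<partial>lborel)"
      by (rule mult_right_mono[OF in_y]) simp
    finally show ?thesis .
  qed
  show thesis
  proof (rule that[of "c * C1 * (c * C2)"])
    show "0 \<le> c * C1 * (c * C2)" using c C1(1) C2(1) by simp
  next
    fix w :: "real^'n \<Rightarrow> real" assume w[measurable]: "w \<in> borel_measurable borel"
    have "(\<integral>\<^sup>+x. (\<integral>\<^sup>+y. poisson_nn s r y x * ennreal \<bar>w y\<bar> \<partial>lborel)\<^sup>2 \<partial>lborel)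
      \<le> (\<integral>\<^sup>+x. ennreal (c * C1) * (\<integral>\<^sup>+y. poisson_nn s r y x * ennreal ((w y)\<^sup>2) \<partial>lborel) \<partial>lborel)"
      by (intro nn_integral_mono cs w)
    also have "\<dots> = ennreal (c * C1) * (\<integral>\<^sup>+x. \<integral>\<^sup>+y. poisson_nn s r y x * ennreal ((w y)\<^sup>2) \<partial>lborel \<partial>lborel)"
      by (rule nn_integral_cmult) measurable
    also have "(\<integral>\<^sup>+x. \<integral>\<^sup>+y. poisson_nn s r y x * ennreal ((w y)\<^sup>2) \<partial>lborel \<partial>lborel)
      = (\<integral>\<^sup>+y. \<integral>\<^sup>+x. poisson_nn s r y x * ennreal ((w y)\<^sup>2) \<partial>lborel \<partial>lborel)"
      by (rule lborel_pair.Fubini') measurable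
    also have "\<dots> = (\<integral>\<^sup>+y. (\<integral>\<^sup>+x. poisson_nn s r y x \<partial>lborel) * ennreal ((w y)\<^sup>2) \<partial>lborel)"
      by (intro nn_integral_cong nn_integral_multc) measurable
    also have "\<dots> \<le> (\<integral>\<^sup>+y. (ennreal (c * C2) * sphere_weight r s y) * ennreal ((w y)\<^sup>2) \<partial>lborel)"
      by (intro nn_integral_mono mult_right_mono in_x) simp
    also have "\<dots> = (\<integral>\<^sup>+y. ennreal (c * C2) * (ennreal ((w y)\<^sup>2) * sphere_weight r s y) \<partial>lborel)"
      by (simp only: mult_ac)
    also have "\<dots> = ennreal (c * C2) * (\<integral>\<^sup>+y. ennreal ((w y)\<^sup>2) * sphere_weight r s y \<partial>lborel)"
      by (rule nn_integral_cmult) measurable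
    finally have "(\<integral>\<^sup>+x. (\<integral>\<^sup>+y. poisson_nn s r y x * ennreal \<bar>w y\<bar> \<partial>lborel)\<^sup>2 \<partial>lborel)
      \<le> ennreal (c * C1) * (ennreal (c * C2) * (\<integral>\<^sup>+y. ennreal ((w y)\<^sup>2) * sphere_weight r s y \<partial>lborel))"
      by (simp add: mult_left_mono)
    also have "\<dots> = ennreal (c * C1 * (c * C2)) * (\<integral>\<^sup>+y. ennreal ((w y)\<^sup>2) * sphere_weight r s y \<partial>lborel)"
      unfolding mult.assoc[symmetric] using ennreal_mult[of "c * C1" "c * C2"] c C1(1) C2(1) by (simp add: mult.assoc)
    finally show "(\<integral>\<^sup>+x. (\<integral>\<^sup>+y. poisson_nn s r y x * ennreal \<bar>w y\<bar> \<partial>lborel)\<^sup>2 \<partial>lborel)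
      \<le> ennreal (c * C1 * (c * C2)) * (\<integral>\<^sup>+y. ennreal ((w y)\<^sup>2) * sphere_weight r s y \<partial>lborel)" .
  next
    fix w :: "real^'n \<Rightarrow> real" and x :: "real^'n" assume w[measurable]: "w \<in> borel_measurable borel"
      and fin: "(\<integral>\<^sup>+y. ennreal ((w y)\<^sup>2) * sphere_weight r s y \<partial>lborel) < \<infinity>"
    \<comment> \<open>For fixed \<open>x\<close> the kernel is at most a multiple of the weight,
      because \<open>norm (x - y) \<ge> r - norm x\<close>. The multiple depends on
      \<open>x\<close>, which does not matter for finiteness.\<close>
    define k where "k = c * ((r - norm x) powr s * (r - norm x) powr (- ?n))"
    have "(\<integral>\<^sup>+y. poisson_nn s r y x * ennreal ((w y)\<^sup>2) \<partial>lborel)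
      \<le> (\<integral>\<^sup>+y. ennreal k * (ennreal ((w y)\<^sup>2) * sphere_weight r s y) \<partial>lborel)"
    proof (rule nn_integral_mono)
      fix y
      have "poisson_nn s r y x \<le> ennreal k * sphere_weight r s y"
      proof (cases "r < norm y \<and> norm x < r")
        case True
        have le: "r - norm x \<le> norm (x - y)" using norm_triangle_ineq2[of y x] True by (simp add: norm_minus_commute)
        have "norm (x - y) powr (- ?n) \<le> (r - norm x) powr (- ?n)" using le True by (intro powr_mono2') auto
        then have "c * ((r - norm x) powr s * (norm y - r) powr (- s) * norm (x - y) powr (- ?n))
          \<le> c * ((r - norm x) powr s * (norm y - r) powr (- s) * (r - norm x) powr (- ?n))"
          using c by (intro mult_left_mono) auto
        also have "\<dots> = k * (norm y - r) powr (- s)" by (simp add: k_def)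
        finally have "ennreal c * ennreal ((r - norm x) powr s * (norm y - r) powr (- s) * norm (x - y) powr (- ?n)) \<le> ennreal k * ennreal ((norm y - r) powr (- s))"
          using c by (simp add: ennreal_mult[symmetric] ennreal_leI k_def)
        then show ?thesis using order_trans[OF poisson_nn_le[OF r s, of y x]] True by (simp add: c_def[symmetric] sphere_weight_def)
      next
        case False
        then show ?thesis by (auto simp: poisson_nn_def split: split_indicator)
      qed
      then have "poisson_nn s r y x * ennreal ((w y)\<^sup>2) \<le> (ennreal k * sphere_weight r s y) * ennreal ((w y)\<^sup>2)"
        by (rule mult_right_mono) simp
      then show "poisson_nn s r y x * ennreal ((w y)\<^sup>2) \<le> ennreal k * (ennreal ((w y)\<^sup>2) * sphere_weight r s y)"
        by (simp only: mult_ac)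
    qed
    also have "\<dots> = ennreal k * (\<integral>\<^sup>+y. ennreal ((w y)\<^sup>2) * sphere_weight r s y \<partial>lborel)"
      by (rule nn_integral_cmult) measurable
    also have "\<dots> < \<infinity>" using fin by (simp add: ennreal_mult_less_top)
    finally have "ennreal (c * C1) * (\<integral>\<^sup>+y. poisson_nn s r y x * ennreal ((w y)\<^sup>2) \<partial>lborel) < \<infinity>"
      by (simp add: ennreal_mult_less_top)
    with cs[OF w, of x] have "(\<integral>\<^sup>+y. poisson_nn s r y x * ennreal \<bar>w y\<bar> \<partial>lborel)\<^sup>2 < \<infinity>"
      by (rule order_le_less_trans)
    then show "(\<integral>\<^sup>+y. poisson_nn s r y x * ennreal \<bar>w y\<bar> \<partial>lborel) < \<infinity>"
      by (auto simp: power2_eq_square ennreal_mult_less_top)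
  qed
qed

section \<open>The Poisson operator on the Sobolev space of the exterior\<close>

locale exterior_problem =
  fixes r s :: real and E :: "(real^'n::finite) set" and m :: nat
  assumes r: "r > 0" and s: "0 < s" "s < 1" and m: "m \<ge> 1" and E: "E = - ball 0 r"
begin

lemma interior_E: "interior E = {y. r < norm y}"
  using r by (auto simp: E interior_complement)

lemma E_sphere: "y \<in> E \<longleftrightarrow> r < norm y \<or> norm y = r"
  by (auto simp: E not_less)

end

sublocale exterior_problem \<subseteq> sobolev_domain E
proof
  show bE: "E \<in> sets borel" by (simp add: E)
  have "sphere (0 :: real^'n) r \<in> null_sets lborel"
    using negligible_sphere[of "0 :: real^'n" r] by (simp add: negligible_iff_null_sets null_sets_completion_iff)
  then have "AE x in lborel. x \<notin> sphere (0 :: real^'n) r" by (rule AE_not_in)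
  then show "AE x in lebesgue_on E. x \<in> interior E"
    unfolding AE_lebesgue_on_iff[OF bE] interior_E by eventually_elim (auto simp: E_sphere)
qed

context exterior_problem begin

abbreviation N :: "(real^'n \<Rightarrow> real) \<Rightarrow> real" where "N \<equiv> sob.nrm m"

lemma nn_integral_representative_le:
  assumes h: "h \<in> H m" and \<beta>: "deg \<beta> \<le> m"
    and w: "w \<in> borel_measurable borel" "\<And>x. x \<notin> E \<Longrightarrow> w x = 0" "AE x in lebesgue_on E. D \<beta> h x = w x"
  shows "(\<integral>\<^sup>+y. ennreal ((w y)\<^sup>2) \<partial>lborel) \<le> ennreal ((N h)\<^sup>2)"
proof -
  have "(\<integral>\<^sup>+y. ennreal ((w y)\<^sup>2) \<partial>lborel) = (\<integral>\<^sup>+y. ennreal ((w y)\<^sup>2) * indicator E y \<partial>lborel)"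
    using w(2) by (intro nn_integral_cong) (auto split: split_indicator)
  also have "\<dots> = (\<integral>\<^sup>+y. ennreal ((w y)\<^sup>2) \<partial>lebesgue_on E)"
    by (rule nn_integral_lebesgue_on[OF borel, symmetric])
  also have "\<dots> = (\<integral>\<^sup>+y. ennreal ((D \<beta> h y)\<^sup>2) \<partial>lebesgue_on E)"
    by (rule nn_integral_cong_AE) (use w(3) in \<open>auto elim!: eventually_mono\<close>)
  also have "\<dots> = ennreal ((L2.nrm (lebesgue_on E) (D \<beta> h))\<^sup>2)" by (rule nn_L2_nrm[OF D_L[OF h \<beta>]])
  also have "\<dots> \<le> ennreal ((N h)\<^sup>2)"
    by (intro ennreal_leI power_mono D_le_nrm[OF h \<beta>] L2.nrm_nonneg[OF D_L[OF h \<beta>]])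
  finally show ?thesis .
qed

text \<open>The zero extensions need not form a weak gradient across the sphere, since
  \<open>w\<close> may jump there. This is why \<open>weak_gradient\<close> only admits test
  functions supported outside the closed ball.\<close>

lemma sobolev_representative:
  assumes h: "h \<in> H m"
  obtains w g where "weak_gradient r w g" "\<And>x. x \<notin> E \<Longrightarrow> w x = 0" "AE x in lebesgue_on E. h x = w x"
    "(\<integral>\<^sup>+y. ennreal ((w y)\<^sup>2) \<partial>lborel) \<le> ennreal ((N h)\<^sup>2)"
    "\<And>i. (\<integral>\<^sup>+y. ennreal ((g i y)\<^sup>2) \<partial>lborel) \<le> ennreal ((N h)\<^sup>2)"
proof -
  let ?e = "\<lambda>i j. if j = i then 1 else (0::nat)"
  have deg: "deg (?e i) = 1" for i :: 'n by simp
  have dm: "deg (?e i) \<le> m" for i :: 'n using m by simp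
  have hL: "h \<in> L" by (rule sobolev_L[OF h])
  obtain w where w: "w \<in> borel_measurable borel" "\<And>x. x \<notin> E \<Longrightarrow> w x = 0"
    "AE x in lebesgue_on E. h x = w x" "w \<in> square_integrable lborel"
    using borel_representative_L2[OF borel hL] by blast
  have "\<exists>g. g \<in> borel_measurable borel \<and> (\<forall>x. x \<notin> E \<longrightarrow> g x = 0) \<and> (AE x in lebesgue_on E. D (?e i) h x = g x)
      \<and> g \<in> square_integrable lborel" for i
    using borel_representative_L2[OF borel D_L[OF h dm[of i]]] by blast
  then have "\<forall>i. \<exists>g. g \<in> borel_measurable borel \<and> (\<forall>x. x \<notin> E \<longrightarrow> g x = 0) \<and> (AE x in lebesgue_on E. D (?e i) h x = g x)
      \<and> g \<in> square_integrable lborel" by blast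
  from choice[OF this] obtain g where g: "\<And>i. g i \<in> borel_measurable borel" "\<And>i x. x \<notin> E \<Longrightarrow> g i x = 0"
    "\<And>i. AE x in lebesgue_on E. D (?e i) h x = g i x" "\<And>i. g i \<in> square_integrable lborel" by blast
  have "weak_gradient r w g"
  proof
    fix \<phi> :: "real^'n \<Rightarrow> real" and i a b
    assume \<phi>: "flat_alg \<phi>" "\<And>x. x \<notin> cbox a b \<Longrightarrow> \<phi> x = 0" "cbox a b \<subseteq> {y. r < norm y}"
    have t: "test_function E \<phi>" by (rule flat_alg_test_function[OF \<phi>(1,2)]) (use \<phi>(3) interior_E in auto)
    have "ip h (multi_deriv (?e i) \<phi>) = (-1) ^ deg (?e i) * ip (D (?e i) h) \<phi>"
      using D_weak[OF h dm[of i]] t unfolding weak_deriv_iff by blast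
    then have "ip h (partial_deriv i \<phi>) = - ip (D (?e i) h) \<phi>" unfolding multi_deriv_single deg by simp
    moreover have "ip h (partial_deriv i \<phi>) = (LINT y|lborel. w y * partial_deriv i \<phi> y)"
      using hL flat_alg_borel[OF flat_alg_partial(1)[OF \<phi>(1)]]
      by (intro integral_lebesgue_on_representative[OF borel _ w(1-3)]) (auto simp: square_integrable_def)
    moreover have "ip (D (?e i) h) \<phi> = (LINT y|lborel. g i y * \<phi> y)"
      using D_L[OF h dm[of i]] flat_alg_borel[OF \<phi>(1)]
      by (intro integral_lebesgue_on_representative[OF borel _ g(1-3)]) (auto simp: square_integrable_def)
    ultimately show "(LINT y|lborel. w y * partial_deriv i \<phi> y) = - (LINT y|lborel. g i y * \<phi> y)" by simp
  qed (use r w g in auto)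
  moreover have "AE x in lebesgue_on E. D (\<lambda>i. 0) h x = w x"
    using D_zero[OF h] w(3) by eventually_elim simp
  then have "(\<integral>\<^sup>+y. ennreal ((w y)\<^sup>2) \<partial>lborel) \<le> ennreal ((N h)\<^sup>2)"
    by (intro nn_integral_representative_le[OF h _ w(1,2)]) auto
  moreover have "(\<integral>\<^sup>+y. ennreal ((g i y)\<^sup>2) \<partial>lborel) \<le> ennreal ((N h)\<^sup>2)" for i
    by (rule nn_integral_representative_le[OF h dm[of i] g(1,2,3)])
  ultimately show thesis using that w(2,3) by blast
qed

lemma Hardy:
  obtains C where "C \<ge> 0" "\<And>h. h \<in> H m \<Longrightarrow> \<exists>w. w \<in> borel_measurable borel \<and>
    (\<forall>x. x \<notin> E \<longrightarrow> w x = 0) \<and> (AE x in lebesgue_on E. h x = w x) \<and>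
    (\<integral>\<^sup>+y. ennreal ((w y)\<^sup>2) * sphere_weight r s y \<partial>lborel) \<le> ennreal (C * (N h)\<^sup>2)"
proof -
  define c where "c = (12 + 648 * r\<^sup>2) * (r powr (- s) / (1 - s))"
  have c: "c \<ge> 0" using r s by (simp add: c_def)
  \<comment> \<open>The factor \<open>1 + n\<close>, with n the dimension, counts the function and
    its first derivatives, each bounded by \<open>N h\<close>; \<open>r powr (- s)\<close> bounds
    the weight where \<open>norm y \<ge> 2 * r\<close>.\<close>
  define C where "C = c * (1 + real CARD('n)) + r powr (- s)"
  have C: "C \<ge> 0" using c by (simp add: C_def)
  show thesis
  proof (rule that[of C])
    fix h assume h: "h \<in> H m"
    obtain w g where wg: "weak_gradient r w g" "\<And>x. x \<notin> E \<Longrightarrow> w x = 0" "AE x in lebesgue_on E. h x = w x"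
      and wN: "(\<integral>\<^sup>+y. ennreal ((w y)\<^sup>2) \<partial>lborel) \<le> ennreal ((N h)\<^sup>2)"
      and gN: "\<And>i. (\<integral>\<^sup>+y. ennreal ((g i y)\<^sup>2) \<partial>lborel) \<le> ennreal ((N h)\<^sup>2)"
      using sobolev_representative[OF h] by blast
    interpret wg: weak_gradient r w g by (rule wg(1))
    define W where "W y = ennreal ((norm y - r) powr (- s)) * indicator {y :: real^'n. r < norm y \<and> norm y < 2 * r} y" for y
    have [measurable]: "W \<in> borel_measurable borel" unfolding W_def by measurable
    have sw: "sphere_weight r s y \<le> W y + ennreal (r powr (- s))" for y
    proof (cases "norm y < 2 * r")
      case True
      then show ?thesis by (auto simp: sphere_weight_def W_def split: split_indicator)
    next
      case False
      then have "(norm y - r) powr (- s) \<le> r powr (- s)" using r s by (intro powr_mono2') auto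
      then show ?thesis using False by (auto simp: sphere_weight_def W_def ennreal_leI split: split_indicator)
    qed
    have sN: "(\<Sum>i\<in>UNIV. \<integral>\<^sup>+y. ennreal ((g i y)\<^sup>2) \<partial>lborel) \<le> ennreal (real CARD('n) * (N h)\<^sup>2)"
    proof -
      have "(\<Sum>i\<in>UNIV. \<integral>\<^sup>+y. ennreal ((g i y)\<^sup>2) \<partial>lborel) \<le> (\<Sum>i\<in>(UNIV :: 'n set). ennreal ((N h)\<^sup>2))"
        by (rule sum_mono) (rule gN)
      also have "\<dots> = ennreal (\<Sum>i\<in>(UNIV :: 'n set). (N h)\<^sup>2)" by (rule sum_ennreal) simp
      finally show ?thesis by simp
    qed
    have "(\<integral>\<^sup>+y. ennreal ((w y)\<^sup>2) * W y \<partial>lborel) \<le> ennreal (12 + 648 * r\<^sup>2) * (ennreal (r powr (- s) / (1 - s)) *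
      ((\<integral>\<^sup>+y. ennreal ((w y)\<^sup>2) \<partial>lborel) + (\<Sum>i\<in>UNIV. \<integral>\<^sup>+y. ennreal ((g i y)\<^sup>2) \<partial>lborel)))"
      unfolding W_def by (rule wg.Hardy_near_sphere[OF s(2)])
    also have "\<dots> \<le> ennreal (12 + 648 * r\<^sup>2) * (ennreal (r powr (- s) / (1 - s)) * (ennreal ((N h)\<^sup>2) + ennreal (real CARD('n) * (N h)\<^sup>2)))"
      by (intro mult_left_mono add_mono wN sN) auto
    also have "\<dots> = ennreal (c * (1 + real CARD('n)) * (N h)\<^sup>2)"
    proof -
      have "ennreal ((N h)\<^sup>2) + ennreal (real CARD('n) * (N h)\<^sup>2) = ennreal ((1 + real CARD('n)) * (N h)\<^sup>2)"
        by (subst ennreal_plus[symmetric]) (auto simp: distrib_right)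
      moreover have "ennreal (12 + 648 * r\<^sup>2) * (ennreal (r powr (- s) / (1 - s)) * ennreal ((1 + real CARD('n)) * (N h)\<^sup>2))
        = ennreal ((12 + 648 * r\<^sup>2) * (r powr (- s) / (1 - s) * ((1 + real CARD('n)) * (N h)\<^sup>2)))"
        using s by (subst ennreal_mult[symmetric], simp, simp)+ simp
      ultimately show ?thesis by (simp only: c_def mult.assoc)
    qed
    finally have 1: "(\<integral>\<^sup>+y. ennreal ((w y)\<^sup>2) * W y \<partial>lborel) \<le> ennreal (c * (1 + real CARD('n)) * (N h)\<^sup>2)" .
    have "(\<integral>\<^sup>+y. ennreal ((w y)\<^sup>2) * sphere_weight r s y \<partial>lborel) \<le> (\<integral>\<^sup>+y. ennreal ((w y)\<^sup>2) * W y + ennreal (r powr (- s)) * ennreal ((w y)\<^sup>2) \<partial>lborel)"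
    proof (rule nn_integral_mono)
      fix y
      have "ennreal ((w y)\<^sup>2) * sphere_weight r s y \<le> ennreal ((w y)\<^sup>2) * (W y + ennreal (r powr (- s)))"
        by (rule mult_left_mono[OF sw]) simp
      then show "ennreal ((w y)\<^sup>2) * sphere_weight r s y \<le> ennreal ((w y)\<^sup>2) * W y + ennreal (r powr (- s)) * ennreal ((w y)\<^sup>2)"
        by (simp only: distrib_left mult.commute[of "ennreal (r powr (- s))"])
    qed
    also have "\<dots> = (\<integral>\<^sup>+y. ennreal ((w y)\<^sup>2) * W y \<partial>lborel) + ennreal (r powr (- s)) * (\<integral>\<^sup>+y. ennreal ((w y)\<^sup>2) \<partial>lborel)"
      by (simp add: nn_integral_add nn_integral_cmult)
    also have "\<dots> \<le> ennreal (c * (1 + real CARD('n)) * (N h)\<^sup>2) + ennreal (r powr (- s)) * ennreal ((N h)\<^sup>2)"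
      by (intro add_mono mult_left_mono 1 wN) auto
    also have "\<dots> = ennreal (C * (N h)\<^sup>2)"
      using c by (simp add: C_def ennreal_mult[symmetric] ennreal_plus[symmetric] distrib_right del: ennreal_plus)
    finally have "(\<integral>\<^sup>+y. ennreal ((w y)\<^sup>2) * sphere_weight r s y \<partial>lborel) \<le> ennreal (C * (N h)\<^sup>2)" .
    then show "\<exists>w. w \<in> borel_measurable borel \<and>
      (\<forall>x. x \<notin> E \<longrightarrow> w x = 0) \<and> (AE x in lebesgue_on E. h x = w x) \<and>
      (\<integral>\<^sup>+y. ennreal ((w y)\<^sup>2) * sphere_weight r s y \<partial>lborel) \<le> ennreal (C * (N h)\<^sup>2)"
      using wg(2,3) wg.meas(1) by blast
  qed (rule C)
qed

text \<open>The kernel vanishes on the sphere because of the convention \<open>x / 0 = 0\<close>.\<close>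

lemma poisson_nn_norm:
  assumes x: "x \<in> ball 0 r"
  shows "ennreal (norm (indicator E y * (w y * poisson_kernel s r y x))) = poisson_nn s r y x * ennreal \<bar>w y\<bar>"
proof (cases "r < norm y")
  case True
  then have "0 \<le> poisson_kernel s r y x" using poisson_kernel_bounds(1)[OF r s _ True, of x] x by simp
  then show ?thesis using True x by (simp add: poisson_nn_def E_sphere abs_mult ennreal_mult mult.commute)
next
  case False
  then show ?thesis using poisson_kernel_sphere[OF s(1), of y r x] by (cases "norm y = r") (auto simp: poisson_nn_def E_sphere)
qed

text \<open>\<open>poisson_op\<close> integrates a Lebesgue measurable function over
  \<open>E\<close>. The Borel form is the one whose joint measurability in \<open>x\<close> and
  \<open>y\<close> is known, and the finite weighted norm guarantees that the integral
  converges.\<close>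

lemma poisson_representative:
  assumes h: "h \<in> borel_measurable (lebesgue_on E)"
    and w: "w \<in> borel_measurable borel" "\<And>x. x \<notin> E \<Longrightarrow> w x = 0" "AE x in lebesgue_on E. h x = w x"
    and fin: "(\<integral>\<^sup>+y. ennreal ((w y)\<^sup>2) * sphere_weight r s y \<partial>lborel) < \<infinity>"
    and x: "x \<in> ball 0 r"
  shows "integrable lborel (\<lambda>y. w y * poisson_kernel s r y x)"
    "integrable (lebesgue_on E) (\<lambda>y. poisson_kernel s r y x * h y)"
    "poisson_op s r h x = (LINT y|lborel. w y * poisson_kernel s r y x)"
proof -
  note w(1)[measurable]
  have km: "(\<lambda>y. poisson_kernel s r y x) \<in> borel_measurable borel" by measurable
  have iE: "indicator E y * (w y * poisson_kernel s r y x) = w y * poisson_kernel s r y x" for y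
    using w(2)[of y] by (cases "y \<in> E") auto
  have "(\<integral>\<^sup>+y. ennreal (norm (w y * poisson_kernel s r y x)) \<partial>lborel) < \<infinity>"
  proof (rule poisson_nn_L2_bound[OF r s, where 'n = 'n])
    fix C assume "\<And>w (x :: real^'n). w \<in> borel_measurable borel \<Longrightarrow>
      (\<integral>\<^sup>+y. ennreal ((w y)\<^sup>2) * sphere_weight r s y \<partial>lborel) < \<infinity> \<Longrightarrow>
      (\<integral>\<^sup>+y. poisson_nn s r y x * ennreal \<bar>w y\<bar> \<partial>lborel) < \<infinity>"
    from this[OF w(1) fin, of x] show ?thesis unfolding poisson_nn_norm[OF x, of _ w, unfolded iE] .
  qed
  then show int: "integrable lborel (\<lambda>y. w y * poisson_kernel s r y x)" by (intro integrableI_bounded) auto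
  have "integrable (lebesgue_on E) (\<lambda>y. w y * poisson_kernel s r y x)"
    using int integrable_lebesgue_on_borel[OF borel, of "\<lambda>y. w y * poisson_kernel s r y x"] by (simp add: iE)
  moreover have "AE y in lebesgue_on E. w y * poisson_kernel s r y x = poisson_kernel s r y x * h y"
    using w(3) by eventually_elim simp
  moreover have hm: "(\<lambda>y. poisson_kernel s r y x * h y) \<in> borel_measurable (lebesgue_on E)"
    using h borel_measurable_lebesgue_on[OF km, of E] by (rule borel_measurable_times[rotated])
  ultimately show "integrable (lebesgue_on E) (\<lambda>y. poisson_kernel s r y x * h y)"
    using borel_measurable_integrable by (blast intro: integrable_cong_AE_imp)
  show "poisson_op s r h x = (LINT y|lborel. w y * poisson_kernel s r y x)"
    using integral_lebesgue_on_representative[OF borel h w km] unfolding poisson_op_def E by (simp add: mult.commute)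
qed

lemma sobolev_measurable: "h \<in> H m \<Longrightarrow> h \<in> borel_measurable (lebesgue_on E)"
  using sobolev_L by (simp add: square_integrable_def)

lemma sobolev_weighted_representative:
  assumes h: "h \<in> H m"
  obtains w where "w \<in> borel_measurable borel" "\<And>x. x \<notin> E \<Longrightarrow> w x = 0" "AE x in lebesgue_on E. h x = w x"
    "(\<integral>\<^sup>+y. ennreal ((w y)\<^sup>2) * sphere_weight r s y \<partial>lborel) < \<infinity>"
proof (rule Hardy)
  fix C assume "\<And>h. h \<in> H m \<Longrightarrow> \<exists>w. w \<in> borel_measurable borel \<and>
    (\<forall>x. x \<notin> E \<longrightarrow> w x = 0) \<and> (AE x in lebesgue_on E. h x = w x) \<and>
    (\<integral>\<^sup>+y. ennreal ((w y)\<^sup>2) * sphere_weight r s y \<partial>lborel) \<le> ennreal (C * (N h)\<^sup>2)"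
  from this[OF h] obtain w where w: "w \<in> borel_measurable borel" "\<And>x. x \<notin> E \<Longrightarrow> w x = 0"
    "AE x in lebesgue_on E. h x = w x"
    "(\<integral>\<^sup>+y. ennreal ((w y)\<^sup>2) * sphere_weight r s y \<partial>lborel) \<le> ennreal (C * (N h)\<^sup>2)" by blast
  show thesis by (rule that[OF w(1-3) order_le_less_trans[OF w(4)]]) simp_all
qed

lemma poisson_integrable:
  assumes "h \<in> H m" "x \<in> ball 0 r"
  shows "integrable (lebesgue_on E) (\<lambda>y. poisson_kernel s r y x * h y)"
  using sobolev_weighted_representative[OF assms(1)] poisson_representative(2)[OF sobolev_measurable[OF assms(1)] _ _ _ _ assms(2)] by blast

lemma poisson_lin:
  assumes "h \<in> H m" "k \<in> H m" "x \<in> ball 0 r"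
  shows "poisson_op s r (\<lambda>x. a * h x + b * k x) x = a * poisson_op s r h x + b * poisson_op s r k x"
proof -
  have "poisson_op s r (\<lambda>x. a * h x + b * k x) x
      = (LINT y|lebesgue_on E. a * (poisson_kernel s r y x * h y) + b * (poisson_kernel s r y x * k y))"
    unfolding poisson_op_def E by (simp add: algebra_simps)
  also have "\<dots> = a * poisson_op s r h x + b * poisson_op s r k x"
    using poisson_integrable[OF assms(1,3)] poisson_integrable[OF assms(2,3)] unfolding poisson_op_def E[symmetric] by simp
  finally show ?thesis .
qed

lemma poisson_bounded:
  obtains C where "C \<ge> 0" "\<And>h. h \<in> H m \<Longrightarrow> poisson_op s r h \<in> square_integrable (lebesgue_on (ball 0 r))"
    "\<And>h. h \<in> H m \<Longrightarrow> L2.nrm (lebesgue_on (ball 0 r)) (poisson_op s r h) \<le> C * N h"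
proof -
  let ?B = "ball (0 :: real^'n) r"
  obtain C1 where C1: "C1 \<ge> 0" "\<And>h. h \<in> H m \<Longrightarrow> \<exists>w. w \<in> borel_measurable borel \<and>
    (\<forall>x. x \<notin> E \<longrightarrow> w x = 0) \<and> (AE x in lebesgue_on E. h x = w x) \<and>
    (\<integral>\<^sup>+y. ennreal ((w y)\<^sup>2) * sphere_weight r s y \<partial>lborel) \<le> ennreal (C1 * (N h)\<^sup>2)"
    by (rule Hardy) (rule that)
  obtain C2 where C2: "C2 \<ge> 0" "\<And>w :: real^'n \<Rightarrow> real. w \<in> borel_measurable borel \<Longrightarrow>
      (\<integral>\<^sup>+x. (\<integral>\<^sup>+y. poisson_nn s r y x * ennreal \<bar>w y\<bar> \<partial>lborel)\<^sup>2 \<partial>lborel)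
        \<le> ennreal C2 * (\<integral>\<^sup>+y. ennreal ((w y)\<^sup>2) * sphere_weight r s y \<partial>lborel)"
    by (rule poisson_nn_L2_bound[OF r s, where 'n = 'n]) (rule that)
  have main: "poisson_op s r h \<in> square_integrable (lebesgue_on ?B) \<and>
      (\<integral>\<^sup>+x. ennreal ((poisson_op s r h x)\<^sup>2) \<partial>lebesgue_on ?B) \<le> ennreal (C2 * C1 * (N h)\<^sup>2)" if h: "h \<in> H m" for h
  proof -
    obtain w where wm[measurable]: "w \<in> borel_measurable borel"
      and w: "\<And>x. x \<notin> E \<Longrightarrow> w x = 0" "AE x in lebesgue_on E. h x = w x"
      and weight: "(\<integral>\<^sup>+y. ennreal ((w y)\<^sup>2) * sphere_weight r s y \<partial>lborel) \<le> ennreal (C1 * (N h)\<^sup>2)"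
      using C1(2)[OF h] by blast
    have fin: "(\<integral>\<^sup>+y. ennreal ((w y)\<^sup>2) * sphere_weight r s y \<partial>lborel) < \<infinity>"
      using weight by (rule order_le_less_trans) simp
    have rep1: "integrable lborel (\<lambda>y. w y * poisson_kernel s r y x)" if "x \<in> ball 0 r" for x
      by (rule poisson_representative(1)[OF sobolev_measurable[OF h] wm _ w(2) fin that]) (rule w(1))
    have rep3: "poisson_op s r h x = (LINT y|lborel. w y * poisson_kernel s r y x)" if "x \<in> ball 0 r" for x
      by (rule poisson_representative(3)[OF sobolev_measurable[OF h] wm _ w(2) fin that]) (rule w(1))
    \<comment> \<open>On the ball this is the image of \<open>h\<close>. As a parameter integral of
      a jointly Borel function it is Borel, which gives the measurability of the image.\<close>
    define u where "u x = (LINT y|lborel. w y * poisson_kernel s r y x)" for x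
    have "(\<lambda>(x, y). w y * poisson_kernel s r y x) \<in> borel_measurable (borel \<Otimes>\<^sub>M lborel)" by measurable
    then have um: "u \<in> borel_measurable borel" unfolding u_def[abs_def] by (rule lborel.borel_measurable_lebesgue_integral)
    have um': "u \<in> borel_measurable (lebesgue_on ?B)" by (rule borel_measurable_lebesgue_on[OF um])
    have pm: "poisson_op s r h \<in> borel_measurable (lebesgue_on ?B)"
    proof (rule measurable_cong[THEN iffD2, OF _ um'])
      show "poisson_op s r h x = u x" if "x \<in> space (lebesgue_on ?B)" for x using that rep3 by (simp add: u_def)
    qed
    have "(\<integral>\<^sup>+x. ennreal ((poisson_op s r h x)\<^sup>2) \<partial>lebesgue_on ?B) = (\<integral>\<^sup>+x. ennreal ((poisson_op s r h x)\<^sup>2) * indicator ?B x \<partial>lborel)"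
      by (rule nn_integral_lebesgue_on) measurable
    also have "\<dots> \<le> (\<integral>\<^sup>+x. (\<integral>\<^sup>+y. poisson_nn s r y x * ennreal \<bar>w y\<bar> \<partial>lborel)\<^sup>2 \<partial>lborel)"
    proof (rule nn_integral_mono)
      fix x :: "real^'n"
      show "ennreal ((poisson_op s r h x)\<^sup>2) * indicator ?B x \<le> (\<integral>\<^sup>+y. poisson_nn s r y x * ennreal \<bar>w y\<bar> \<partial>lborel)\<^sup>2"
      proof (cases "x \<in> ?B")
        case True
        have iE: "indicator E y * (w y * poisson_kernel s r y x) = w y * poisson_kernel s r y x" for y
          using w(1)[of y] by (cases "y \<in> E") auto
        have "ennreal \<bar>poisson_op s r h x\<bar> \<le> (\<integral>\<^sup>+y. ennreal (norm (w y * poisson_kernel s r y x)) \<partial>lborel)"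
          unfolding rep3[OF True] using integral_norm_bound_ennreal[OF rep1[OF True]] by simp
        also have "\<dots> = (\<integral>\<^sup>+y. poisson_nn s r y x * ennreal \<bar>w y\<bar> \<partial>lborel)"
          using poisson_nn_norm[OF True, of _ w, unfolded iE] by simp
        finally have "(ennreal \<bar>poisson_op s r h x\<bar>)\<^sup>2 \<le> (\<integral>\<^sup>+y. poisson_nn s r y x * ennreal \<bar>w y\<bar> \<partial>lborel)\<^sup>2"
          by (rule power_mono) simp
        then show ?thesis using True by (simp add: ennreal_power)
      qed simp
    qed
    also have "\<dots> \<le> ennreal C2 * ennreal (C1 * (N h)\<^sup>2)"
      by (rule order_trans[OF C2(2)[OF wm] mult_left_mono[OF weight]]) simp
    also have "\<dots> = ennreal (C2 * C1 * (N h)\<^sup>2)" using C1(1) C2(1) by (simp add: ennreal_mult[symmetric] mult.assoc)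
    finally have le: "(\<integral>\<^sup>+x. ennreal ((poisson_op s r h x)\<^sup>2) \<partial>lebesgue_on ?B) \<le> ennreal (C2 * C1 * (N h)\<^sup>2)" .
    then have "(\<integral>\<^sup>+x. ennreal ((poisson_op s r h x)\<^sup>2) \<partial>lebesgue_on ?B) < \<infinity>" by (rule order_le_less_trans) simp
    then show ?thesis using le square_integrableI_nn[OF pm] by blast
  qed
  show thesis
  proof (rule that[of "sqrt (C2 * C1)"])
    show "0 \<le> sqrt (C2 * C1)" using C1(1) C2(1) by simp
    fix h assume h: "h \<in> H m"
    show sq: "poisson_op s r h \<in> square_integrable (lebesgue_on ?B)" using main[OF h] by blast
    have "ennreal ((L2.nrm (lebesgue_on ?B) (poisson_op s r h))\<^sup>2) \<le> ennreal (C2 * C1 * (N h)\<^sup>2)"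
      using main[OF h] nn_L2_nrm[OF sq] by simp
    then have "(L2.nrm (lebesgue_on ?B) (poisson_op s r h))\<^sup>2 \<le> (sqrt (C2 * C1) * N h)\<^sup>2"
      using C1(1) C2(1) by (simp add: power_mult_distrib)
    then show "L2.nrm (lebesgue_on ?B) (poisson_op s r h) \<le> sqrt (C2 * C1) * N h"
      by (rule power2_le_imp_le) (use C1(1) C2(1) sob.nrm_nonneg[OF h] in simp)
  qed
qed

end

section \<open>Injectivity\<close>

locale vanishing_potential =
  fixes r n :: real and f :: "real^'n::finite \<Rightarrow> real"
  assumes n: "n = real CARD('n)" and r: "r > 0" and fm: "f \<in> borel_measurable borel" and f0: "\<And>y. norm y \<le> r \<Longrightarrow> f y = 0"
    and fint: "integrable lborel (\<lambda>y. f y * norm y powr (- n))"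
begin

lemma fm'[measurable]: "f \<in> borel_measurable borel" by (rule fm)

text \<open>A family closed under differentiation along \<open>e\<close>: the derivative combines
  the indices \<open>(Suc k, b + 1)\<close> and \<open>(k - 1, b)\<close>. As the base is the
  squared distance, the distance itself carries the exponent \<open>- 2 * b\<close>.\<close>

definition ker :: "nat \<Rightarrow> real \<Rightarrow> real^'n \<Rightarrow> real^'n \<Rightarrow> real^'n \<Rightarrow> real" where
  "ker k b e x y = ((y - x) \<bullet> e) ^ k * ((y - x) \<bullet> (y - x)) powr (- b)"

lemma ker_measurable[measurable]: "ker k b e x \<in> borel_measurable borel"
  unfolding ker_def by measurable

definition pot :: "nat \<Rightarrow> real \<Rightarrow> real^'n \<Rightarrow> real^'n \<Rightarrow> real" where
  "pot k b e x = (LINT y|lborel. f y * ker k b e x y)"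

definition bound :: "nat \<Rightarrow> real \<Rightarrow> real^'n \<Rightarrow> real \<Rightarrow> real" where
  "bound k b e \<rho> = norm e ^ k * ((1 - \<rho> / r) powr (real k - 2 * b) * r powr (real k - 2 * b + n))"

lemma bound_nonneg: "0 \<le> bound k b e \<rho>" by (simp add: bound_def)

lemma inner_powr: "((u :: real^'n) \<bullet> u) powr (- b) = norm u powr (- 2 * b)"
proof (cases "u = 0")
  case False
  then have "(norm u)\<^sup>2 = norm u powr 2" by (simp add: powr_numeral)
  then have "((norm u)\<^sup>2) powr (- b) = norm u powr (2 * - b)" by (simp only: powr_powr)
  then show ?thesis by (simp add: power2_norm_eq_inner)
qed simp

text \<open>For \<open>y\<close> outside the ball, \<open>\<rho>\<close> is at most the fraction
  \<open>\<rho> / r\<close> of \<open>norm y\<close>, so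
  \<open>norm (y - x) \<ge> (1 - \<rho> / r) * norm y\<close>. The condition on \<open>b\<close>
  makes the surplus exponent \<open>k - 2 * b + n\<close> nonpositive, which allows
  \<open>norm y\<close> to be replaced by \<open>r\<close> in that factor.\<close>

lemma ker_bound:
  assumes x: "norm x \<le> \<rho>" "\<rho> < r" and y: "r < norm y" and b: "2 * b \<ge> n + real k"
  shows "\<bar>ker k b e x y\<bar> \<le> bound k b e \<rho> * norm y powr (- n)"
proof -
  have \<rho>0: "0 \<le> \<rho>" using x(1) norm_ge_zero[of x] by linarith
  have \<kappa>: "0 < 1 - \<rho> / r" using x r by simp
  have "(1 - \<rho> / r) * norm y \<le> norm y - \<rho>"
  proof -
    have "\<rho> \<le> (\<rho> / r) * norm y" using y r \<rho>0 by (simp add: field_simps mult_left_mono)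
    then show ?thesis by (simp add: left_diff_distrib)
  qed
  also have "\<dots> \<le> norm (y - x)" using norm_triangle_ineq2[of y x] x by linarith
  finally have low: "(1 - \<rho> / r) * norm y \<le> norm (y - x)" .
  have y0: "0 < norm y" using y r by linarith
  have pos: "0 < (1 - \<rho> / r) * norm y" using \<kappa> y0 by (rule mult_pos_pos)
  have xy: "0 < norm (y - x)" using low pos by linarith
  have "\<bar>ker k b e x y\<bar> = \<bar>(y - x) \<bullet> e\<bar> ^ k * norm (y - x) powr (- 2 * b)"
    unfolding ker_def inner_powr by (simp add: abs_mult power_abs)
  also have "\<dots> \<le> (norm (y - x) * norm e) ^ k * norm (y - x) powr (- 2 * b)"
    by (intro mult_right_mono power_mono Cauchy_Schwarz_ineq2) auto
  also have "\<dots> = norm e ^ k * norm (y - x) powr (real k - 2 * b)"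
    using xy by (simp add: power_mult_distrib powr_realpow[symmetric] powr_add[symmetric] mult_ac)
  also have "\<dots> \<le> norm e ^ k * ((1 - \<rho> / r) * norm y) powr (real k - 2 * b)"
    using low pos b by (intro mult_left_mono powr_mono2') (auto simp: n)
  also have "((1 - \<rho> / r) * norm y) powr (real k - 2 * b) = (1 - \<rho> / r) powr (real k - 2 * b) * (norm y powr (real k - 2 * b + n) * norm y powr (- n))"
    using \<kappa> y0 by (simp add: powr_mult powr_add[symmetric])
  also have "norm e ^ k * \<dots> \<le> norm e ^ k * ((1 - \<rho> / r) powr (real k - 2 * b) * (r powr (real k - 2 * b + n) * norm y powr (- n)))"
    using r y b by (intro mult_left_mono mult_right_mono powr_mono2') auto
  finally show ?thesis by (simp only: bound_def mult.assoc)
qed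

lemma dominated:
  assumes x: "norm x \<le> \<rho>" "\<rho> < r" and b: "2 * b \<ge> n + real k"
  shows "\<bar>f y * ker k b e x y\<bar> \<le> bound k b e \<rho> * \<bar>f y * norm y powr (- n)\<bar>"
proof (cases "r < norm y")
  case True
  have "\<bar>f y\<bar> * \<bar>ker k b e x y\<bar> \<le> \<bar>f y\<bar> * (bound k b e \<rho> * norm y powr (- n))"
    by (rule mult_left_mono[OF ker_bound[OF x True b]]) simp
  then show ?thesis by (simp add: abs_mult mult_ac)
next
  case False
  then show ?thesis using f0[of y] by simp
qed

lemma pot_integrable:
  assumes x: "norm x < r" and b: "2 * b \<ge> n + real k"
  shows "integrable lborel (\<lambda>y. f y * ker k b e x y)"
proof (rule Bochner_Integration.integrable_bound)
  show "integrable lborel (\<lambda>y. bound k b e (norm x) * \<bar>f y * norm y powr (- n)\<bar>)"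
    using fint by auto
  show "AE y in lborel. norm (f y * ker k b e x y) \<le> norm (bound k b e (norm x) * \<bar>f y * norm y powr (- n)\<bar>)"
    using dominated[OF order_refl x b] bound_nonneg by (auto simp: abs_mult)
qed measurable

lemma ker_derivative:
  assumes y: "y \<noteq> x + t *\<^sub>R e"
  shows "((\<lambda>t. ker k b e (x + t *\<^sub>R e) y) has_real_derivative
     (2 * b * ker (Suc k) (b + 1) e (x + t *\<^sub>R e) y - real k * (e \<bullet> e) * ker (k - 1) b e (x + t *\<^sub>R e) y)) (at t)"
proof -
  define u where "u t = (y - x) \<bullet> e - t * (e \<bullet> e)" for t
  define q where "q t = (y - x) \<bullet> (y - x) - 2 * t * ((y - x) \<bullet> e) + t\<^sup>2 * (e \<bullet> e)" for t
  have u: "(y - (x + t *\<^sub>R e)) \<bullet> e = u t" for t by (simp add: u_def inner_diff_left inner_add_left)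
  have q: "(y - (x + t *\<^sub>R e)) \<bullet> (y - (x + t *\<^sub>R e)) = q t" for t
    by (simp add: q_def inner_diff_left inner_diff_right inner_add_left inner_add_right inner_commute algebra_simps power2_eq_square)
  have qp: "q t > 0" unfolding q[symmetric] using y by simp
  have du: "(u has_real_derivative - (e \<bullet> e)) (at t)" unfolding u_def[abs_def] by (auto intro!: derivative_eq_intros)
  have dq: "(q has_real_derivative - 2 * u t) (at t)"
    unfolding q_def[abs_def] u_def by (auto intro!: derivative_eq_intros simp: algebra_simps)
  have "((\<lambda>t. u t ^ k) has_real_derivative real k * u t ^ (k - 1) * - (e \<bullet> e)) (at t)"
    using DERIV_power[OF du, of k] by (simp add: mult_ac)
  moreover have "((\<lambda>t. q t powr (- b)) has_real_derivative (- b) * q t powr (- b - 1) * (- 2 * u t)) (at t)"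
    using DERIV_fun_powr[OF dq qp, of "- b"] by simp
  ultimately have "((\<lambda>t. u t ^ k * q t powr (- b)) has_real_derivative
      (real k * u t ^ (k - 1) * - (e \<bullet> e)) * q t powr (- b) + ((- b) * q t powr (- b - 1) * (- 2 * u t)) * u t ^ k) (at t)"
    by (rule DERIV_mult)
  moreover have "(real k * u t ^ (k - 1) * - (e \<bullet> e)) * q t powr (- b) + ((- b) * q t powr (- b - 1) * (- 2 * u t)) * u t ^ k
    = 2 * b * (u t ^ Suc k * q t powr (- (b + 1))) - real k * (e \<bullet> e) * (u t ^ (k - 1) * q t powr (- b))"
  proof -
    have e: "- b - 1 = - (b + 1)" by simp
    show ?thesis unfolding e by (simp add: algebra_simps)
  qed
  ultimately show ?thesis unfolding ker_def u q by (simp only:)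
qed

text \<open>The potential vanishes throughout the ball, hence so does its derivative along
  \<open>e\<close>; differentiating the kernel produces the two terms. For \<open>k = 0\<close> the
  truncated \<open>k - 1\<close> is harmless because its coefficient is 0.\<close>

lemma pot_recurrence:
  assumes zero: "\<And>x. norm x < r \<Longrightarrow> pot k b e x = 0" and b: "2 * b \<ge> n + real k" and x: "norm x < r"
  shows "2 * b * pot (Suc k) (b + 1) e x = real k * (e \<bullet> e) * pot (k - 1) b e x"
proof -
  \<comment> \<open>The summand 1 avoids a division by 0 when \<open>e = 0\<close>. The choice of
    \<open>\<delta>\<close> keeps \<open>x + t *\<^sub>R e\<close> within the radius
    \<open>\<rho>\<close> halfway between \<open>norm x\<close> and \<open>r\<close>.\<close>
  define c where "c = norm e + 1"
  have c: "c > 0" by (simp add: c_def add_nonneg_pos)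
  define \<delta> where "\<delta> = (r - norm x) / (2 * c)"
  define \<rho> where "\<rho> = (norm x + r) / 2"
  have \<rho>: "\<rho> < r" using x by (simp add: \<rho>_def)
  have \<delta>: "\<delta> > 0" using x c by (simp add: \<delta>_def)
  have near: "norm (x + t *\<^sub>R e) \<le> \<rho>" if "t \<in> {- \<delta><..<\<delta>}" for t
  proof -
    have "\<bar>t\<bar> * norm e \<le> \<delta> * c" using that \<delta> by (intro mult_mono) (auto simp: c_def)
    also have "\<dots> = (r - norm x) / 2" using c by (simp add: \<delta>_def)
    finally show ?thesis using norm_triangle_ineq[of x "t *\<^sub>R e"] by (simp add: \<rho>_def)
  qed
  have b1: "2 * (b + 1) \<ge> n + real (Suc k)" using b by simp
  have b2: "2 * b \<ge> n + real (k - 1)" using b by simp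
  define F where "F t y = f y * ker k b e (x + t *\<^sub>R e) y" for t y
  define F' where "F' t y = 2 * b * (f y * ker (Suc k) (b + 1) e (x + t *\<^sub>R e) y) - real k * (e \<bullet> e) * (f y * ker (k - 1) b e (x + t *\<^sub>R e) y)" for t y
  define M where "M = \<bar>2 * b\<bar> * bound (Suc k) (b + 1) e \<rho> + \<bar>real k * (e \<bullet> e)\<bar> * bound (k - 1) b e \<rho>"
  have Fint: "integrable lborel (F t)" if "t \<in> {- \<delta><..<\<delta>}" for t
    unfolding F_def by (rule pot_integrable[OF _ b]) (use near[OF that] \<rho> in linarith)
  have F': "((\<lambda>t. F t y) has_real_derivative F' t y) (at t)" if t: "t \<in> {- \<delta><..<\<delta>}" for t y
  proof (cases "r < norm y")
    case True
    then have "y \<noteq> x + t *\<^sub>R e" using near[OF t] \<rho> by auto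
    from DERIV_cmult[OF ker_derivative[OF this, where k = k and b = b], of "f y"] show ?thesis
      unfolding F_def F'_def by (simp add: algebra_simps)
  next
    case False
    then show ?thesis using f0[of y] by (simp add: F_def F'_def)
  qed
  have bd: "\<bar>F' t y\<bar> \<le> M * \<bar>f y * norm y powr (- n)\<bar>" if t: "t \<in> {- \<delta><..<\<delta>}" for t y
  proof -
    have "\<bar>F' t y\<bar> \<le> \<bar>2 * b\<bar> * \<bar>f y * ker (Suc k) (b + 1) e (x + t *\<^sub>R e) y\<bar> + \<bar>real k * (e \<bullet> e)\<bar> * \<bar>f y * ker (k - 1) b e (x + t *\<^sub>R e) y\<bar>"
      unfolding F'_def abs_mult[symmetric] by (rule abs_triangle_ineq4)
    also have "\<dots> \<le> \<bar>2 * b\<bar> * (bound (Suc k) (b + 1) e \<rho> * \<bar>f y * norm y powr (- n)\<bar>) + \<bar>real k * (e \<bullet> e)\<bar> * (bound (k - 1) b e \<rho> * \<bar>f y * norm y powr (- n)\<bar>)"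
      by (intro add_mono mult_left_mono dominated[OF near[OF t] \<rho>] b1 b2) auto
    finally show ?thesis by (simp add: M_def distrib_right mult.assoc)
  qed
  have t0: "(0::real) \<in> {- \<delta><..<\<delta>}" using \<delta> by simp
  have "((\<lambda>t. LINT y|lborel. F t y) has_real_derivative (LINT y|lborel. F' 0 y)) (at 0)"
    by (rule has_derivative_under_integral(2)[OF t0 Fint F' bd]) (use fint in auto)
  moreover have "((\<lambda>t. LINT y|lborel. F t y) has_real_derivative 0) (at 0)"
  proof (rule has_field_derivative_transform_within_open[of "\<lambda>_. 0" 0 0 "{- \<delta><..<\<delta>}"])
    show "0 = (LINT y|lborel. F t y)" if "t \<in> {- \<delta><..<\<delta>}" for t
      using zero[of "x + t *\<^sub>R e"] near[OF that] \<rho> by (simp add: pot_def F_def)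
  qed (use \<delta> in auto)
  ultimately have "(LINT y|lborel. F' 0 y) = 0" by (rule DERIV_unique)
  moreover have "(LINT y|lborel. F' 0 y) = 2 * b * pot (Suc k) (b + 1) e x - real k * (e \<bullet> e) * pot (k - 1) b e x"
    using pot_integrable[OF x b1, of e] pot_integrable[OF x b2, of e] by (simp add: F'_def pot_def)
  ultimately show ?thesis by simp
qed

text \<open>Taking second derivatives and summing over an orthonormal basis is an application of the
  Laplacian; it raises the exponent because \<open>\<bar>x - y\<bar>\<^sup>-\<^sup>n\<close> is not harmonic.\<close>

lemma pot_zero_step:
  assumes zero: "\<And>x e. norm x < r \<Longrightarrow> pot 0 b e x = 0" and b: "2 * b \<ge> n" and x: "norm x < r"
  shows "pot 0 (b + 1) e x = 0"
proof -
  have npos: "n > 0" by (simp add: n)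
  have z1: "pot 1 (b + 1) e x = 0" if "norm x < r" for e x
    using pot_recurrence[of 0 b e x] zero that b npos by simp
  have z2: "2 * (b + 1) * pot 2 (b + 2) e x = (e \<bullet> e) * pot 0 (b + 1) e x" for e
    using pot_recurrence[of 1 "b + 1" e x] z1 x b by (simp add: numeral_2_eq_2 add.assoc)
  have p0: "pot 0 (b + 1) e x = pot 0 (b + 1) e' x" for e e' by (simp add: pot_def ker_def)
  have "(\<Sum>e\<in>Basis. pot 2 (b + 2) e x) = (LINT y|lborel. (\<Sum>e\<in>Basis. f y * ker 2 (b + 2) e x y))"
    unfolding pot_def by (rule Bochner_Integration.integral_sum[symmetric]) (use pot_integrable[OF x] b in simp)
  also have "\<dots> = pot 0 (b + 1) e x"
    unfolding pot_def
  proof (rule Bochner_Integration.integral_cong[OF refl])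
    fix y :: "real^'n"
    have "(\<Sum>e\<in>Basis. ((y - x) \<bullet> e)\<^sup>2) = (y - x) \<bullet> (y - x)"
      by (subst euclidean_inner[of "y - x" "y - x"]) (simp add: power2_eq_square)
    then have "(\<Sum>e\<in>Basis. f y * ker 2 (b + 2) e x y) = f y * (((y - x) \<bullet> (y - x)) * ((y - x) \<bullet> (y - x)) powr (- (b + 2)))"
      by (simp add: ker_def sum_distrib_left[symmetric] sum_distrib_right[symmetric])
    also have "((y - x) \<bullet> (y - x)) * ((y - x) \<bullet> (y - x)) powr (- (b + 2)) = ((y - x) \<bullet> (y - x)) powr (- (b + 1))"
    proof -
      have e: "1 + - (b + 2) = - (b + 1)" by simp
      show ?thesis using powr_mult_base[of "(y - x) \<bullet> (y - x)" "- (b + 2)"] unfolding e by simp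
    qed
    finally show "(\<Sum>e\<in>Basis. f y * ker 2 (b + 2) e x y) = f y * ker 0 (b + 1) e x y" by (simp add: ker_def)
  qed
  finally have "2 * (b + 1) * pot 0 (b + 1) e x = 2 * (b + 1) * (\<Sum>e\<in>Basis. pot 2 (b + 2) e x)"
    by simp
  also have "\<dots> = (\<Sum>e\<in>Basis. 2 * (b + 1) * pot 2 (b + 2) e x)" by (rule sum_distrib_left)
  also have "\<dots> = (\<Sum>e'\<in>(Basis :: (real^'n) set). pot 0 (b + 1) e x)"
    unfolding z2 using p0[of _ e] by (intro sum.cong) auto
  also have "\<dots> = n * pot 0 (b + 1) e x" by (simp add: n)
  \<comment> \<open>This is the factor \<open>2 * b + 2 - n\<close> in the Laplacian of the power
    \<open>- 2 * b\<close> of the distance. It is at least 2 here; it would vanish for the harmonic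
    exponent \<open>2 * b = n - 2\<close>.\<close>
  finally have "(2 * (b + 1) - n) * pot 0 (b + 1) e x = 0" by (simp add: algebra_simps)
  then show ?thesis using b by simp
qed

text \<open>The moments correspond to \<open>j = 0\<close>. In the recurrence, however, the lower
  index \<open>l - 1\<close> occurs with the same exponent \<open>b\<close>, that is with surplus
  \<open>Suc j\<close>, so the induction on \<open>k\<close> must cover every surplus. For
  \<open>k = 0\<close> the surplus is climbed by \<open>pot_zero_step\<close>.\<close>

lemma pot_moments:
  assumes zero: "\<And>x e. norm x < r \<Longrightarrow> pot 0 (n / 2) e x = 0"
  shows "norm x < r \<Longrightarrow> pot k (n / 2 + real k + real j) e x = 0"
proof (induction k arbitrary: j x e rule: less_induct)
  case (less k)
  have z0: "norm x < r \<Longrightarrow> pot 0 (n / 2 + real j) e x = 0" for j e x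
  proof (induction j arbitrary: x e)
    case (Suc j)
    have "pot 0 (n / 2 + real j + 1) e x = 0"
      by (rule pot_zero_step[OF Suc.IH _ Suc.prems]) auto
    then show ?case by (simp add: add_ac)
  qed (use zero in simp)
  show ?case
  proof (cases k)
    case 0
    then show ?thesis using z0[OF less.prems] by simp
  next
    case (Suc l)
    define b where "b = n / 2 + real l + real j"
    have b: "2 * b \<ge> n + real l" by (simp add: b_def)
    have "pot l b e x = 0" if "norm x < r" for x unfolding b_def by (rule less.IH) (use Suc that in auto)
    then have rec: "2 * b * pot (Suc l) (b + 1) e x = real l * (e \<bullet> e) * pot (l - 1) b e x"
      by (rule pot_recurrence[OF _ b less.prems])
    have "real l * pot (l - 1) b e x = 0"
    proof (cases l)
      case (Suc l')
      have "pot l' (n / 2 + real l' + real (Suc j)) e x = 0" by (rule less.IH) (use Suc \<open>k = Suc l\<close> less.prems in auto)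
      then show ?thesis using Suc by (simp add: b_def add_ac)
    qed simp
    then have "2 * b * pot (Suc l) (b + 1) e x = 0" unfolding rec by (metis mult.assoc mult.commute mult_zero_right)
    moreover have "b > 0" by (simp add: b_def n add_pos_nonneg)
    ultimately have "pot (Suc l) (b + 1) e x = 0" by simp
    then show ?thesis using Suc by (simp add: b_def add_ac)
  qed
qed

lemma abs_exp_partial_sum_le:
  fixes x :: real
  shows "\<bar>\<Sum>k<N. x ^ k /\<^sub>R fact k\<bar> \<le> exp \<bar>x\<bar>"
proof -
  have "\<bar>\<Sum>k<N. x ^ k /\<^sub>R fact k\<bar> \<le> (\<Sum>k<N. \<bar>x\<bar> ^ k /\<^sub>R fact k)"
    by (rule order_trans[OF sum_abs]) (simp add: abs_mult power_abs)
  also have "\<dots> \<le> (\<Sum>k. \<bar>x\<bar> ^ k /\<^sub>R fact k)"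
    by (rule sum_le_suminf[OF summable_exp_generic]) auto
  finally show ?thesis by (simp add: exp_def)
qed

end

text \<open>The moments concern powers of a single linear form, not mixed monomials. Exponentials of
  linear forms are series in such powers, and their products are again exponentials; so they yield
  an algebra that separates points, and no polarisation is required.\<close>

inductive exp_sum :: "(real^'n::finite \<Rightarrow> real) \<Rightarrow> bool" where
  base: "exp_sum (\<lambda>z. c * exp (z \<bullet> e))"
| add: "exp_sum f \<Longrightarrow> exp_sum g \<Longrightarrow> exp_sum (\<lambda>z. f z + g z)"

lemma exp_sum_base_mult: "exp_sum g \<Longrightarrow> exp_sum (\<lambda>z. c * exp (z \<bullet> e) * g z)"
proof (induction rule: exp_sum.induct)
  case (base c' e')
  have "(\<lambda>z. c * exp (z \<bullet> e) * (c' * exp (z \<bullet> e'))) = (\<lambda>z. (c * c') * exp (z \<bullet> (e + e')))"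
    by (simp add: inner_add_right exp_add mult_ac)
  then show ?case by (simp only: exp_sum.base)
next
  case (add f g)
  then show ?case using exp_sum.add[OF add.IH] by (simp add: distrib_left)
qed

lemma exp_sum_mult: "exp_sum f \<Longrightarrow> exp_sum g \<Longrightarrow> exp_sum (\<lambda>z. f z * g z)"
proof (induction rule: exp_sum.induct)
  case (base c e)
  then show ?case by (rule exp_sum_base_mult)
next
  case (add f1 f2)
  then show ?case using exp_sum.add[OF add.IH[OF add.prems]] by (simp add: distrib_right)
qed

lemma exp_sum_continuous: "exp_sum f \<Longrightarrow> continuous_on S f"
  by (induction rule: exp_sum.induct) (auto intro!: continuous_intros)

lemma exp_sum_dense:
  fixes q :: "real^'n::finite \<Rightarrow> real"
  assumes S: "compact S" and q: "continuous_on S q" and e: "e > 0"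
  shows "\<exists>g. exp_sum g \<and> (\<forall>z\<in>S. \<bar>q z - g z\<bar> < e)"
proof (rule Stone_Weierstrass_HOL[OF S _ exp_sum_continuous _ _ _ q e])
  show "exp_sum (\<lambda>z :: real^'n. c)" for c
    using exp_sum.base[of c 0] by simp
  show "exp_sum f \<and> exp_sum g \<Longrightarrow> exp_sum (\<lambda>x. f x + g x)" for f g :: "real^'n \<Rightarrow> real" by (blast intro: exp_sum.add)
  show "exp_sum f \<and> exp_sum g \<Longrightarrow> exp_sum (\<lambda>x. f x * g x)" for f g :: "real^'n \<Rightarrow> real" by (blast intro: exp_sum_mult)
  fix x y :: "real^'n" assume "x \<in> S \<and> y \<in> S \<and> x \<noteq> y"
  then have "(x - y) \<bullet> (x - y) \<noteq> 0" by simp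
  then have "x \<bullet> (x - y) \<noteq> y \<bullet> (x - y)" by (simp add: inner_diff_left)
  then show "\<exists>f. exp_sum f \<and> f x \<noteq> f y"
    using exp_sum.base[of 1 "x - y"] by (intro exI[of _ "\<lambda>z. 1 * exp (z \<bullet> (x - y))"]) simp
qed

context vanishing_potential begin

text \<open>After the inversion \<open>z = y / \<bar>y\<bar>\<^sup>2\<close> the vanishing moments say that a finite signed measure on a
  ball annihilates all polynomials.\<close>

lemma density_zero:
  assumes zero: "\<And>x e. norm x < r \<Longrightarrow> pot 0 (n / 2) e x = 0"
  shows "AE y in lborel. f y = 0"
proof -
  define p where "p y = f y * norm y powr (- n)" for y
  \<comment> \<open>The inversion is an involution of the whole space: the convention
    \<open>1 / 0 = 0\<close> fixes the origin. It maps the exterior into the compact ball of radius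
    \<open>1 / r\<close>, on which uniform approximation is available.\<close>
  define J where "J y = (1 / (y \<bullet> y)) *\<^sub>R y" for y :: "real^'n"
  have pint: "integrable lborel p" unfolding p_def by (rule fint)
  have [measurable]: "J \<in> borel_measurable borel" "p \<in> borel_measurable borel" unfolding J_def p_def by measurable
  have p0: "p y = 0" if "\<not> r < norm y" for y using f0[of y] that by (simp add: p_def)
  have JJ: "J (J y) = y" for y by (cases "y = 0") (auto simp: J_def)
  have nJ: "norm (J y) = 1 / norm y" for y
    by (cases "y = 0") (auto simp: J_def power2_norm_eq_inner[symmetric] power2_eq_square)
  have Jr: "J y \<in> cball 0 (1 / r)" if "r < norm y" for y
    using that r by (simp add: nJ frac_le)
  have bdd_int: "integrable lborel (\<lambda>y. p y * q y)"
    if [measurable]: "q \<in> borel_measurable borel" and B: "\<And>y. r < norm y \<Longrightarrow> \<bar>q y\<bar> \<le> B" for q B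
  proof (rule Bochner_Integration.integrable_bound)
    show "integrable lborel (\<lambda>y. \<bar>B\<bar> * \<bar>p y\<bar>)" using pint by auto
    have "\<bar>p y * q y\<bar> \<le> \<bar>B\<bar> * \<bar>p y\<bar>" for y
    proof (cases "r < norm y")
      case True
      then have "\<bar>q y\<bar> \<le> \<bar>B\<bar>" using B[OF True] by linarith
      then show ?thesis unfolding abs_mult by (subst mult.commute) (rule mult_right_mono, auto)
    qed (simp add: p0)
    then show "AE y in lborel. norm (p y * q y) \<le> norm (\<bar>B\<bar> * \<bar>p y\<bar>)" by simp
  qed measurable
  have moment: "(LINT y|lborel. p y * (J y \<bullet> e) ^ k) = 0" for k e
  proof -
    \<comment> \<open>At the centre and with surplus 0 the kernel is
      \<open>norm y powr (- n)\<close> times the k-th power of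
      \<open>J y \<bullet> e\<close>.\<close>
    have "(LINT y|lborel. p y * (J y \<bullet> e) ^ k) = pot k (n / 2 + real k + real 0) e 0"
      unfolding pot_def
    proof (rule Bochner_Integration.integral_cong[OF refl])
      fix y :: "real^'n"
      show "p y * (J y \<bullet> e) ^ k = f y * ker k (n / 2 + real k + real 0) e 0 y"
      proof (cases "r < norm y")
        case True
        then have y: "y \<noteq> 0" "y \<bullet> y > 0" using r by auto
        have e1: "- (n / 2 + real k + real 0) = - (n / 2) + (- real k)" by simp
        have "(y \<bullet> y) powr (- (n / 2 + real k + real 0)) = (y \<bullet> y) powr (- (n / 2)) * (y \<bullet> y) powr (- real k)"
          unfolding e1 by (rule powr_add)
        also have "(y \<bullet> y) powr (- (n / 2)) = norm y powr (- n)" unfolding inner_powr by simp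
        also have "(y \<bullet> y) powr (- real k) = (1 / (y \<bullet> y)) ^ k"
          using y by (simp add: powr_minus_divide powr_realpow power_one_over)
        finally show ?thesis by (simp add: ker_def p_def J_def power_mult_distrib power_divide mult_ac)
      next
        case False
        then show ?thesis using f0[of y] by (simp add: p_def)
      qed
    qed
    also have "\<dots> = 0" by (rule pot_moments[OF zero]) (use r in auto)
    finally show ?thesis .
  qed
  have Je: "\<bar>J y \<bullet> e\<bar> \<le> norm e / r" if "r < norm y" for y e
  proof -
    have "\<bar>J y \<bullet> e\<bar> \<le> norm (J y) * norm e" by (rule Cauchy_Schwarz_ineq2)
    also have "\<dots> \<le> (1 / r) * norm e" using Jr[OF that] by (intro mult_right_mono) auto
    finally show ?thesis by simp
  qed
  have expm: "(LINT y|lborel. p y * exp (J y \<bullet> e)) = 0" for e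
  proof -
    have "(\<lambda>N. LINT y|lborel. p y * (\<Sum>k<N. (J y \<bullet> e) ^ k /\<^sub>R fact k)) \<longlonglongrightarrow> (LINT y|lborel. p y * exp (J y \<bullet> e))"
    proof (rule integral_dominated_convergence[where w = "\<lambda>y. \<bar>p y\<bar> * exp (norm e / r)"])
      show "integrable lborel (\<lambda>y. \<bar>p y\<bar> * exp (norm e / r))" using pint by auto
      show "AE y in lborel. (\<lambda>N. p y * (\<Sum>k<N. (J y \<bullet> e) ^ k /\<^sub>R fact k)) \<longlonglongrightarrow> p y * exp (J y \<bullet> e)"
        by (intro AE_I2 tendsto_mult tendsto_const exp_converges[unfolded sums_def])
      show "AE y in lborel. norm (p y * (\<Sum>k<N. (J y \<bullet> e) ^ k /\<^sub>R fact k)) \<le> \<bar>p y\<bar> * exp (norm e / r)" for N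
      proof (rule AE_I2)
        fix y
        show "norm (p y * (\<Sum>k<N. (J y \<bullet> e) ^ k /\<^sub>R fact k)) \<le> \<bar>p y\<bar> * exp (norm e / r)"
        proof (cases "r < norm y")
          case True
          have "\<bar>\<Sum>k<N. (J y \<bullet> e) ^ k /\<^sub>R fact k\<bar> \<le> exp \<bar>J y \<bullet> e\<bar>" by (rule abs_exp_partial_sum_le)
          also have "\<dots> \<le> exp (norm e / r)" using Je[OF True] by simp
          finally show ?thesis unfolding real_norm_def abs_mult by (rule mult_left_mono) simp
        qed (simp add: p0)
      qed
    qed measurable
    moreover have "(LINT y|lborel. p y * (\<Sum>k<N. (J y \<bullet> e) ^ k /\<^sub>R fact k)) = 0" for N
    proof -
      have "integrable lborel (\<lambda>y. p y * (J y \<bullet> e) ^ k)" for k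
        by (rule bdd_int[where B = "(norm e / r) ^ k"]) (auto simp: power_abs intro!: power_mono Je)
      moreover have "p y * (\<Sum>k<N. (J y \<bullet> e) ^ k /\<^sub>R fact k) = (\<Sum>k<N. inverse (fact k) * (p y * (J y \<bullet> e) ^ k))" for y
        by (simp add: sum_distrib_left mult_ac)
      ultimately show ?thesis by (simp add: Bochner_Integration.integral_sum moment)
    qed
    ultimately show ?thesis by (simp add: LIMSEQ_const_iff)
  qed
  have exps: "integrable lborel (\<lambda>y. p y * q (J y)) \<and> (LINT y|lborel. p y * q (J y)) = 0" if "exp_sum q" for q
    using that
  proof (induction rule: exp_sum.induct)
    case (base c e)
    have i: "integrable lborel (\<lambda>y. p y * exp (J y \<bullet> e))"
      by (rule bdd_int[where B = "exp (norm e / r)"]) (use Je in \<open>auto intro: order_trans[OF abs_ge_self]\<close>)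
    have eq: "p y * (c * exp (J y \<bullet> e)) = c * (p y * exp (J y \<bullet> e))" for y by simp
    show ?case unfolding eq using i expm by simp
  next
    case (add f g)
    then show ?case by (simp add: distrib_left)
  qed
  have cont: "(LINT y|lborel. p y * q (J y)) = 0" if q: "continuous_on UNIV q" for q
  proof -
    have [measurable]: "q \<in> borel_measurable borel" by (rule borel_measurable_continuous_onI[OF q])
    have "bounded (q ` cball 0 (1 / r))"
      by (intro compact_imp_bounded compact_continuous_image continuous_on_subset[OF q]) auto
    then obtain B where B: "\<forall>z\<in>cball 0 (1 / r). \<bar>q z\<bar> \<le> B" unfolding bounded_iff by auto
    have qi: "integrable lborel (\<lambda>y. p y * q (J y))"
    proof (rule bdd_int)
      show "(\<lambda>y. q (J y)) \<in> borel_measurable borel" by measurable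
      show "\<bar>q (J y)\<bar> \<le> B" if "r < norm y" for y using B Jr[OF that] by blast
    qed
    have small: "\<bar>LINT y|lborel. p y * q (J y)\<bar> \<le> \<epsilon> * (LINT y|lborel. \<bar>p y\<bar>)" if \<epsilon>: "\<epsilon> > 0" for \<epsilon>
    proof -
      obtain g where g: "exp_sum g" "\<And>z. z \<in> cball 0 (1 / r) \<Longrightarrow> \<bar>q z - g z\<bar> < \<epsilon>"
        using exp_sum_dense[OF compact_cball continuous_on_subset[OF q] \<epsilon>, of 0 "1 / r"] by auto
      note gi = exps[OF g(1)]
      have "(LINT y|lborel. p y * q (J y)) = (LINT y|lborel. p y * q (J y) - p y * g (J y))"
        using qi gi by simp
      also have "\<bar>\<dots>\<bar> \<le> (LINT y|lborel. \<bar>p y * q (J y) - p y * g (J y)\<bar>)"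
        by (rule integral_abs_bound)
      also have "\<dots> \<le> (LINT y|lborel. \<epsilon> * \<bar>p y\<bar>)"
      proof (rule integral_mono)
        show "integrable lborel (\<lambda>y. \<bar>p y * q (J y) - p y * g (J y)\<bar>)" using qi gi by auto
        show "integrable lborel (\<lambda>y. \<epsilon> * \<bar>p y\<bar>)" using pint by auto
        fix y
        show "\<bar>p y * q (J y) - p y * g (J y)\<bar> \<le> \<epsilon> * \<bar>p y\<bar>"
        proof (cases "r < norm y")
          case True
          have "\<bar>p y * q (J y) - p y * g (J y)\<bar> = \<bar>q (J y) - g (J y)\<bar> * \<bar>p y\<bar>"
            by (simp add: abs_mult[symmetric] right_diff_distrib mult.commute)
          also have "\<dots> \<le> \<epsilon> * \<bar>p y\<bar>" using g(2)[OF Jr[OF True]] by (intro mult_right_mono) auto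
          finally show ?thesis .
        qed (simp add: p0)
      qed
      finally show ?thesis by simp
    qed
    have "\<bar>LINT y|lborel. p y * q (J y)\<bar> \<le> 0 + \<epsilon>" if \<epsilon>: "\<epsilon> > 0" for \<epsilon>
    proof -
      define I where "I = (LINT y|lborel. \<bar>p y\<bar>)"
      have I: "I \<ge> 0" by (simp add: I_def)
      then have "\<epsilon> / (I + 1) > 0" using \<epsilon> by simp
      from small[OF this] have "\<bar>LINT y|lborel. p y * q (J y)\<bar> \<le> \<epsilon> / (I + 1) * I" unfolding I_def .
      also have "\<dots> \<le> \<epsilon>" using I \<epsilon> by (simp add: field_simps)
      finally show ?thesis by simp
    qed
    then have "\<bar>LINT y|lborel. p y * q (J y)\<bar> \<le> 0" by (rule field_le_epsilon)
    then show ?thesis by simp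
  qed
  have "AE y in lborel. y \<in> {y. r < norm y} \<longrightarrow> p y = 0"
  proof (rule fundamental_lemma_box_bump)
    show "open {y :: real^'n. r < norm y}" by (intro open_Collect_less continuous_intros)
    show "integrable lborel (\<lambda>y. indicator (cbox a b) y * p y)" for a b
      using integrable_mult_indicator[OF _ pint, of "cbox a b"] by simp
    fix k a b assume ab: "cbox a b \<subseteq> {y :: real^'n. r < norm y}"
    \<comment> \<open>The bump seen through the inversion. A nonzero point of
      \<open>ball 0 (1 / R)\<close> is inverted to a norm above \<open>R\<close>, beyond the box, so
      \<open>q\<close> vanishes near the origin and is continuous everywhere; and
      \<open>q (J y)\<close> is the bump at \<open>y\<close>.\<close>
    define q where "q z = box_bump k a b (J z)" for z
    obtain R where R: "R > 0" "\<And>y. y \<in> cbox a b \<Longrightarrow> norm y \<le> R"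
      using bounded_cbox[of a b] unfolding bounded_pos by blast
    have bc: "continuous_on UNIV (box_bump k a b)" by (rule flat_alg_continuous[OF flat_alg_box_bump])
    have q0: "q z = 0" if "z \<in> ball 0 (1 / R)" for z
    proof -
      have "J z \<notin> cbox a b"
      proof
        assume in_box: "J z \<in> cbox a b"
        then have "r < norm (J z)" "norm (J z) \<le> R" using ab R by auto
        then have "z \<noteq> 0" using r nJ[of z] by auto
        then have "1 / norm z \<le> R" "0 < norm z" using \<open>norm (J z) \<le> R\<close> nJ[of z] by auto
        then have "1 / R \<le> norm z" using R(1) by (simp add: field_simps)
        then show False using that by simp
      qed
      then show ?thesis using box_bump_outside[of "J z" a b k] box_subset_cbox[of a b] by (auto simp: q_def)
    qed
    have "isCont q z" for z
    proof (cases "z = 0")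
      case True
      have "\<forall>\<^sub>F z in nhds 0. z \<in> ball 0 (1 / R)" using R(1) by (intro eventually_nhds_in_open) auto
      then have "\<forall>\<^sub>F z in nhds 0. q z = 0" by (rule eventually_mono) (rule q0)
      then have "isCont q 0 \<longleftrightarrow> isCont (\<lambda>z :: real^'n. 0 :: real) 0" by (rule isCont_cong)
      then show ?thesis using True by simp
    next
      case False
      then have 1: "isCont J z" unfolding J_def by (intro continuous_intros) auto
      have 2: "isCont (box_bump k a b) (J z)" using bc by (simp add: continuous_on_eq_continuous_at[OF open_UNIV])
      show ?thesis unfolding q_def by (rule isCont_o2[OF 1 2])
    qed
    then have "continuous_on UNIV q" by (simp add: continuous_at_imp_continuous_on)
    from cont[OF this] show "(LINT y|lborel. p y * box_bump k a b y) = 0" by (simp add: q_def JJ)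
  qed measurable
  then show ?thesis
  proof eventually_elim
    case (elim y)
    show ?case
    proof (cases "r < norm y")
      case True
      then have "norm y powr (- n) \<noteq> 0" using r by auto
      then show ?thesis using elim True by (simp add: p_def)
    next
      case False
      then show ?thesis using f0[of y] by simp
    qed
  qed
qed

end

section \<open>Injectivity of the Poisson operator, and the conclusion\<close>

context exterior_problem begin

text \<open>A vanishing L2 norm is blind to null sets, but the recurrence differentiates the
  potential and must know it at every point. Balls have positive measure, so each \<open>x\<close>
  is a limit of zeros of the potential, which is continuous by dominated convergence.\<close>

lemma potential_zero_everywhere:
  fixes f :: "real^'n \<Rightarrow> real"
  assumes vp: "vanishing_potential r (real CARD('n)) f"
    and ae: "AE x in lborel. norm x < r \<longrightarrow> vanishing_potential.pot f 0 (real CARD('n) / 2) e x = 0"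
    and x: "norm x < r"
  shows "vanishing_potential.pot f 0 (real CARD('n) / 2) e x = 0"
proof -
  interpret vanishing_potential r "real CARD('n)" f by (rule vp)
  let ?b = "real CARD('n) / 2"
  define \<rho> where "\<rho> = (norm x + r) / 2"
  define \<delta> where "\<delta> = (r - norm x) / 2"
  have \<rho>: "\<rho> < r" and \<delta>: "\<delta> > 0" using x by (auto simp: \<rho>_def \<delta>_def)
  have near: "norm z \<le> \<rho>" if "z \<in> ball x \<delta>" for z
    using that norm_triangle_ineq2[of z x] by (simp add: dist_norm norm_minus_commute \<rho>_def \<delta>_def)
  have "\<exists>z\<in>ball x (\<delta> / real (Suc j)). pot 0 ?b e z = 0" for j
  proof (rule ccontr)
    assume no: "\<not> (\<exists>z\<in>ball x (\<delta> / real (Suc j)). pot 0 ?b e z = 0)"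
    have sub: "ball x (\<delta> / real (Suc j)) \<subseteq> ball x \<delta>"
      using \<delta> by (intro subset_ball) (simp add: field_simps)
    have "AE z in lborel. z \<notin> ball x (\<delta> / real (Suc j))"
      using ae
    proof eventually_elim
      case (elim z)
      show ?case
      proof
        assume z: "z \<in> ball x (\<delta> / real (Suc j))"
        then have "norm z < r" using near sub \<rho> by fastforce
        then show False using elim no z by blast
      qed
    qed
    then have "ball x (\<delta> / real (Suc j)) \<in> null_sets lborel"
      by (subst (asm) AE_iff_null_sets[symmetric]) auto
    then have "negligible (ball x (\<delta> / real (Suc j)))"
      by (simp add: negligible_iff_null_sets null_sets_completionI)
    then have "ball x (\<delta> / real (Suc j)) = {}" using open_not_negligible[OF open_ball] by blast
    moreover have "\<delta> / real (Suc j) > 0" using \<delta> by (intro divide_pos_pos) auto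
    ultimately show False by (metis ball_eq_empty not_le)
  qed
  then obtain X where X: "\<And>j. X j \<in> ball x (\<delta> / real (Suc j))" "\<And>j. pot 0 ?b e (X j) = 0" by metis
  have Xn: "norm (X j) \<le> \<rho>" for j
  proof (rule near)
    have "ball x (\<delta> / real (Suc j)) \<subseteq> ball x \<delta>"
      using \<delta> by (intro subset_ball) (simp add: field_simps)
    then show "X j \<in> ball x \<delta>" using X(1) by blast
  qed
  have "X \<longlonglongrightarrow> x"
  proof (rule LIMSEQ_I)
    fix \<epsilon> :: real assume "\<epsilon> > 0"
    then obtain N where N: "inverse (real (Suc N)) < \<epsilon> / \<delta>" using reals_Archimedean[of "\<epsilon> / \<delta>"] \<delta> by auto
    have "norm (X j - x) < \<epsilon>" if "j \<ge> N" for j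
    proof -
      have "norm (X j - x) < \<delta> / real (Suc j)" using X(1)[of j] by (simp add: dist_norm norm_minus_commute)
      also have "\<dots> \<le> \<delta> / real (Suc N)" using that \<delta> by (intro divide_left_mono) auto
      also have "\<dots> < \<epsilon>" using N \<delta> by (simp add: field_simps)
      finally show ?thesis .
    qed
    then show "\<exists>N. \<forall>j\<ge>N. norm (X j - x) < \<epsilon>" by blast
  qed
  have "(\<lambda>j. LINT y|lborel. f y * ker 0 ?b e (X j) y) \<longlonglongrightarrow> (LINT y|lborel. f y * ker 0 ?b e x y)"
  proof (rule integral_dominated_convergence)
    show "integrable lborel (\<lambda>y. bound 0 ?b e \<rho> * \<bar>f y * norm y powr (- real CARD('n))\<bar>)" using fint by auto
    show "AE y in lborel. norm (f y * ker 0 ?b e (X j) y) \<le> bound 0 ?b e \<rho> * \<bar>f y * norm y powr (- real CARD('n))\<bar>" for j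
      using dominated[OF Xn \<rho>, of 0 ?b] by simp
    show "AE y in lborel. (\<lambda>j. f y * ker 0 ?b e (X j) y) \<longlonglongrightarrow> f y * ker 0 ?b e x y"
    proof (rule AE_I2)
      fix y
      show "(\<lambda>j. f y * ker 0 ?b e (X j) y) \<longlonglongrightarrow> f y * ker 0 ?b e x y"
      proof (cases "r < norm y")
        case True
        then have "(y - x) \<bullet> (y - x) \<noteq> 0" using x by auto
        then show ?thesis unfolding ker_def by (intro tendsto_intros \<open>X \<longlonglongrightarrow> x\<close>) blast
      qed (simp add: f0)
    qed
  qed measurable
  then have "(\<lambda>j. 0) \<longlonglongrightarrow> pot 0 ?b e x" using X(2) by (simp add: pot_def)
  then show ?thesis by (simp add: LIMSEQ_const_iff)
qed

lemma poisson_injective: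
  assumes h: "h \<in> H m" and z: "L2.nrm (lebesgue_on (ball 0 r)) (poisson_op s r h) = 0"
  shows "N h = 0"
proof -
  let ?n = "real CARD('n)"
  obtain w where w: "w \<in> borel_measurable borel" "\<And>x. x \<notin> E \<Longrightarrow> w x = 0" "AE x in lebesgue_on E. h x = w x"
    "(\<integral>\<^sup>+y. ennreal ((w y)\<^sup>2) * sphere_weight r s y \<partial>lborel) < \<infinity>"
    using sobolev_weighted_representative[OF h] by blast
  note w(1)[measurable]
  have rep1: "integrable lborel (\<lambda>y. w y * poisson_kernel s r y x)" if "x \<in> ball 0 r" for x
    by (rule poisson_representative(1)[OF sobolev_measurable[OF h] w(1) _ w(3,4) that]) (rule w(2))
  have rep3: "poisson_op s r h x = (LINT y|lborel. w y * poisson_kernel s r y x)" if "x \<in> ball 0 r" for x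
    by (rule poisson_representative(3)[OF sobolev_measurable[OF h] w(1) _ w(3,4) that]) (rule w(2))
  define f where "f y = (if r < norm y then w y * ((norm y)\<^sup>2 - r\<^sup>2) powr (- s) else 0)" for y
  have [measurable]: "f \<in> borel_measurable borel" unfolding f_def by measurable
  define c where "c x = poisson_const s CARD('n) * (r\<^sup>2 - (norm x)\<^sup>2) powr s" for x :: "real^'n"
  have c: "c x \<noteq> 0" if "norm x < r" for x
  proof -
    have "(norm x)\<^sup>2 < r\<^sup>2" using that by (intro power_strict_mono) auto
    moreover have "poisson_const s CARD('n) > 0" by (rule poisson_const_pos[OF s]) simp
    ultimately show ?thesis by (simp add: c_def)
  qed
  \<comment> \<open>The kernel is the product of a function of \<open>x\<close> without zeros in the
    ball, a function of \<open>y\<close> that is absorbed into \<open>f\<close>, and a power of the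
    distance.\<close>
  have wP: "w y * poisson_kernel s r y x = c x * (f y * norm (x - y) powr (- ?n))" if x: "norm x < r" for x y
  proof (cases "r < norm y")
    case True
    have ne: "norm (x - y) > 0" using x True by auto
    have "0 \<le> r\<^sup>2 - (norm x)\<^sup>2" "0 \<le> (norm y)\<^sup>2 - r\<^sup>2" using x True r by (auto intro: power_mono)
    then have "((r\<^sup>2 - (norm x)\<^sup>2) / ((norm y)\<^sup>2 - r\<^sup>2)) powr s = (r\<^sup>2 - (norm x)\<^sup>2) powr s * ((norm y)\<^sup>2 - r\<^sup>2) powr (- s)"
      by (simp add: powr_divide powr_minus_divide)
    moreover have "1 / norm (x - y) ^ CARD('n) = norm (x - y) powr (- ?n)"
      using ne by (simp add: powr_minus_divide powr_realpow)
    ultimately show ?thesis using True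
      by (simp only: poisson_kernel_def poisson_const_def c_def f_def if_True mult_ac)
  next
    case False
    have "w y * poisson_kernel s r y x = 0"
    proof (cases "norm y = r")
      case True
      then show ?thesis by (simp add: poisson_kernel_sphere s)
    next
      case ne: False
      then show ?thesis using w(2)[of y] False by (simp add: E_sphere)
    qed
    then show ?thesis using False by (simp add: f_def)
  qed
  have vp: "vanishing_potential r ?n f"
  proof
    \<comment> \<open>At \<open>x = 0\<close> the distance is \<open>norm y\<close>, so convergence
      of the Poisson integral at the centre is the integrability demanded of
      \<open>f\<close>.\<close>
    have "integrable lborel (\<lambda>y. c 0 * (f y * norm (0 - y) powr (- ?n)))"
      using rep1[of 0] r wP[of 0] by simp
    then show "integrable lborel (\<lambda>y. f y * norm y powr (- ?n))" using c[of 0] r by simp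
  qed (use r in \<open>auto simp: f_def\<close>)
  interpret vanishing_potential r ?n f by (rule vp)
  have pot: "c x * pot 0 (?n / 2) e x = poisson_op s r h x" if "norm x < r" for e x
  proof -
    have "pot 0 (?n / 2) e x = (LINT y|lborel. f y * norm (x - y) powr (- ?n))"
      unfolding pot_def ker_def inner_powr by (simp add: norm_minus_commute)
    then show ?thesis using rep3[of x] that wP[OF that] by simp
  qed
  have "poisson_op s r h \<in> square_integrable (lebesgue_on (ball 0 r))"
    by (rule poisson_bounded) (use h in blast)
  from L2_nrm_eq_0[OF this z]
  have "AE x in lborel. x \<in> ball 0 r \<longrightarrow> poisson_op s r h x = 0"
    by (subst (asm) AE_lebesgue_on_iff) auto
  then have ae: "AE x in lborel. norm x < r \<longrightarrow> pot 0 (?n / 2) e x = 0" for e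
  proof eventually_elim
    case (elim x)
    show ?case using elim pot[of x e] c[of x] by auto
  qed
  have "AE y in lborel. f y = 0"
    by (rule density_zero) (rule potential_zero_everywhere[OF vp ae])
  then have "AE y in lborel. y \<in> E \<longrightarrow> r < norm y \<longrightarrow> w y = 0"
  proof eventually_elim
    case (elim y)
    show ?case
    proof (intro impI)
      assume y: "r < norm y"
      then have "r\<^sup>2 < (norm y)\<^sup>2" using r by (intro power_strict_mono) auto
      then show "w y = 0" using elim y by (simp add: f_def)
    qed
  qed
  then have "AE y in lebesgue_on E. r < norm y \<longrightarrow> w y = 0" by (simp add: AE_lebesgue_on_iff[OF borel])
  with null_boundary w(3) have "AE y in lebesgue_on E. h y = 0"
    by eventually_elim (simp add: interior_E)
  then show ?thesis by (rule AE_zero_nrm[OF h])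
qed

abbreviation ball_ip :: "(real^'n \<Rightarrow> real) \<Rightarrow> (real^'n \<Rightarrow> real) \<Rightarrow> real" where
  "ball_ip f g \<equiv> LINT x|lebesgue_on (ball 0 r). f x * g x"

text \<open>The L2 product pulled back along the operator; boundedness and injectivity become
  comparisons of two seminorms on \<open>H m\<close>.\<close>

definition Kip :: "(real^'n \<Rightarrow> real) \<Rightarrow> (real^'n \<Rightarrow> real) \<Rightarrow> real" where
  "Kip h k = ball_ip (poisson_op s r h) (poisson_op s r k)"

lemma poisson_L2: "h \<in> H m \<Longrightarrow> poisson_op s r h \<in> square_integrable (lebesgue_on (ball 0 r))"
  by (rule poisson_bounded) blast

lemma semi_inner_Kip: "semi_inner_space (H m) Kip"
proof
  fix h k l and a b :: real
  assume h: "h \<in> H m" and k: "k \<in> H m"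
  show "(\<lambda>x. a * h x + b * k x) \<in> H m" by (rule sobolev_lin[OF h k])
  show "Kip h k = Kip k h" by (simp add: Kip_def mult.commute)
  assume l: "l \<in> H m"
  have "Kip (\<lambda>x. a * h x + b * k x) l
      = ball_ip (\<lambda>x. a * poisson_op s r h x + b * poisson_op s r k x) (poisson_op s r l)"
    unfolding Kip_def by (intro Bochner_Integration.integral_cong refl) (simp add: poisson_lin[OF h k])
  then show "Kip (\<lambda>x. a * h x + b * k x) l = a * Kip h l + b * Kip k l"
    unfolding Kip_def using L2.lin_left[OF poisson_L2[OF h] poisson_L2[OF k] poisson_L2[OF l]] by simp
next
  show "0 \<le> Kip h h" for h by (simp add: Kip_def)
qed

lemma Kip_nrm: "semi_inner_space.nrm Kip h = L2.nrm (lebesgue_on (ball 0 r)) (poisson_op s r h)"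
  by (simp add: semi_inner_space.nrm_def[OF semi_inner_Kip] L2.nrm_def Kip_def)

lemma tikhonov_setting: "\<exists>C. tikhonov_setting (H m) (sip m) Kip C"
proof (rule poisson_bounded)
  interpret K: semi_inner_space "H m" Kip by (rule semi_inner_Kip)
  fix C assume C: "\<And>h. h \<in> H m \<Longrightarrow> L2.nrm (lebesgue_on (ball 0 r)) (poisson_op s r h) \<le> C * N h"
  have "tikhonov_setting (H m) (sip m) Kip C"
  proof
    show "K.nrm h \<le> C * N h" if "h \<in> H m" for h using C[OF that] by (simp add: Kip_nrm)
    show "N h = 0" if "h \<in> H m" "K.nrm h = 0" for h
      using poisson_injective[OF that(1)] that(2) by (simp add: Kip_nrm)
    fix f :: "nat \<Rightarrow> real^'n \<Rightarrow> real"
    assume "\<And>k. f k \<in> H m" "\<And>e. e > 0 \<Longrightarrow> \<exists>K. \<forall>j\<ge>K. \<forall>k\<ge>K. N (\<lambda>x. f j x - f k x) < e"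
    then show "\<exists>h\<in>H m. (\<lambda>k. N (\<lambda>x. f k x - h x)) \<longlonglongrightarrow> 0" by (rule sobolev_complete)
  qed
  then show ?thesis by blast
qed

lemma tikhonov_eq:
  assumes t: "tikhonov_setting (H m) (sip m) Kip C" and g: "g \<in> H m" and h: "h \<in> H m"
  shows "tikhonov s r m (poisson_op s r g) \<alpha> h = tikhonov_setting.J (sip m) Kip g \<alpha> h"
proof -
  interpret K: semi_inner_space "H m" Kip by (rule semi_inner_Kip)
  have "L2_norm (ball 0 r) (\<lambda>x. poisson_op s r h x - poisson_op s r g x)
      = L2_norm (ball 0 r) (poisson_op s r (\<lambda>x. h x - g x))"
    unfolding L2_norm_def
  proof (intro arg_cong[of _ _ sqrt] Bochner_Integration.integral_cong refl)
    fix x :: "real^'n" assume "x \<in> space (lebesgue_on (ball 0 r))"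
    then show "(poisson_op s r h x - poisson_op s r g x)\<^sup>2 = (poisson_op s r (\<lambda>x. h x - g x) x)\<^sup>2"
      using poisson_lin[OF h g, of x 1 "-1"] by simp
  qed
  then show ?thesis
    unfolding tikhonov_def tikhonov_setting.J_def[OF t] L2_norm_eq Kip_nrm E[symmetric] sobolev_norm_eq by simp
qed

end

text \<open>The concrete and the abstract functional are identified on \<open>H m\<close> only,
  where the operator is known to be linear.\<close>

lemma is_arg_min_cong:
  assumes "\<And>h. P h \<Longrightarrow> f h = g h"
  shows "is_arg_min f P h \<longleftrightarrow> is_arg_min g P h"
  using assms by (auto simp: is_arg_min_def)

theorem theorem5p8:
  fixes s r :: real and m :: nat and g :: "real^'n::finite \<Rightarrow> real"
  assumes "0 < s" "s < 1" "r > 0"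
    and "real m > real CARD('n) / 2" "real CARD('n) / 2 \<ge> real m - 1"
    and "g \<in> sobolev_space (- ball 0 r) m"
  shows
    "(\<forall>h \<in> sobolev_space (- ball 0 r) m.
        (\<forall>x \<in> ball (0 :: real^'n) r.
           integrable (lebesgue_on (- ball 0 r)) (\<lambda>y. poisson_kernel s r y x * h y)) \<and>
        poisson_op s r h \<in> L2_space (ball 0 r)) \<and>
     (\<forall>\<alpha>>0.
        (\<exists>h. is_arg_min (tikhonov s r m (poisson_op s r g) \<alpha>)
               (\<lambda>h. h \<in> sobolev_space (- ball 0 r) m) h) \<and>
        (\<forall>h h'. is_arg_min (tikhonov s r m (poisson_op s r g) \<alpha>)
                  (\<lambda>h. h \<in> sobolev_space (- ball 0 r) m) h \<longrightarrow>
                is_arg_min (tikhonov s r m (poisson_op s r g) \<alpha>)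
                  (\<lambda>h. h \<in> sobolev_space (- ball 0 r) m) h' \<longrightarrow>
                (AE x in lebesgue_on (- ball 0 r). h x = h' x))) \<and>
     (\<forall>G. (\<forall>\<alpha>>0. is_arg_min (tikhonov s r m (poisson_op s r g) \<alpha>)
                    (\<lambda>h. h \<in> sobolev_space (- ball 0 r) m) (G \<alpha>)) \<longrightarrow>
          ((\<lambda>\<alpha>. sobolev_norm (- ball 0 r) m (\<lambda>x. G \<alpha> x - g x)) \<longlongrightarrow> 0) (at_right 0))"
proof -
  \<comment> \<open>The lower bound on \<open>m\<close> provides the one weak derivative that the
    Hardy inequality consumes.\<close>
  have "m \<ge> 1" using assms(4) by (cases m) auto
  then interpret exterior_problem r s "- ball 0 r :: (real^'n) set" m
    using assms by unfold_locales auto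
  obtain C where t: "tikhonov_setting (H m) (sip m) Kip C" using tikhonov_setting by blast
  interpret T: tikhonov_setting "H m" "sip m" Kip C by (rule t)
  have min: "is_arg_min (tikhonov s r m (poisson_op s r g) \<alpha>) (\<lambda>h. h \<in> H m) h
      \<longleftrightarrow> is_arg_min (T.J g \<alpha>) (\<lambda>h. h \<in> H m) h" for \<alpha> h
    by (rule is_arg_min_cong) (rule tikhonov_eq[OF t assms(6)])
  show ?thesis
  proof (intro conjI ballI allI impI)
    show "integrable (lebesgue_on (- ball 0 r)) (\<lambda>y. poisson_kernel s r y x * h y)"
      if "h \<in> H m" "x \<in> ball 0 r" for h x by (rule poisson_integrable[OF that])
    show "poisson_op s r h \<in> L2_space (ball 0 r)" if "h \<in> H m" for h
      unfolding L2_space_eq by (rule poisson_L2[OF that])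
  next
    fix \<alpha> :: real assume "\<alpha> > 0"
    then show "\<exists>h. is_arg_min (tikhonov s r m (poisson_op s r g) \<alpha>) (\<lambda>h. h \<in> H m) h"
      unfolding min by (rule T.minimiser_exists[OF assms(6)])
  next
    fix \<alpha> :: real and h h' assume \<alpha>: "\<alpha> > 0"
      and h: "is_arg_min (tikhonov s r m (poisson_op s r g) \<alpha>) (\<lambda>h. h \<in> H m) h"
      and h': "is_arg_min (tikhonov s r m (poisson_op s r g) \<alpha>) (\<lambda>h. h \<in> H m) h'"
    have V: "h \<in> H m" "h' \<in> H m" using h h' by (auto simp: is_arg_min_def)
    have "N (\<lambda>x. h x - h' x) = 0"
      by (rule T.minimiser_unique[OF assms(6) \<alpha> h[unfolded min] h'[unfolded min]])
    from nrm_eq_0[OF sob.diff_mem[OF V] this]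
    show "AE x in lebesgue_on (- ball 0 r). h x = h' x" by eventually_elim simp
  next
    fix G assume "\<forall>\<alpha>>0. is_arg_min (tikhonov s r m (poisson_op s r g) \<alpha>) (\<lambda>h. h \<in> H m) (G \<alpha>)"
    then show "((\<lambda>\<alpha>. sobolev_norm (- ball 0 r) m (\<lambda>x. G \<alpha> x - g x)) \<longlongrightarrow> 0) (at_right 0)"
      unfolding min sobolev_norm_eq by (intro T.minimisers_converge[OF assms(6)]) blast
  qed
qed

end
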